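(* Let $s>0$, let $h:\mathbb{R}^n\to[0,\infty)$ be a proper log-concave function and suppose that $\hslash_{B^{n+1}}^s$ is its John $s$-function. Let $f,g:\mathbb{R}\to\mathbb{R}$ be functions such that: $f$ is locally Lipschitz, convex, $f(x)=0$ for $x\le-1$, and $f$ is strictly increasing on $[-1,\infty)$; $g$ is locally Lipschitz, non-increasing, $g(x)=1$ for $x\le-1$, $g(x)>0$ for $x\in(-1,1)$, and $g(x)=0$ for $x\ge1$. Then for every $r\in(1/2,1)$ the restriction of $\bar L_r$ to $\mathcal{E}_+\cap({}^{(s)}\mathrm{SL}_{n+1}(\mathbb{R})\times\mathbb{R}^n)$ has a unique minimum $(A_r\oplus\alpha_r,v_r)$, up to horizontal translation, and $$\lim_{r\to1^-}(A_r\oplus\alpha_r,v_r)=(\bar{\mathrm{Id}},0).$$ Likewise, the restriction of $\bar I_r$ to $$\left\{\left(\frac{A\oplus\alpha-\bar{\mathrm{Id}}}{1-r},\frac{v}{1-r}\right):(A\oplus\alpha,v)\in\mathcal{E}_+\cap({}^{(s)}\mathrm{SL}_{n+1}(\mathbb{R})\times\mathbb{R}^n)\right\}$$ has the unique minimum $(M_r\oplus\beta_r,w_r)=\left(\frac{A_r\oplus\alpha_r-\bar{\mathrm{Id}}}{1-r},\frac{v_r}{1-r}\right)$, up to horizontal translation, and $${}^{(s)}\mathrm{tr}\left(\frac{M_r\oplus\beta_r}{\|M_r\oplus\beta_r\|_F}\right)\to0\quad\text{as } r\to1^-.$$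
   Context: Notation: $|\cdot|_2$ is the Euclidean norm, $B^d$ the closed unit Euclidean ball of $\mathbb{R}^d$, $\|\cdot\|_F$ the Frobenius norm, $\mathrm{Id}$ and $\bar{\mathrm{Id}}$ the identity matrices of size $n$ and $n+1$. For an $n\times n$ matrix $A$ and $\alpha\in\mathbb{R}$, $A\oplus\alpha$ is the block diagonal matrix with blocks $A$ and $\alpha$. A function $h:\mathbb{R}^n\to[0,\infty)$ is log-concave if $h=e^{-\varphi}$ with $\varphi:\mathbb{R}^n\to(-\infty,+\infty]$ convex; it is proper if moreover it is upper semicontinuous and has finite positive integral. John $s$-function: the $s$-lifting of $h$ is ${}^{(s)}\bar h=\{(x,\xi)\in\mathbb{R}^{n}\times\mathbb{R}:|\xi|\le h(x)^{1/s}\}$. An $n$-symmetric ellipsoid in $\mathbb{R}^{n+1}$ is a set $(A\oplus\alpha)B^{n+1}+(a,0)$ with $A$ symmetric positive definite $n\times n$, $\alpha>0$, $a\in\mathbb{R}^n$. The $s$-volume of a Borel set $\bar C\subset\mathbb{R}^{n+1}$ symmetric under $(x,t)\mapsto(x,-t)$ is $\int_{\mathbb{R}^n}[\frac12 \ell(\bar C\cap l_x)]^s dx$, where $l_x=\{x\}\times\mathbb{R}$ and $\ell$ is one-dimensional Lebesgue measure; the $s$-volume of $(A\oplus\alpha)B^{n+1}+(a,0)$ is $\alpha^s\det(A)$ times that of $B^{n+1}$. For a proper log-concave $h$ there is a unique $n$-symmetric ellipsoid of maximal $s$-volume contained in ${}^{(s)}\bar h$, the John $s$-ellipsoid $\bar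 E$ of $h$; the function $x\mapsto[\frac12\ell(\bar E\cap l_x)]^s$ is the John $s$-function of $h$. With $\hslash_{B^{n+1}}(x)=\sqrt{1-|x|_2^2}$ for $x\in B^n$ and $0$ otherwise, "$\hslash_{B^{n+1}}^s$ is the John $s$-function of $h$" means that $B^{n+1}$ is the John $s$-ellipsoid of $h$. $\mathcal{E}_+=\{(A\oplus\alpha,a):A \text{ symmetric positive definite } n\times n,\ \alpha>0,\ a\in\mathbb{R}^n\}$; ${}^{(s)}\mathrm{SL}_{n+1}(\mathbb{R})=\{M\oplus\beta: M\in \mathbb{R}^{n\times n},\ \beta>0,\ \beta^s\det(M)=1\}$; ${}^{(s)}\mathrm{tr}(M\oplus\beta)=s\beta+\mathrm{tr}(M)$. For $\gamma:\mathbb{R}\to\mathbb{R}$ and $r\in(1/2,1)$ put $\gamma_r(t)=\gamma\left(\frac{t-1}{1-r}\right)$. For $A\in\mathbb{R}^{n\times n}$, $\alpha>0$, $v\in\mathbb{R}^n$, $$\bar L_r(A\oplus\alpha,v)=\frac1{1-r}\int_{\mathbb{R}^n}\int_0^\infty f_r\left(\frac{\alpha y}{h(Ax+v)^{1/s}}\right)g_r\left(\frac{|x|_2^2+y^2-1}{2h(x)^{2/s}}+1\right)dy\,dx.$$ For $M$ symmetric $n\times n$, $\beta\in\mathbb{R}$, $w\in\mathbb{R}^n$ with $\tilde A_r=\mathrm{Id}+(1-r)M$ invertible and $\tilde\alpha_r=1+(1-r)\beta>0$, $$\bar I_r(M\oplus\beta,w)=\frac{\tilde\alpha_r^{s-1}}{1-r}\int_{\mathbb{R}^n}\int_0^\infty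 f_r\left(\frac{y}{h(x)^{1/s}}\right)g_r\left(\frac{|\tilde A_r^{-1}(x-(1-r)w)|_2^2+(\tilde\alpha_r^{-1}y)^2-1}{2h(\tilde A_r^{-1}(x-(1-r)w))^{2/s}}+1\right)dy\,dx.$$ "Unique up to horizontal translation" means that a minimum exists and any two minimizers have the same matrix part ($A\oplus\alpha$, resp. $M\oplus\beta$), possibly differing only in the vector component in $\mathbb{R}^n$. *)

theory Defs
  imports "HOL-Analysis.Analysis"
begin

section \<open>Proper log-concave functions\<close>

text \<open>
  \<open>\<real>\<^sup>n\<close> is \<open>real ^ 'n\<close> with \<open>n = CARD('n)\<close>, and \<open>\<real>\<^sup>n\<^sup>+\<^sup>1\<close> is \<open>(real ^ 'n) \<times> real\<close>, whose library norm
  \<open>norm (x, t) = sqrt ((norm x)\<^sup>2 + t\<^sup>2)\<close> is the Euclidean one.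
\<close>

text \<open>Used only for \<open>\<phi> > -\<infinity>\<close>; the value at \<open>-\<infinity>\<close> is immaterial.\<close>

definition exp_minus :: "ereal \<Rightarrow> real" where
  "exp_minus u = (case u of ereal t \<Rightarrow> exp (- t) | PInfty \<Rightarrow> 0 | MInfty \<Rightarrow> 0)"

definition convex_ext :: "('a::real_vector \<Rightarrow> ereal) \<Rightarrow> bool" where
  "convex_ext \<phi> \<longleftrightarrow> (\<forall>x. \<phi> x \<noteq> -\<infinity>) \<and>
     (\<forall>x y t. 0 < t \<and> t < 1 \<longrightarrow>
        \<phi> ((1 - t) *\<^sub>R x + t *\<^sub>R y) \<le> ereal (1 - t) * \<phi> x + ereal t * \<phi> y)"

definition log_concave :: "('a::real_vector \<Rightarrow> real) \<Rightarrow> bool" where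
  "log_concave h \<longleftrightarrow> (\<exists>\<phi>. convex_ext \<phi> \<and> (\<forall>x. h x = exp_minus (\<phi> x)))"

definition proper_log_concave :: "('a::euclidean_space \<Rightarrow> real) \<Rightarrow> bool" where
  "proper_log_concave h \<longleftrightarrow> log_concave h \<and> (\<forall>c. open {x. h x < c}) \<and>
     integrable lborel h \<and> 0 < (\<integral>x. h x \<partial>lborel)"

section \<open>Block diagonal matrices\<close>

text \<open>
  The block diagonal matrix \<open>A \<oplus> \<alpha>\<close> of size \<open>n + 1\<close> is represented by the pair of its blocks \<open>(A, \<alpha>)\<close>;
  it acts on \<open>\<real>\<^sup>n \<times> \<real>\<close> by \<open>(x, t) \<mapsto> (A x, \<alpha> t)\<close>, and linear operations and limits of such matrices
  are those of the product space. In particular the identity of size \<open>n + 1\<close> is \<open>(mat 1, 1)\<close>.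
\<close>

type_synonym 'n block = "(real ^ 'n ^ 'n) \<times> real"

definition spd :: "real ^ 'n ^ 'n \<Rightarrow> bool" where
  "spd A \<longleftrightarrow> transpose A = A \<and> (\<forall>x. x \<noteq> 0 \<longrightarrow> 0 < x \<bullet> (A *v x))"

definition E_plus :: "('n::finite block \<times> (real ^ 'n)) set" where
  "E_plus = {((A, \<alpha>), a). spd A \<and> 0 < \<alpha>}"

definition SL :: "real \<Rightarrow> 'n::finite block set" where
  "SL s = {(M, \<beta>). 0 < \<beta> \<and> \<beta> powr s * det M = 1}"

definition s_trace :: "real \<Rightarrow> 'n::finite block \<Rightarrow> real" where
  "s_trace s = (\<lambda>(M, \<beta>). s * \<beta> + trace M)"

definition frobenius_norm :: "'n::finite block \<Rightarrow> real" where
  "frobenius_norm = (\<lambda>(M, \<beta>). sqrt ((\<Sum>i\<in>UNIV. \<Sum>j\<in>UNIV. (M $ i $ j)\<^sup>2) + \<beta>\<^sup>2))"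

section \<open>The John \<open>s\<close>-ellipsoid\<close>

definition s_lifting :: "real \<Rightarrow> (real ^ 'n \<Rightarrow> real) \<Rightarrow> ((real ^ 'n) \<times> real) set" where
  "s_lifting s h = {(x, \<xi>). \<bar>\<xi>\<bar> \<le> h x powr (1 / s)}"

definition n_symmetric_ellipsoid :: "((real ^ 'n) \<times> real) set \<Rightarrow> bool" where
  "n_symmetric_ellipsoid C \<longleftrightarrow>
     (\<exists>A \<alpha> a. spd A \<and> 0 < \<alpha> \<and> C = (\<lambda>(x, t). (A *v x + a, \<alpha> * t)) ` cball 0 1)"

definition ennreal_powr :: "ennreal \<Rightarrow> real \<Rightarrow> ennreal" where
  "ennreal_powr m s = (if m = \<infinity> then \<infinity> else ennreal (enn2real m powr s))"

definition s_volume :: "real \<Rightarrow> ((real ^ 'n) \<times> real) set \<Rightarrow> ennreal" where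
  "s_volume s C = (\<integral>\<^sup>+x. ennreal_powr (emeasure lborel {t. (x, t) \<in> C} / 2) s \<partial>lborel)"

text \<open>
  For proper log-concave \<open>h\<close> and \<open>s > 0\<close> there is exactly one set satisfying this predicate.
  That \<open>x \<mapsto> sqrt (1 - (norm x)\<^sup>2) powr s\<close> on the unit ball (and \<open>0\<close> outside) is the John \<open>s\<close>-function of
  \<open>h\<close> means, by definition, that this set is the unit ball \<open>cball 0 1\<close> of \<open>\<real>\<^sup>n\<^sup>+\<^sup>1\<close>.
\<close>

definition John_s_ellipsoid :: "real \<Rightarrow> (real ^ 'n \<Rightarrow> real) \<Rightarrow> ((real ^ 'n) \<times> real) set \<Rightarrow> bool" where
  "John_s_ellipsoid s h C \<longleftrightarrow> n_symmetric_ellipsoid C \<and> C \<subseteq> s_lifting s h \<and>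
     (\<forall>C'. n_symmetric_ellipsoid C' \<and> C' \<subseteq> s_lifting s h \<longrightarrow> s_volume s C' \<le> s_volume s C)"

section \<open>The functionals\<close>

definition locally_lipschitz :: "(real \<Rightarrow> real) \<Rightarrow> bool" where
  "locally_lipschitz \<gamma> \<longleftrightarrow> (\<forall>x. \<exists>u>0. \<exists>L. L-lipschitz_on (cball x u) \<gamma>)"

definition rescaled :: "(real \<Rightarrow> real) \<Rightarrow> real \<Rightarrow> real \<Rightarrow> real" where
  "rescaled \<gamma> r t = \<gamma> ((t - 1) / (1 - r))"

text \<open>
  The integrands contain quotients by powers of \<open>h\<close>, which may vanish. The quotients are therefore
  formed in \<^typ>\<open>ereal\<close>, where \<open>t / 0\<close> is \<open>\<infinity>\<close> for \<open>t > 0\<close> and \<open>-\<infinity>\<close> for \<open>t < 0\<close>, and \<open>f\<^sub>r\<close>, \<open>g\<^sub>r\<close> are extended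
  to \<open>\<plusminus>\<infinity>\<close> by their limits (so \<open>f\<^sub>r \<infinity> = \<infinity>\<close> and \<open>g\<^sub>r \<infinity> = 0\<close>). A product \<open>\<infinity> * 0\<close>
  is \<open>0\<close>: points where \<open>g\<^sub>r\<close> vanishes do not contribute. The functions \<open>f\<close>, \<open>g\<close> of the theorem are
  non-negative, so \<^const>\<open>ennreal\<close> truncates nothing; the integrals may take the value \<open>\<infinity>\<close>.
\<close>

definition ext_by_limits :: "(real \<Rightarrow> real) \<Rightarrow> ereal \<Rightarrow> ennreal" where
  "ext_by_limits \<gamma> u = (case u of
       ereal t \<Rightarrow> ennreal (\<gamma> t)
     | PInfty \<Rightarrow> Lim at_top (\<lambda>t. ennreal (\<gamma> t))
     | MInfty \<Rightarrow> Lim at_bot (\<lambda>t. ennreal (\<gamma> t)))"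

definition L_bar :: "real \<Rightarrow> (real ^ 'n \<Rightarrow> real) \<Rightarrow> (real \<Rightarrow> real) \<Rightarrow> (real \<Rightarrow> real) \<Rightarrow> real \<Rightarrow>
    'n::finite block \<times> (real ^ 'n) \<Rightarrow> ennreal" where
  "L_bar s h f g r = (\<lambda>((A, \<alpha>), v).
     ennreal (1 / (1 - r)) *
     (\<integral>\<^sup>+x. (\<integral>\<^sup>+y\<in>{0<..}.
        ext_by_limits (rescaled f r) (ereal (\<alpha> * y) / ereal (h (A *v x + v) powr (1 / s))) *
        ext_by_limits (rescaled g r)
          (ereal ((norm x)\<^sup>2 + y\<^sup>2 - 1) / ereal (2 * h x powr (2 / s)) + 1)
      \<partial>lborel) \<partial>lborel))"

definition I_bar :: "real \<Rightarrow> (real ^ 'n \<Rightarrow> real) \<Rightarrow> (real \<Rightarrow> real) \<Rightarrow> (real \<Rightarrow> real) \<Rightarrow> real \<Rightarrow>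
    'n::finite block \<times> (real ^ 'n) \<Rightarrow> ennreal" where
  "I_bar s h f g r = (\<lambda>((M, \<beta>), w).
     let A = mat 1 + (1 - r) *\<^sub>R M;
         \<alpha> = 1 + (1 - r) * \<beta>;
         T = (\<lambda>x. matrix_inv A *v (x - (1 - r) *\<^sub>R w))
     in ennreal (\<alpha> powr (s - 1) / (1 - r)) *
        (\<integral>\<^sup>+x. (\<integral>\<^sup>+y\<in>{0<..}.
           ext_by_limits (rescaled f r) (ereal y / ereal (h x powr (1 / s))) *
           ext_by_limits (rescaled g r)
             (ereal ((norm (T x))\<^sup>2 + (inverse \<alpha> * y)\<^sup>2 - 1) / ereal (2 * h (T x) powr (2 / s)) + 1)
         \<partial>lborel) \<partial>lborel))"

section \<open>Minimisation\<close>

definition feasible :: "real \<Rightarrow> ('n::finite block \<times> (real ^ 'n)) set" where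
  "feasible s = E_plus \<inter> (SL s \<times> UNIV)"

definition renormalize :: "real \<Rightarrow> 'n::finite block \<times> (real ^ 'n) \<Rightarrow> 'n block \<times> (real ^ 'n)" where
  "renormalize r = (\<lambda>(B, v). ((1 / (1 - r)) *\<^sub>R (B - (mat 1, 1)), (1 / (1 - r)) *\<^sub>R v))"

abbreviation minimizer_on ::
    "('n::finite block \<times> (real ^ 'n) \<Rightarrow> ennreal) \<Rightarrow> ('n block \<times> (real ^ 'n)) set \<Rightarrow>
     'n block \<times> (real ^ 'n) \<Rightarrow> bool" where
  "minimizer_on F D p \<equiv> is_arg_min F (\<lambda>q. q \<in> D) p"

definition unique_min_up_to_translation ::
    "('n::finite block \<times> (real ^ 'n) \<Rightarrow> ennreal) \<Rightarrow> ('n block \<times> (real ^ 'n)) set \<Rightarrow> bool" where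
  "unique_min_up_to_translation F D \<longleftrightarrow>
     (\<exists>p. minimizer_on F D p) \<and>
     (\<forall>p q. minimizer_on F D p \<and> minimizer_on F D q \<longrightarrow> fst p = fst q)"

end

theory Submission
  imports Defs
begin

text \<open>
  Put \<open>q = h powr (1 / s)\<close>. Since \<open>q\<close> is log-concave, \<open>\<alpha> y / q (A x + v)\<close> is jointly convex in
  \<open>(A, log \<alpha>, v)\<close>, and \<open>det\<close> is strictly log-concave on positive definite matrices; hence two minimizers
  with different matrix parts would have a strictly better feasible point between them, unless the
  integral vanished there, in which case the ellipsoid \<open>A \<oplus> \<alpha> / r\<close> would be contained in the lifting
  and violate the maximality of the unit ball. Existence follows by the direct method: \<open>q\<close> is upper semicontinuous and
  decays exponentially, which makes \<open>L_bar\<close> lower semicontinuous and coercive on the feasible set.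

  The value of \<open>L_bar\<close> at the identity is bounded uniformly in \<open>r\<close>, whereas \<open>L_bar\<close> dominates,
  up to a constant factor, \<open>(1 - r) powr -2\<close> times the integral of the positive part of \<open>\<alpha> y / q (A x + v) - 1\<close> over the upper half
  ball. So this integral tends to \<open>0\<close> along the minimizers, and its only feasible zero is the identity,
  by uniqueness of the John ellipsoid. An affine change of variables turns \<open>I_bar\<close> into \<open>L_bar\<close>, and the
  statement on traces is the first-order expansion of \<open>\<beta>\<^sup>s det M = 1\<close> at the identity.
\<close>

section \<open>Positive definite matrices\<close>

text \<open>The gain at the midpoint of two minimizers is due to the determinant alone. The
  integrand is convex but not strictly so: \<open>f\<close> may be affine on an interval, and
  \<open>q\<close> may be constant along a segment. But for A1 \<noteq> A2 the determinant of the
  midpoint strictly exceeds the geometric mean, so the volume constraint puts \<alpha> strictly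
  below the geometric mean of \<alpha>1 and \<alpha>2, and strict monotonicity of \<open>f\<close>
  beyond -1 turns this into a gain. The argument gives nothing when only v differs, whence
  uniqueness up to translation. The functional \<open>excess\<close>, independent of r, serves
  twice: its sublevel sets in the feasible set are relatively compact, which gives existence for
  each r, and its only zero there is the identity, which gives the limit. It is taken over the half
  ball because there the argument of \<open>g\<close> is at most 0, so that the weight is at least
  \<open>g 0\<close> for every r. Since h may vanish and is only upper semicontinuous, all
  functionals take values in \<open>ennreal\<close>, limits pass through Fatou's lemma, and
  inequalities valid almost everywhere are extended to all points by openness of the sets q <
  c.\<close>

lemma linear_term_zero_if_quadratic_nonpos:
  fixes b c :: real
  assumes "\<And>t. 2 * t * b + t\<^sup>2 * c \<le> 0"
  shows "b = 0"
proof (rule ccontr)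
  assume "b \<noteq> 0"
  \<comment> \<open>With this t the linear term equals
    \<open>2 * t\<^sup>2 * (\<bar>c\<bar> + 1)\<close>, which outweighs \<open>t\<^sup>2 * c\<close>
    whatever the sign of c.\<close>
  define t where "t = b / (\<bar>c\<bar> + 1)"
  have p: "\<bar>c\<bar> + 1 > 0" by simp
  have tc: "b = t * (\<bar>c\<bar> + 1)" using p by (simp add: t_def)
  have t2: "t\<^sup>2 > 0" using \<open>b \<noteq> 0\<close> p by (simp add: t_def)
  have "2 * t * b + t\<^sup>2 * c = t\<^sup>2 * (2 * (\<bar>c\<bar> + 1) + c)"
    by (subst tc) (simp add: algebra_simps power2_eq_square)
  moreover have "2 * (\<bar>c\<bar> + 1) + c > 0" by (simp add: abs_if)
  ultimately have "2 * t * b + t\<^sup>2 * c > 0" using t2 by simp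
  then show False using assms[of t] by linarith
qed

text \<open>The eigenvector found here maximizes the Rayleigh quotient on the unit sphere of \<open>S\<close>.\<close>

lemma self_adjoint_eigenvector:
  fixes f :: "'a::euclidean_space \<Rightarrow> 'a"
  assumes lin: "linear f" and adj: "\<And>x y. f x \<bullet> y = x \<bullet> f y"
    and S: "subspace S" "f ` S \<subseteq> S" "S \<noteq> {0}"
  obtains e c where "e \<in> S" "norm e = 1" "f e = c *\<^sub>R e"
proof -
  obtain z where z: "z \<in> S" "z \<noteq> 0" using S subspace_0 by blast
  have "z /\<^sub>R norm z \<in> S \<inter> sphere 0 1"
    using z S by (auto simp: subspace_scale)
  then have ne: "S \<inter> sphere 0 1 \<noteq> {}" by blast
  have comp: "compact (S \<inter> sphere 0 1)"
    by (intro closed_Int_compact closed_subspace S compact_sphere)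
  have cont: "continuous_on (S \<inter> sphere 0 1) (\<lambda>x. x \<bullet> f x)"
    by (intro continuous_intros linear_continuous_on lin linear_conv_bounded_linear[THEN iffD1])
  obtain e where e: "e \<in> S \<inter> sphere 0 1" and mx: "\<And>x. x \<in> S \<inter> sphere 0 1 \<Longrightarrow> x \<bullet> f x \<le> e \<bullet> f e"
    using continuous_attains_sup[OF comp ne cont] by blast
  define c where "c = e \<bullet> f e"
  have ne1: "norm e = 1" and eS: "e \<in> S" using e by auto
  have ee: "e \<bullet> e = 1" using ne1 by (simp add: dot_square_norm)
  have bd: "x \<bullet> f x \<le> c * (x \<bullet> x)" if "x \<in> S" for x
  proof (cases "x = 0")
    case True
    then show ?thesis by simp
  next
    case False
    then have "x /\<^sub>R norm x \<in> S \<inter> sphere 0 1" using that S by (auto simp: subspace_scale)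
    from mx[OF this] have "(x \<bullet> f x) / (norm x)\<^sup>2 \<le> c"
      by (simp add: c_def linear_scale[OF lin] power2_eq_square divide_simps)
    then show ?thesis using False by (simp add: divide_simps dot_square_norm mult.commute)
  qed
  have orth: "u \<bullet> f e = 0" if u: "u \<in> S" "u \<bullet> e = 0" for u
  proof (rule linear_term_zero_if_quadratic_nonpos)
    fix t :: real
    have "e + t *\<^sub>R u \<in> S" using S eS u by (simp add: subspace_add subspace_scale)
    from bd[OF this]
    have "(e + t *\<^sub>R u) \<bullet> f (e + t *\<^sub>R u) \<le> c * ((e + t *\<^sub>R u) \<bullet> (e + t *\<^sub>R u))" .
    moreover have "(e + t *\<^sub>R u) \<bullet> f (e + t *\<^sub>R u) = c + 2 * t * (u \<bullet> f e) + t\<^sup>2 * (u \<bullet> f u)"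
      by (simp add: linear_add[OF lin] linear_scale[OF lin] inner_add_left inner_add_right c_def
          power2_eq_square adj[of e u, symmetric] inner_commute[of "f e" u] algebra_simps)
    moreover have "(e + t *\<^sub>R u) \<bullet> (e + t *\<^sub>R u) = 1 + t\<^sup>2 * (u \<bullet> u)"
      using u by (simp add: inner_add_left inner_add_right ee inner_commute[of e u] power2_eq_square)
    ultimately have "c + 2 * t * (u \<bullet> f e) + t\<^sup>2 * (u \<bullet> f u) \<le> c * (1 + t\<^sup>2 * (u \<bullet> u))"
      by simp
    then show "2 * t * (u \<bullet> f e) + t\<^sup>2 * (u \<bullet> f u - c * (u \<bullet> u)) \<le> 0"
      by (simp add: algebra_simps)
  qed
  define u where "u = f e - c *\<^sub>R e"
  have uS: "u \<in> S" unfolding u_def using S eS by (auto simp: subspace_diff subspace_scale)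
  have ue: "u \<bullet> e = 0" by (simp add: u_def inner_diff_left ee c_def) (simp add: inner_commute)
  have "u \<bullet> u = u \<bullet> f e - c * (u \<bullet> e)" by (subst (2) u_def) (simp add: inner_diff_right)
  then have "u = 0" using orth[OF uS ue] ue by simp
  then have "f e = c *\<^sub>R e" by (simp add: u_def)
  then show thesis using that ne1 eS by blast
qed

text \<open>Induction on the dimension: by self-adjointness the orthogonal complement of an
  eigenvector inside S is again invariant, and it is smaller. The formulation for invariant
  subspaces is what the induction requires; only the whole space is used later.\<close>

lemma self_adjoint_orthonormal_eigenbasis:
  fixes f :: "'a::euclidean_space \<Rightarrow> 'a"
  assumes lin: "linear f" and adj: "\<And>x y. f x \<bullet> y = x \<bullet> f y"
    and "subspace S" "f ` S \<subseteq> S"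
  shows "\<exists>B. pairwise orthogonal B \<and> (\<forall>b\<in>B. norm b = 1 \<and> (\<exists>c. f b = c *\<^sub>R b)) \<and> span B = S"
  using assms(3,4)
proof (induction "dim S" arbitrary: S rule: less_induct)
  case less
  show ?case
  proof (cases "S = {0}")
    case True
    then show ?thesis by (intro exI[of _ "{}"]) auto
  next
    case False
    obtain e c where e: "e \<in> S" "norm e = 1" "f e = c *\<^sub>R e"
      using self_adjoint_eigenvector[OF lin adj less.prems False] by blast
    have ee: "e \<bullet> e = 1" using e by (simp add: dot_square_norm)
    define S' where "S' = {x \<in> S. x \<bullet> e = 0}"
    have sub: "subspace S'" using less.prems(1)
      by (auto simp: S'_def subspace_def inner_add_left)
    have inv: "f ` S' \<subseteq> S'" using less.prems(2) e adj by (auto simp: S'_def)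
    have "e \<notin> S'" "S' \<subseteq> S" using ee by (auto simp: S'_def)
    then have "S' \<subset> S" using e by blast
    then have "dim S' < dim S"
      using dim_psubset sub less.prems(1) by (metis span_eq_iff)
    from less.hyps[OF this sub inv] obtain B where B: "pairwise orthogonal B"
      "\<forall>b\<in>B. norm b = 1 \<and> (\<exists>c. f b = c *\<^sub>R b)" "span B = S'" by blast
    have BS: "B \<subseteq> S'" using B(3) span_superset by blast
    have "span (insert e B) = S"
    proof
      show "span (insert e B) \<subseteq> S"
        using BS e less.prems(1) by (intro span_minimal) (auto simp: S'_def)
      show "S \<subseteq> span (insert e B)"
      proof
        fix x assume x: "x \<in> S"
        have "x - (x \<bullet> e) *\<^sub>R e \<in> S'"
          using x e less.prems(1) by (auto simp: S'_def subspace_diff subspace_scale inner_diff_left ee)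
        then have "x - (x \<bullet> e) *\<^sub>R e \<in> span B" using B(3) by simp
        then show "x \<in> span (insert e B)" by (metis span_breakdown_eq)
      qed
    qed
    moreover have "pairwise orthogonal (insert e B)"
      using B(1) BS by (auto simp: pairwise_insert S'_def orthogonal_def inner_commute)
    ultimately show ?thesis using B(2) e by (intro exI[of _ "insert e B"]) auto
  qed
qed

definition diag_matrix :: "('n \<Rightarrow> real) \<Rightarrow> real ^ 'n ^ 'n" where
  "diag_matrix d = (\<chi> i j. if i = j then d i else 0)"

lemma det_diag_matrix: "det (diag_matrix d) = (\<Prod>i\<in>UNIV. d i)"
  by (subst det_diagonal) (auto simp: diag_matrix_def)

lemma transpose_diag_matrix [simp]: "transpose (diag_matrix d) = diag_matrix d"
  by (auto simp: diag_matrix_def transpose_def vec_eq_iff)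

lemma diag_matrix_mult: "diag_matrix c ** diag_matrix d = diag_matrix (\<lambda>i. c i * d i)"
  by (auto simp: diag_matrix_def matrix_matrix_mult_def vec_eq_iff mult_delta_left mult_delta_right)

lemma diag_matrix_one: "diag_matrix (\<lambda>_. 1) = mat 1"
  by (simp add: diag_matrix_def mat_def)

lemma diag_matrix_mult_axis: "diag_matrix d *v axis j 1 = d j *\<^sub>R axis j 1"
  by (auto simp: diag_matrix_def vec_eq_iff axis_def matrix_vector_mult_def mult_delta_left mult_delta_right)

lemma spectral_decomposition:
  fixes A :: "real ^ 'n ^ 'n"
  assumes "transpose A = A"
  obtains U d where "orthogonal_matrix U" "transpose U ** A ** U = diag_matrix d"
proof -
  have adj: "(A *v x) \<bullet> y = x \<bullet> (A *v y)" for x y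
    using assms by (metis dot_lmul_matrix transpose_matrix_vector)
  obtain B where B: "pairwise orthogonal B" "\<forall>b\<in>B. norm b = 1 \<and> (\<exists>c. A *v b = c *\<^sub>R b)" "span B = UNIV"
    using self_adjoint_orthonormal_eigenbasis[of "(*v) A" UNIV, OF _ adj] by auto
  have B0: "0 \<notin> B" using B(2) by auto
  have ind: "independent B" using B(1) B0 by (rule pairwise_orthogonal_independent)
  have "card B = CARD('n)"
    using ind B(3) by (metis dim_UNIV basis_card_eq_dim subset_UNIV dim_span DIM_cart DIM_real mult.right_neutral
        span_eq_dim top_greatest)
  then obtain b :: "'n \<Rightarrow> _" where b: "bij_betw b UNIV B"
    using ind independent_imp_finite by (metis bij_betw_iff_card finite)
  have bB: "b j \<in> B" for j using b by (auto simp: bij_betw_def)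
  have inj: "b i = b j \<longleftrightarrow> i = j" for i j using b by (auto simp: bij_betw_def inj_on_def)
  have "\<forall>j. \<exists>c. A *v b j = c *\<^sub>R b j" using B(2) bB by blast
  then obtain d where d: "A *v b j = d j *\<^sub>R b j" for j
    using choice[of "\<lambda>j c. A *v b j = c *\<^sub>R b j"] by blast
  have on: "b i \<bullet> b j = (if i = j then 1 else 0)" for i j
    using B(1,2) bB inj by (auto simp: pairwise_def orthogonal_def dot_square_norm)
  define U where "U = (\<chi> i j. b j $ i)"
  have Uax: "U *v axis j 1 = b j" for j
    by (simp add: U_def matrix_vector_mult_basis column_def vec_eq_iff)
  \<comment> \<open>Applied to A this identity shows that the conjugate is diagonal; applied to
    \<open>mat 1\<close> it shows that U is orthogonal.\<close>
  have e: "(transpose U ** M ** U) $ i $ j = b i \<bullet> (M *v b j)" for M i j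
  proof -
    have "(transpose U ** M ** U) $ i $ j = axis i 1 \<bullet> ((transpose U ** M ** U) *v axis j 1)"
      by (simp add: matrix_vector_mult_basis column_def inner_axis')
    also have "\<dots> = axis i 1 \<bullet> (transpose U *v (M *v b j))"
      by (simp add: Uax flip: matrix_vector_mul_assoc)
    also have "\<dots> = (U *v axis i 1) \<bullet> (M *v b j)"
      by (metis dot_lmul_matrix inner_commute transpose_matrix_vector)
    finally show ?thesis by (simp add: Uax)
  qed
  have "transpose U ** A ** U = diag_matrix d"
    by (auto simp: vec_eq_iff e d on diag_matrix_def)
  moreover have "transpose U ** mat 1 ** U = mat 1"
    unfolding vec_eq_iff e by (simp add: on) (simp add: mat_def)
  then have "orthogonal_matrix U" by (simp add: orthogonal_matrix)
  ultimately show thesis using that by blast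
qed

section \<open>Congruence and determinant inequalities for positive definite matrices\<close>

lemma spd_congruence:
  fixes A P :: "real ^ 'n ^ 'n"
  assumes "spd A" "invertible P"
  shows "spd (transpose P ** A ** P)"
  unfolding spd_def
proof (intro conjI allI impI)
  show "transpose (transpose P ** A ** P) = transpose P ** A ** P"
    using assms(1) by (simp add: spd_def matrix_transpose_mul matrix_mul_assoc)
  fix x :: "real ^ 'n" assume "x \<noteq> 0"
  then have "P *v x \<noteq> 0" using assms(2) by (metis inj_matrix_vector_mult injD matrix_vector_mult_0_right)
  moreover have "x \<bullet> ((transpose P ** A ** P) *v x) = (P *v x) \<bullet> (A *v (P *v x))"
    by (metis dot_lmul_matrix matrix_vector_mul_assoc transpose_matrix_vector inner_commute)
  ultimately show "0 < x \<bullet> ((transpose P ** A ** P) *v x)" using assms(1) by (simp add: spd_def)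
qed

lemma spd_diag_matrix_pos:
  assumes "spd (diag_matrix d)"
  shows "0 < d j"
proof -
  have "axis j 1 \<noteq> (0 :: real ^ 'a)" by simp
  then have "0 < axis j 1 \<bullet> (diag_matrix d *v axis j 1)" using assms unfolding spd_def by blast
  then show ?thesis by (simp add: diag_matrix_mult_axis inner_axis_axis)
qed

text \<open>Diagonalizing A and dividing the columns by the roots of the eigenvalues gives P, which
  carries A to the identity. A rotation V then diagonalizes the image of B and leaves the identity
  unchanged.\<close>

lemma spd_simultaneous_diagonalization:
  fixes A B :: "real ^ 'n ^ 'n"
  assumes A: "spd A" and B: "spd B"
  obtains Q :: "real ^ 'n ^ 'n" and c where "invertible Q" "transpose Q ** A ** Q = mat 1" "transpose Q ** B ** Q = diag_matrix c"
    "\<And>i. 0 < c i"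
proof -
  obtain U d where U: "orthogonal_matrix U" "transpose U ** A ** U = diag_matrix d"
    using A spectral_decomposition unfolding spd_def by metis
  have invU: "invertible U" using U(1) by (simp add: orthogonal_matrix_def invertible_def) blast
  have d: "0 < d j" for j using spd_congruence[OF A invU] U(2) spd_diag_matrix_pos by metis
  define D where "D = diag_matrix (\<lambda>i. 1 / sqrt (d i))"
  have "det D \<noteq> 0" using d by (simp add: D_def det_diag_matrix less_imp_neq[symmetric])
  then have invD: "invertible D" by (simp add: invertible_det_nz)
  define P where "P = U ** D"
  have invP: "invertible P" by (simp add: P_def invertible_mult invU invD)
  have "transpose P ** A ** P = transpose D ** (transpose U ** A ** U) ** D"
    by (simp add: P_def matrix_transpose_mul matrix_mul_assoc)
  also have "\<dots> = diag_matrix (\<lambda>i. 1 / sqrt (d i) * d i * (1 / sqrt (d i)))"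
    by (simp add: U D_def diag_matrix_mult)
  also have "(\<lambda>i. 1 / sqrt (d i) * d i * (1 / sqrt (d i))) = (\<lambda>_. 1)"
    using d by (auto simp: fun_eq_iff field_simps less_imp_neq[symmetric] less_imp_le)
  finally have PA: "transpose P ** A ** P = mat 1" by (simp add: diag_matrix_one)
  have C: "spd (transpose P ** B ** P)" by (rule spd_congruence[OF B invP])
  then obtain V c where V: "orthogonal_matrix V" "transpose V ** (transpose P ** B ** P) ** V = diag_matrix c"
    using spectral_decomposition unfolding spd_def by metis
  have invV: "invertible V" using V(1) by (simp add: orthogonal_matrix_def invertible_def) blast
  have c: "0 < c j" for j using spd_congruence[OF C invV] V(2) spd_diag_matrix_pos by metis
  define Q where "Q = P ** V"
  have "transpose Q ** A ** Q = transpose V ** (transpose P ** A ** P) ** V"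
    by (simp add: Q_def matrix_transpose_mul matrix_mul_assoc)
  also have "\<dots> = mat 1" using V(1) by (simp add: PA orthogonal_matrix)
  finally have "transpose Q ** A ** Q = mat 1" .
  moreover have "transpose Q ** B ** Q = diag_matrix c"
    using V(2) by (simp add: Q_def matrix_transpose_mul matrix_mul_assoc)
  moreover have "invertible Q" by (simp add: Q_def invertible_mult invP invV)
  ultimately show thesis using that[of Q c] c by blast
qed

lemma spd_mat_1: "spd (mat 1)"
  by (simp add: spd_def transpose_mat)

lemma spd_det_pos:
  fixes A :: "real ^ 'n ^ 'n"
  assumes "spd A"
  shows "0 < det A"
proof -
  obtain Q :: "real ^ 'n ^ 'n" and c where Q: "invertible Q" "transpose Q ** mat 1 ** Q = mat 1"
    "transpose Q ** A ** Q = diag_matrix c" "\<And>i. 0 < c i"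
    using spd_simultaneous_diagonalization[OF spd_mat_1 assms] by blast
  have "(det Q)\<^sup>2 = 1" using arg_cong[OF Q(2), of det] by (simp add: det_mul power2_eq_square)
  moreover have "(det Q)\<^sup>2 * det A = (\<Prod>i\<in>UNIV. c i)"
    using arg_cong[OF Q(3), of det] by (simp add: det_mul det_diag_matrix power2_eq_square ac_simps)
  ultimately show ?thesis using Q(4) by (simp add: prod_pos)
qed

lemma matrix_add_rdistrib: "(B + C) ** A = B ** A + C ** (A :: real ^ 'n ^ 'm)"
  by (simp add: matrix_matrix_mult_def vec_eq_iff distrib_right sum.distrib)

lemma congruence_cancel:
  fixes Q :: "real ^ 'n ^ 'n"
  assumes "invertible Q" "transpose Q ** A ** Q = transpose Q ** B ** Q"
  shows "A = B"
proof -
  obtain R where R: "Q ** R = mat 1" using assms(1) by (auto simp: invertible_def)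
  then have R': "transpose R ** transpose Q = mat 1" by (metis matrix_transpose_mul transpose_mat)
  have *: "M = transpose R ** (transpose Q ** M ** Q) ** R" for M
    by (metis R R' matrix_mul_assoc matrix_mul_lid matrix_mul_rid)
  show ?thesis using *[of A] *[of B] assms(2) by metis
qed

text \<open>Simultaneous diagonalization multiplies all three determinants by
  \<open>(det Q)\<^sup>2\<close> and leaves the product over i of the scalar inequalities
  \<open>sqrt (c i) \<le> (1 + c i) / 2\<close>. One of them is strict as soon as some
  \<open>c i\<close> differs from 1, that is, when A \<noteq> B.\<close>

lemma det_midpoint:
  fixes A B :: "real ^ 'n ^ 'n"
  assumes A: "spd A" and B: "spd B"
  shows "sqrt (det A * det B) \<le> det ((1/2) *\<^sub>R (A + B))" (is ?le)
    and "A \<noteq> B \<Longrightarrow> sqrt (det A * det B) < det ((1/2) *\<^sub>R (A + B))"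
proof -
  obtain Q :: "real ^ 'n ^ 'n" and c where Q: "invertible Q" "transpose Q ** A ** Q = mat 1"
    "transpose Q ** B ** Q = diag_matrix c" and c: "\<And>i. 0 < c i"
    using spd_simultaneous_diagonalization[OF A B] by blast
  have q: "(det Q)\<^sup>2 > 0" using Q(1) by (simp add: invertible_det_nz)
  have 1: "(det Q)\<^sup>2 * det A = 1"
    using arg_cong[OF Q(2), of det] by (simp add: det_mul power2_eq_square ac_simps)
  have 2: "(det Q)\<^sup>2 * det B = (\<Prod>i\<in>UNIV. c i)"
    using arg_cong[OF Q(3), of det] by (simp add: det_mul det_diag_matrix power2_eq_square ac_simps)
  have "transpose Q ** ((1/2) *\<^sub>R (A + B)) ** Q
      = (1/2) *\<^sub>R (transpose Q ** A ** Q + transpose Q ** B ** Q)"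
    by (simp add: matrix_add_ldistrib matrix_add_rdistrib matrix_scalar_ac scaleR_add_right
        flip: scalar_matrix_assoc)
  also have "\<dots> = (1/2) *\<^sub>R (mat 1 + diag_matrix c)"
    by (simp add: Q)
  also have "\<dots> = diag_matrix (\<lambda>i. (1 + c i) / 2)"
    by (auto simp: vec_eq_iff diag_matrix_def mat_def)
  finally have "(det Q)\<^sup>2 * det ((1/2) *\<^sub>R (A + B)) = (\<Prod>i\<in>UNIV. (1 + c i) / 2)"
    by (metis (no_types, lifting) det_diag_matrix det_mul det_transpose mult.commute mult.left_commute power2_eq_square)
  note 3 = this
  have amgm: "sqrt (c i) \<le> (1 + c i) / 2" for i
    using arith_geo_mean_sqrt[of 1 "c i"] c[of i] by simp
  have s: "(det Q)\<^sup>2 * sqrt (det A * det B) = (\<Prod>i\<in>UNIV. sqrt (c i))"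
  proof -
    have "(det Q)\<^sup>2 * sqrt (det A * det B) = sqrt (((det Q)\<^sup>2 * det A) * ((det Q)\<^sup>2 * det B))"
      by (simp add: real_sqrt_mult power2_eq_square)
    also have "\<dots> = (\<Prod>i\<in>UNIV. sqrt (c i))"
    proof -
      have "sqrt (\<Prod>i\<in>I. c i) = (\<Prod>i\<in>I. sqrt (c i))" for I
        by (induction I rule: infinite_finite_induct) (auto simp: real_sqrt_mult)
      then show ?thesis unfolding 1 2 by simp
    qed
    finally show ?thesis .
  qed
  have "(\<Prod>i\<in>UNIV. sqrt (c i)) \<le> (\<Prod>i\<in>UNIV. (1 + c i) / 2)"
    by (intro prod_mono) (use amgm c less_imp_le in auto)
  then show ?le using q unfolding s[symmetric] 3[symmetric] by simp
  assume "A \<noteq> B"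
  then have "\<exists>i. c i \<noteq> 1" using Q congruence_cancel[of Q A B] diag_matrix_one
    by (metis (no_types, lifting) ext)
  then obtain k where k: "c k \<noteq> 1" by blast
  have "sqrt (c k) < (1 + c k) / 2"
  proof -
    have "0 < (sqrt (c k) - 1)\<^sup>2" using k by simp
    then show ?thesis using c[of k] by (simp add: power2_diff)
  qed
  then have "(\<Prod>i\<in>UNIV. sqrt (c i)) < (\<Prod>i\<in>UNIV. (1 + c i) / 2)"
    using amgm c by (intro prod_mono_strict[of k]) (auto intro: less_imp_le add_pos_pos)
  then show "sqrt (det A * det B) < det ((1/2) *\<^sub>R (A + B))"
    using q unfolding s[symmetric] 3[symmetric] by simp
qed

text \<open>Shows that a ball stretched in one direction gains volume. Here Q preserves the
  identity, hence is orthogonal, and the c i are the eigenvalues of A: all are at least 1 and not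
  all equal 1.\<close>

lemma det_gt_1:
  fixes A :: "real ^ 'n ^ 'n"
  assumes A: "spd A" and ge: "\<And>x. x \<bullet> x \<le> x \<bullet> (A *v x)" and "A \<noteq> mat 1"
  shows "1 < det A"
proof -
  obtain Q :: "real ^ 'n ^ 'n" and c where Q: "invertible Q" "transpose Q ** mat 1 ** Q = mat 1"
    "transpose Q ** A ** Q = diag_matrix c" "\<And>i. 0 < c i"
    using spd_simultaneous_diagonalization[OF spd_mat_1 A] by blast
  have "(det Q)\<^sup>2 = 1" using arg_cong[OF Q(2), of det] by (simp add: det_mul power2_eq_square)
  moreover have "(det Q)\<^sup>2 * det A = (\<Prod>i\<in>UNIV. c i)"
    using arg_cong[OF Q(3), of det] by (simp add: det_mul det_diag_matrix power2_eq_square ac_simps)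
  ultimately have d: "det A = (\<Prod>i\<in>UNIV. c i)" by simp
  have tr: "x \<bullet> ((transpose Q ** M ** Q) *v x) = (Q *v x) \<bullet> (M *v (Q *v x))" for M x
    by (metis dot_lmul_matrix matrix_vector_mul_assoc transpose_matrix_vector inner_commute)
  have c1: "1 \<le> c j" for j
    using ge[of "Q *v axis j 1"] tr[of "axis j 1" A] tr[of "axis j 1" "mat 1"] Q(2,3)
    by (simp add: diag_matrix_mult_axis inner_axis_axis)
  have "\<exists>i. c i \<noteq> 1" using Q congruence_cancel[of Q A "mat 1"] diag_matrix_one assms(3)
    by (metis (no_types, lifting) ext)
  then obtain k where k: "c k \<noteq> 1" by blast
  have "(\<Prod>i\<in>(UNIV::'n set). 1) < (\<Prod>i\<in>UNIV. c i)"
    using c1 k by (intro prod_mono_strict[of k]) (auto intro: le_neq_trans less_le_trans[OF zero_less_one])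
  then show ?thesis by (simp add: d)
qed

lemma spd_add: "spd A \<Longrightarrow> spd B \<Longrightarrow> spd (A + B)"
  by (auto simp: spd_def transpose_def vec_eq_iff matrix_vector_mult_add_rdistrib inner_add_right add_pos_pos)

lemma spd_scaleR: "0 < c \<Longrightarrow> spd A \<Longrightarrow> spd (c *\<^sub>R A)"
  by (auto simp: spd_def transpose_def vec_eq_iff scaleR_matrix_vector_assoc[symmetric])

text \<open>Recovers positive definiteness for limits of feasible matrices. At a zero x of the form,
  moving in the direction A x would make the form negative to first order unless A x = 0, which
  invertibility forbids.\<close>

lemma spd_if_semidefinite_det:
  fixes A :: "real ^ 'n ^ 'n"
  assumes sym: "transpose A = A" and psd: "\<And>x. 0 \<le> x \<bullet> (A *v x)" and "det A \<noteq> 0"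
  shows "spd A"
  unfolding spd_def
proof (intro conjI allI impI sym)
  fix x :: "real ^ 'n" assume "x \<noteq> 0"
  have adj: "(A *v x) \<bullet> y = x \<bullet> (A *v y)" for x y
    using sym by (metis dot_lmul_matrix transpose_matrix_vector)
  show "0 < x \<bullet> (A *v x)"
  proof (rule ccontr)
    assume "\<not> ?thesis"
    then have 0: "x \<bullet> (A *v x) = 0" using psd[of x] by linarith
    let ?y = "A *v x"
    have "- (?y \<bullet> ?y) = 0"
    proof (rule linear_term_zero_if_quadratic_nonpos)
      fix t :: real
      have "0 \<le> (x + t *\<^sub>R ?y) \<bullet> (A *v (x + t *\<^sub>R ?y))" by (rule psd)
      also have "\<dots> = 2 * t * (?y \<bullet> ?y) + t\<^sup>2 * (?y \<bullet> (A *v ?y))"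
        by (simp add: matrix_vector_right_distrib matrix_vector_mult_scaleR
            inner_add_left inner_add_right 0 power2_eq_square adj[of x ?y, symmetric] algebra_simps)
      finally show "2 * t * - (?y \<bullet> ?y) + t\<^sup>2 * (- (?y \<bullet> (A *v ?y))) \<le> 0" by simp
    qed
    then have "A *v x = 0" by simp
    moreover have "inj ((*v) A)" using assms(3) by (simp add: inj_matrix_vector_mult invertible_det_nz)
    ultimately show False using \<open>x \<noteq> 0\<close> by (metis injD matrix_vector_mult_0_right)
  qed
qed

text \<open>In the Leibniz expansion a permutation other than the identity moves at least two
  indices. Differentiating one factor thus leaves an off-diagonal entry of the identity among the
  remaining ones, and only the identity permutation contributes.\<close>

lemma det_has_derivative_mat_1:
  "(det has_derivative (\<lambda>H. trace H)) (at (mat 1 :: real ^ 'n ^ 'n))"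
proof -
  let ?P = "{p. p permutes (UNIV :: 'n set)}"
  have fin: "finite ?P" by (simp add: finite_permutations)
  have *: "((\<lambda>A :: real ^ 'n ^ 'n. of_int (sign p) * (\<Prod>i\<in>UNIV. A $ i $ p i)) has_derivative
      (\<lambda>H. of_int (sign p) * (\<Sum>i\<in>UNIV. H $ i $ p i * (\<Prod>j\<in>UNIV - {i}. mat 1 $ j $ p j)))) (at (mat 1))" for p
    by (intro has_derivative_mult_right has_derivative_prod derivative_intros)
      (auto intro!: bounded_linear_imp_has_derivative bounded_linear_compose[OF bounded_linear_vec_nth] bounded_linear_vec_nth)
  have "((\<lambda>A :: real ^ 'n ^ 'n. \<Sum>p\<in>?P. of_int (sign p) * (\<Prod>i\<in>UNIV. A $ i $ p i)) has_derivative
      (\<lambda>H. \<Sum>p\<in>?P. of_int (sign p) * (\<Sum>i\<in>UNIV. H $ i $ p i * (\<Prod>j\<in>UNIV - {i}. mat 1 $ j $ p j)))) (at (mat 1))"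
    by (intro has_derivative_sum *)
  moreover have "(\<Sum>p\<in>?P. of_int (sign p) * (\<Sum>i\<in>UNIV. H $ i $ p i * (\<Prod>j\<in>UNIV - {i}. mat 1 $ j $ p j))) = trace H"
    for H :: "real ^ 'n ^ 'n"
  proof -
    have z: "of_int (sign p) * (\<Sum>i\<in>UNIV. H $ i $ p i * (\<Prod>j\<in>UNIV - {i}. mat 1 $ j $ p j)) = 0"
      if p: "p permutes (UNIV :: 'n set)" "p \<noteq> id" for p
    proof -
      have "(\<Prod>j\<in>UNIV - {i}. (mat 1 :: real ^ 'n ^ 'n) $ j $ p j) = 0" for i
      proof -
        obtain k where k: "p k \<noteq> k" using p by fastforce
        have "p (p k) \<noteq> p k" using k p(1) by (metis permutes_inj injD)
        then obtain j where "j \<noteq> i" "p j \<noteq> j" using k by metis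
        then show ?thesis by (intro prod_zero) (auto simp: mat_def intro!: bexI[of _ j])
      qed
      then show ?thesis by (simp del: prod_zero_iff)
    qed
    have "(\<Sum>p\<in>?P. of_int (sign p) * (\<Sum>i\<in>UNIV. H $ i $ p i * (\<Prod>j\<in>UNIV - {i}. mat 1 $ j $ p j)))
      = (\<Sum>p\<in>{id}. of_int (sign p) * (\<Sum>i\<in>UNIV. H $ i $ p i * (\<Prod>j\<in>UNIV - {i}. mat 1 $ j $ p j)))"
      by (rule sum.mono_neutral_right) (use fin z in \<open>auto simp: permutes_id\<close>)
    also have "\<dots> = trace H" by (simp add: trace_def mat_def sign_id)
    finally show ?thesis .
  qed
  ultimately show ?thesis unfolding det_def[abs_def] by simp
qed

section \<open>Affine change of variables and the \<open>s\<close>-volume of ellipsoids\<close>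

lemma nn_integral_translation:
  fixes F :: "'a::euclidean_space \<Rightarrow> ennreal"
  assumes [measurable]: "F \<in> borel_measurable borel"
  shows "(\<integral>\<^sup>+x. F (a + x) \<partial>lborel) = (\<integral>\<^sup>+x. F x \<partial>lborel)"
proof -
  have "(\<integral>\<^sup>+x. F x \<partial>lborel) = (\<integral>\<^sup>+x. F x \<partial>distr lborel borel ((+) a))"
    by (simp add: lborel_distr_plus)
  also have "\<dots> = (\<integral>\<^sup>+x. F (a + x) \<partial>lborel)" by (subst nn_integral_distr) auto
  finally show ?thesis by simp
qed

lemma borel_measurable_matrix_vector_mult [measurable]:
  fixes A :: "real ^ 'n ^ 'm"
  assumes [measurable]: "f \<in> borel_measurable M"
  shows "(\<lambda>x. A *v f x) \<in> borel_measurable M"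
  by (rule borel_measurable_continuous_on[OF _ assms])
    (simp add: linear_continuous_on linear_conv_bounded_linear[symmetric])

lemma matrix_inv_vector_mult:
  fixes A :: "real ^ 'n ^ 'n"
  assumes "invertible A"
  shows "A *v (matrix_inv A *v z) = z" "matrix_inv A *v (A *v z) = z"
proof -
  have "A ** matrix_inv A = mat 1 \<and> matrix_inv A ** A = mat 1"
    unfolding matrix_inv_def using assms unfolding invertible_def by (rule someI_ex)
  then show "A *v (matrix_inv A *v z) = z" "matrix_inv A *v (A *v z) = z"
    by (simp_all add: matrix_vector_mul_assoc)
qed

text \<open>As in the uniqueness proof for Haar measure: the double integral of
  \<open>indicator B (U x) * F (U x + y)\<close>, where \<open>B\<close> is the unit ball, is evaluated in both orders.\<close>

lemma nn_integral_orthogonal: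
  fixes U :: "real ^ 'n ^ 'n" and F :: "real ^ 'n \<Rightarrow> ennreal"
  assumes U: "orthogonal_matrix U" and [measurable]: "F \<in> borel_measurable borel"
  shows "(\<integral>\<^sup>+x. F (U *v x) \<partial>lborel) = (\<integral>\<^sup>+x. F x \<partial>lborel)"
proof -
  define B where "B = ball (0 :: real ^ 'n) 1"
  define \<beta> where "\<beta> = emeasure lborel B"
  have ball: "emeasure lborel (ball z 1) = \<beta>" for z :: "real ^ 'n"
    by (simp add: \<beta>_def B_def emeasure_ball)
  have [measurable]: "B \<in> sets borel" by (simp add: B_def)
  have \<beta>: "\<beta> \<noteq> 0" "\<beta> \<noteq> top"
    using unit_ball_vol_pos[of "real CARD('n)"] by (auto simp: \<beta>_def B_def emeasure_ball simp del: unit_ball_vol_pos)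
  have nU: "norm (U *v x) = norm x" for x
    using U by (simp add: orthogonal_transformation_matrix orthogonal_transformation_norm orthogonal_matrix_def)
  have UU: "U *v (transpose U *v y) = y" for y
    unfolding matrix_vector_mul_assoc using U unfolding orthogonal_matrix_def by simp
  have "(\<integral>\<^sup>+x. \<integral>\<^sup>+y. indicator B (U *v x) * F (U *v x + y) \<partial>lborel \<partial>lborel)
      = (\<integral>\<^sup>+x. indicator B (U *v x) * (\<integral>\<^sup>+y. F y \<partial>lborel) \<partial>lborel)"
    by (simp add: nn_integral_cmult nn_integral_translation)
  also have "\<dots> = (\<integral>\<^sup>+x. indicator B x * (\<integral>\<^sup>+y. F y \<partial>lborel) \<partial>lborel)"
    by (simp add: B_def nU indicator_def)
  also have "\<dots> = \<beta> * (\<integral>\<^sup>+y. F y \<partial>lborel)"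
    by (simp add: nn_integral_multc \<beta>_def)
  finally have 1: "(\<integral>\<^sup>+x. \<integral>\<^sup>+y. indicator B (U *v x) * F (U *v x + y) \<partial>lborel \<partial>lborel) = \<dots>" .
  have "(\<integral>\<^sup>+x. \<integral>\<^sup>+y. indicator B (U *v x) * F (U *v x + y) \<partial>lborel \<partial>lborel)
      = (\<integral>\<^sup>+y. \<integral>\<^sup>+x. indicator B (U *v x) * F (U *v x + y) \<partial>lborel \<partial>lborel)"
    by (rule lborel_pair.Fubini'[symmetric]) measurable
  \<comment> \<open>Replacing x by x - \<open>transpose U *v y\<close> removes y from the argument
    of F, because U times its transpose is the identity; y then survives only in the
    indicator.\<close>
  also have "\<dots> = (\<integral>\<^sup>+y. \<integral>\<^sup>+x. indicator B (U *v (- (transpose U *v y) + x)) *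
      F (U *v (- (transpose U *v y) + x) + y) \<partial>lborel \<partial>lborel)"
    by (intro nn_integral_cong nn_integral_translation[symmetric]) measurable
  also have "\<dots> = (\<integral>\<^sup>+y. \<integral>\<^sup>+x. indicator B (U *v x - y) * F (U *v x) \<partial>lborel \<partial>lborel)"
    by (intro nn_integral_cong)
      (simp add: matrix_vector_mult_diff_distrib UU del: transpose_matrix_vector)
  also have "\<dots> = (\<integral>\<^sup>+x. \<integral>\<^sup>+y. indicator B (U *v x - y) * F (U *v x) \<partial>lborel \<partial>lborel)"
    by (rule lborel_pair.Fubini') measurable
  also have "\<dots> = \<beta> * (\<integral>\<^sup>+x. F (U *v x) \<partial>lborel)"
  proof -
    have "(\<integral>\<^sup>+y. indicator B (z - y) \<partial>lborel) = \<beta>" for z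
    proof -
      have "(\<integral>\<^sup>+y. indicator B (z - y) \<partial>lborel) = (\<integral>\<^sup>+y. indicator (ball z 1) y \<partial>lborel)"
        by (intro nn_integral_cong) (simp add: B_def indicator_def dist_norm norm_minus_commute)
      then show ?thesis by (simp add: ball)
    qed
    then show ?thesis by (simp add: nn_integral_multc nn_integral_cmult)
  qed
  finally show ?thesis unfolding 1 using \<beta> by (simp add: ennreal_mult_cancel_left)
qed

lemma nn_integral_diag_matrix:
  fixes F :: "real ^ 'n \<Rightarrow> ennreal"
  assumes d: "\<And>i. 0 < d i" and [measurable]: "F \<in> borel_measurable borel"
  shows "(\<integral>\<^sup>+x. F x \<partial>lborel) = ennreal (\<Prod>i\<in>UNIV. d i) * (\<integral>\<^sup>+x. F (diag_matrix d *v x) \<partial>lborel)"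
proof -
  \<comment> \<open>The scaling lemma for \<open>lborel\<close> indexes its factors by basis
    vectors, not by coordinates. At \<open>axis i 1\<close> the only non-zero coordinate is i, so
    this product reduces to \<open>d i\<close>.\<close>
  define c where "c b = (\<Prod>i\<in>{i. b $ i \<noteq> 0}. d i)" for b :: "real ^ 'n"
  have c: "c (axis i 1) = d i" for i by (simp add: c_def axis_def)
  have Basis: "(Basis :: (real ^ 'n) set) = (\<lambda>i. axis i 1) ` UNIV" by (auto simp: Basis_vec_def)
  have inj: "inj (\<lambda>i :: 'n. axis i (1::real))" by (auto simp: inj_on_def axis_eq_axis)
  have "(\<Sum>j\<in>Basis. (c j * (x \<bullet> j)) *\<^sub>R j) = diag_matrix d *v x" for x :: "real ^ 'n"
    unfolding Basis by (subst sum.reindex[OF inj])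
      (simp add: c inner_axis o_def vec_eq_iff, simp add: diag_matrix_def matrix_vector_mult_def axis_def
        mult_delta_left mult_delta_right)
  then have "lborel = density (distr lborel borel ((*v) (diag_matrix d))) (\<lambda>_. (\<Prod>j\<in>Basis. \<bar>c j\<bar>))"
    using lborel_affine_euclidean[of c "0 :: real ^ 'n"] c d by (force simp: Basis less_imp_neq[symmetric])
  moreover have "(\<Prod>j\<in>Basis. \<bar>c j\<bar>) = (\<Prod>i\<in>UNIV. d i)"
    unfolding Basis by (subst prod.reindex[OF inj]) (simp add: c d less_imp_le)
  ultimately have "(lborel :: (real ^ 'n) measure)
      = density (distr lborel borel ((*v) (diag_matrix d))) (\<lambda>_. ennreal (\<Prod>i\<in>UNIV. d i))" by simp
  then have "(\<integral>\<^sup>+x. F x \<partial>lborel)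
      = (\<integral>\<^sup>+x. F x \<partial>density (distr lborel borel ((*v) (diag_matrix d))) (\<lambda>_. ennreal (\<Prod>i\<in>UNIV. d i)))"
    by (rule arg_cong[where f = "\<lambda>M. nn_integral M F"])
  also have "\<dots> = ennreal (\<Prod>i\<in>UNIV. d i) * (\<integral>\<^sup>+x. F (diag_matrix d *v x) \<partial>lborel)"
    by (simp add: nn_integral_density nn_integral_distr nn_integral_cmult)
  finally show ?thesis .
qed

text \<open>With A = U D \<open>transpose U\<close>, D diagonal, the orthogonal factors and the
  translation preserve the integral, so the Jacobian is that of the coordinate scaling D, whose
  determinant is \<open>det A\<close>.\<close>

lemma nn_integral_affine_spd:
  fixes A :: "real ^ 'n ^ 'n" and F :: "real ^ 'n \<Rightarrow> ennreal"
  assumes A: "spd A" and [measurable]: "F \<in> borel_measurable borel"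
  shows "(\<integral>\<^sup>+x. F x \<partial>lborel) = ennreal (det A) * (\<integral>\<^sup>+x. F (A *v x + v) \<partial>lborel)"
proof -
  obtain U d where U: "orthogonal_matrix U" and UA: "transpose U ** A ** U = diag_matrix d"
    using A spectral_decomposition unfolding spd_def by metis
  have invU: "invertible U" using U by (simp add: orthogonal_matrix_def invertible_def) blast
  have d: "0 < d j" for j using spd_congruence[OF A invU] UA spd_diag_matrix_pos by metis
  have "U ** (transpose U ** A ** U) = A ** U"
    using U by (simp add: matrix_mul_assoc orthogonal_matrix_def)
  then have AU: "A *v (U *v x) = U *v (diag_matrix d *v x)" for x
    by (simp add: matrix_vector_mul_assoc UA)
  have "(det U)\<^sup>2 = 1"
    using det_orthogonal_matrix[OF U] by auto
  moreover have "(det U)\<^sup>2 * det A = (\<Prod>i\<in>UNIV. d i)"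
    using arg_cong[OF UA, of det] by (simp add: det_mul det_diag_matrix power2_eq_square ac_simps)
  ultimately have det: "det A = (\<Prod>i\<in>UNIV. d i)" by simp
  have "(\<integral>\<^sup>+x. F x \<partial>lborel) = (\<integral>\<^sup>+x. F (U *v x + v) \<partial>lborel)"
    using nn_integral_orthogonal[OF U, of "\<lambda>x. F (x + v)"] nn_integral_translation[of F v]
    by (simp add: add.commute)
  also have "\<dots> = ennreal (det A) * (\<integral>\<^sup>+x. F (U *v (diag_matrix d *v x) + v) \<partial>lborel)"
    unfolding det by (rule nn_integral_diag_matrix[OF d]) measurable
  also have "(\<integral>\<^sup>+x. F (U *v (diag_matrix d *v x) + v) \<partial>lborel) = (\<integral>\<^sup>+x. F (A *v (U *v x) + v) \<partial>lborel)"
    by (simp add: AU)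
  also have "\<dots> = (\<integral>\<^sup>+x. F (A *v x + v) \<partial>lborel)"
    by (rule nn_integral_orthogonal[OF U]) measurable
  finally show ?thesis .
qed

text \<open>The height of the unit ball above x. The cut at 0 makes it continuous on the whole space
  and zero outside the ball.\<close>

definition ball_profile :: "'a::real_normed_vector \<Rightarrow> real" where
  "ball_profile x = sqrt (max 0 (1 - (norm x)\<^sup>2))"

lemma continuous_ball_profile: "continuous_on S ball_profile"
  unfolding ball_profile_def by (intro continuous_intros)

lemma borel_measurable_ball_profile [measurable]:
  "ball_profile \<in> borel_measurable (borel :: 'a::real_normed_vector measure)"
  by (intro borel_measurable_continuous_onI continuous_ball_profile)

lemma mem_cball_Pair_iff: "(x, t :: real) \<in> cball 0 1 \<longleftrightarrow> (norm x)\<^sup>2 + t\<^sup>2 \<le> 1"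
  by (simp add: norm_Pair)

text \<open>Above the point \<open>A *v x + a\<close> the slice is an interval of half-length
  \<alpha> times \<open>ball_profile x\<close>; the rest is the change of variables x to
  \<open>A *v x + a\<close>.\<close>

lemma s_volume_ellipsoid:
  fixes A :: "real ^ 'n ^ 'n"
  assumes s: "0 < s" and A: "spd A" and \<alpha>: "0 < \<alpha>"
  shows "s_volume s ((\<lambda>(x, t). (A *v x + a, \<alpha> * t)) ` cball 0 1)
    = ennreal (\<alpha> powr s * det A) * (\<integral>\<^sup>+x. ennreal (ball_profile (x :: real ^ 'n) powr s) \<partial>lborel)"
proof -
  let ?C = "(\<lambda>(x, t). (A *v x + a, \<alpha> * t)) ` cball 0 1"
  define H where "H x = ennreal ((\<alpha> * ball_profile x) powr s)" for x :: "real ^ 'n"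
  have [measurable]: "H \<in> borel_measurable borel" unfolding H_def by measurable
  have detA: "det A > 0" by (rule spd_det_pos[OF A])
  then have inv: "invertible A" by (simp add: invertible_det_nz)
  note inv' = matrix_inv_vector_mult[OF inv]
  have slice: "ennreal_powr (emeasure lborel {t. (A *v x + a, t) \<in> ?C} / 2) s = H x" for x
  proof -
    have "{t. (A *v x + a, t) \<in> ?C} = {t. (norm x)\<^sup>2 + (t / \<alpha>)\<^sup>2 \<le> 1}"
    proof (intro Collect_cong iffI)
      fix t assume "(A *v x + a, t) \<in> ?C"
      then obtain x' t' where *: "(x', t') \<in> cball 0 1" "A *v x + a = A *v x' + a" "t = \<alpha> * t'" by auto
      then have "x = x'" by (metis add_right_cancel inv'(2))
      moreover have "t / \<alpha> = t'" using * \<alpha> by simp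
      ultimately show "(norm x)\<^sup>2 + (t / \<alpha>)\<^sup>2 \<le> 1" using *(1) unfolding mem_cball_Pair_iff by simp
    next
      fix t assume "(norm x)\<^sup>2 + (t / \<alpha>)\<^sup>2 \<le> 1"
      then have "(x, t / \<alpha>) \<in> cball 0 1" unfolding mem_cball_Pair_iff .
      then show "(A *v x + a, t) \<in> ?C"
        using \<alpha> by (intro image_eqI[of _ _ "(x, t / \<alpha>)"]) auto
    qed
    \<comment> \<open>For norm x > 1 the slice is empty, whereas the interval on the right would be
      the single point 0. Both have measure 0, in agreement with
      \<open>ball_profile x = 0\<close>.\<close>
    also have "\<dots> = (if norm x \<le> 1 then {- (\<alpha> * ball_profile x)..\<alpha> * ball_profile x} else {})"
    proof (cases "norm x \<le> 1")
      case True
      then have n: "(norm x)\<^sup>2 \<le> 1" by (simp add: power_le_one)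
      have eq: "(norm x)\<^sup>2 + (t / \<alpha>)\<^sup>2 \<le> 1 \<longleftrightarrow> \<bar>t\<bar> \<le> \<alpha> * ball_profile x" for t
      proof -
        have "(norm x)\<^sup>2 + (t / \<alpha>)\<^sup>2 \<le> 1 \<longleftrightarrow> \<bar>t / \<alpha>\<bar> \<le> ball_profile x"
          using n unfolding ball_profile_def real_sqrt_abs[symmetric] real_sqrt_le_iff by auto
        also have "\<dots> \<longleftrightarrow> \<bar>t\<bar> \<le> \<alpha> * ball_profile x" using \<alpha> by (simp add: abs_divide field_simps)
        finally show ?thesis .
      qed
      show ?thesis unfolding eq using True by auto
    next
      case False
      then have "(norm x)\<^sup>2 > 1" by (simp add: one_less_power)
      then have "\<not> (norm x)\<^sup>2 + (t / \<alpha>)\<^sup>2 \<le> 1" for t using zero_le_power2[of "t / \<alpha>"] by linarith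
      then show ?thesis using False by auto
    qed
    finally have set: "{t. (A *v x + a, t) \<in> ?C}
        = (if norm x \<le> 1 then {- (\<alpha> * ball_profile x)..\<alpha> * ball_profile x} else {})" .
    have p: "0 \<le> ball_profile x" by (simp add: ball_profile_def)
    have "emeasure lborel {t. (A *v x + a, t) \<in> ?C} / 2 = ennreal (\<alpha> * ball_profile x)"
    proof (cases "norm x \<le> 1")
      case True
      have "emeasure lborel {t. (A *v x + a, t) \<in> ?C} = ennreal (2 * (\<alpha> * ball_profile x))"
        unfolding set using True p \<alpha> by simp
      then show ?thesis by (metis (no_types, lifting) ennreal_divide_numeral mult_nonneg_nonneg p \<alpha> less_imp_le
            nonzero_mult_div_cancel_left zero_le_numeral zero_neq_numeral)
    next
      case False
      then have "(norm x)\<^sup>2 > 1" by (simp add: one_less_power)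
      then show ?thesis unfolding set using False by (simp add: ball_profile_def)
    qed
    then show ?thesis using p \<alpha> by (simp add: ennreal_powr_def H_def)
  qed
  have G: "ennreal_powr (emeasure lborel {t. (z, t) \<in> ?C} / 2) s = H (matrix_inv A *v (z - a))" for z
    using slice[of "matrix_inv A *v (z - a)"] by (simp add: inv')
  have "s_volume s ?C = ennreal (det A) * (\<integral>\<^sup>+x. H (matrix_inv A *v (A *v x + a - a)) \<partial>lborel)"
    unfolding s_volume_def G by (rule nn_integral_affine_spd[OF A]) measurable
  also have "\<dots> = ennreal (det A) * (\<integral>\<^sup>+x. ennreal (\<alpha> powr s) * ennreal (ball_profile (x :: real ^ 'n) powr s) \<partial>lborel)"
    using \<alpha> by (simp add: inv' H_def powr_mult ball_profile_def ennreal_mult')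
  also have "\<dots> = ennreal (\<alpha> powr s * det A) * (\<integral>\<^sup>+x. ennreal (ball_profile (x :: real ^ 'n) powr s) \<partial>lborel)"
    using detA by (simp add: nn_integral_cmult ennreal_mult' ac_simps)
  finally show ?thesis .
qed

text \<open>Allows the common factor to be cancelled when the s-volumes of two ellipsoids are
  compared.\<close>

lemma ball_profile_integral:
  assumes "0 < s"
  shows "(\<integral>\<^sup>+x. ennreal (ball_profile (x :: 'a::euclidean_space) powr s) \<partial>lborel) \<noteq> 0"
    and "(\<integral>\<^sup>+x. ennreal (ball_profile (x :: 'a::euclidean_space) powr s) \<partial>lborel) \<noteq> top"
proof -
  have "(\<integral>\<^sup>+x. ennreal (ball_profile (x :: 'a) powr s) \<partial>lborel) \<le> (\<integral>\<^sup>+x. indicator (cball (0::'a) 1) x \<partial>lborel)"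
  proof (rule nn_integral_mono)
    fix x :: 'a
    show "ennreal (ball_profile x powr s) \<le> indicator (cball 0 1) x"
    proof (cases "norm x \<le> 1")
      case True
      have "ball_profile x \<le> 1" by (simp add: ball_profile_def)
      then have "ball_profile x powr s \<le> 1" using assms
        by (intro powr_le1) (auto simp: ball_profile_def)
      then show ?thesis using True by simp
    next
      case False
      then have "(norm x)\<^sup>2 > 1" by (simp add: one_less_power)
      then show ?thesis by (simp add: ball_profile_def)
    qed
  qed
  also have "\<dots> < top" using emeasure_bounded_finite[of "cball (0::'a) 1"] by simp
  finally show "(\<integral>\<^sup>+x. ennreal (ball_profile (x :: 'a) powr s) \<partial>lborel) \<noteq> top" by simp
  have "emeasure lborel (ball (0::'a) 1) \<noteq> 0" by (simp add: emeasure_ball less_imp_neq[OF unit_ball_vol_pos, symmetric])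
  moreover have "(norm x)\<^sup>2 < 1" if "x \<in> ball 0 1" for x :: 'a
    using that abs_square_less_1[of "norm x"] by simp
  then have "ball 0 1 \<subseteq> {x \<in> space lborel. ennreal (ball_profile (x :: 'a) powr s) \<noteq> 0}"
    by (force simp: ball_profile_def)
  then have "emeasure lborel (ball (0::'a) 1) \<le> emeasure lborel {x \<in> space lborel. ennreal (ball_profile (x :: 'a) powr s) \<noteq> 0}"
    by (rule emeasure_mono) measurable
  ultimately have "emeasure lborel {x \<in> space lborel. ennreal (ball_profile (x :: 'a) powr s) \<noteq> 0} \<noteq> 0"
    by auto
  then show "(\<integral>\<^sup>+x. ennreal (ball_profile (x :: 'a) powr s) \<partial>lborel) \<noteq> 0"
    by (subst nn_integral_0_iff) simp_all
qed

text \<open>A point z of S far from a would force too much volume: by convexity, copies of the given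
  ball shrunk towards z fit into S, and a long segment from a to z carries many disjoint
  ones.\<close>

lemma bounded_convex_finite_measure:
  fixes S :: "'a::euclidean_space set"
  assumes conv: "convex S" and meas: "S \<in> sets borel" and fin: "emeasure lborel S < top"
    and \<rho>: "0 < \<rho>" "ball a \<rho> \<subseteq> S"
  shows "bounded S"
proof -
  define v where "v = measure lborel (ball a (\<rho> / 2))"
  have ev: "emeasure lborel (ball z (\<rho> / 2)) = ennreal v" for z :: 'a
    using \<rho> by (simp add: v_def emeasure_ball measure_def)
  have v: "v > 0" using \<rho> by (simp add: v_def content_ball)
  obtain m where m: "emeasure lborel S = ennreal m" "0 \<le> m" using fin by (metis ennreal_cases less_irrefl top_neq_ennreal)
  obtain N :: nat where N: "m / v < N" using reals_Archimedean2 by blast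
  have "dist a z < 2 * N * \<rho>" if z: "z \<in> S" for z
  proof (rule ccontr)
    assume "\<not> ?thesis"
    then have far: "2 * N * \<rho> \<le> norm (z - a)" by (simp add: dist_norm norm_minus_commute)
    have N0: "N > 0" using N m v by (metis divide_nonneg_pos not_le of_nat_0 gr0I)
    \<comment> \<open>The centres stay in the half of the segment next to a, where the shrinking
      factor is at least 1/2, so that balls of radius \<rho> / 2 fit. Consecutive centres are norm
      (z - a) / (2 N) \<ge> \<rho> apart, so these balls are disjoint, and N of them have more than
      the volume m of S.\<close>
    define w where "w j = a + (real j / (2 * N)) *\<^sub>R (z - a)" for j :: nat
    have sub: "ball (w j) (\<rho> / 2) \<subseteq> S" if j: "j < N" for j
    proof
      fix p assume p: "p \<in> ball (w j) (\<rho> / 2)"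
      define t where "t = real j / (2 * N)"
      have t: "0 \<le> t" "t \<le> 1/2" using j by (auto simp: t_def divide_simps)
      define b where "b = p - w j"
      have b: "norm b < \<rho> / 2" using p by (simp add: b_def dist_norm norm_minus_commute)
      define e where "e = b /\<^sub>R (1 - t)"
      have "norm e = inverse \<bar>1 - t\<bar> * norm b" by (simp add: e_def)
      also have "\<dots> \<le> 2 * norm b"
        by (rule mult_right_mono) (use t in \<open>auto simp: abs_if inverse_eq_divide divide_le_eq\<close>)
      finally have "a + e \<in> ball a \<rho>" using b by (simp add: dist_norm)
      then have "(1 - t) *\<^sub>R (a + e) + t *\<^sub>R z \<in> S"
        using \<rho> t z by (intro convexD[OF conv]) auto
      moreover have "(1 - t) *\<^sub>R e = b" using t by (simp add: e_def)
      then have "(1 - t) *\<^sub>R (a + e) + t *\<^sub>R z = a + t *\<^sub>R (z - a) + b"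
        by (simp add: algebra_simps)
      then have "(1 - t) *\<^sub>R (a + e) + t *\<^sub>R z = p" by (simp add: b_def w_def t_def)
      ultimately show "p \<in> S" by simp
    qed
    have disj: "disjoint_family_on (\<lambda>j. ball (w j) (\<rho> / 2)) {..<N}"
      unfolding disjoint_family_on_def
    proof (intro ballI impI)
      fix i j :: nat assume ij: "i \<noteq> j"
      have "\<rho> \<le> norm (z - a) / (2 * N)" using far N0 by (simp add: field_simps)
      also have "\<dots> \<le> \<bar>real i - real j\<bar> * (norm (z - a) / (2 * N))"
      proof -
        have "1 \<le> \<bar>real i - real j\<bar>" using ij by linarith
        from mult_right_mono[OF this, of "norm (z - a) / (2 * N)"] show ?thesis by simp
      qed
      also have "\<dots> = dist (w i) (w j)"
      proof -
        have "w i - w j = ((real i - real j) / (2 * N)) *\<^sub>R (z - a)"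
          by (simp add: w_def diff_divide_distrib algebra_simps)
        then show ?thesis by (simp add: dist_norm)
      qed
      finally show "ball (w i) (\<rho> / 2) \<inter> ball (w j) (\<rho> / 2) = {}"
        by (intro disjoint_ballI) simp
    qed
    have "(\<Sum>j<N. emeasure lborel (ball (w j) (\<rho> / 2))) = emeasure lborel (\<Union>j<N. ball (w j) (\<rho> / 2))"
      using disj by (intro sum_emeasure) auto
    also have "\<dots> \<le> emeasure lborel S" using sub meas by (intro emeasure_mono) auto
    finally have "ennreal (real N * v) \<le> ennreal m"
      using v m by (simp add: ev ennreal_mult ennreal_of_nat_eq_real_of_nat)
    then have "N * v \<le> m" using m by (simp add: ennreal_le_iff)
    then show False using N v by (simp add: field_simps)
  qed
  then have "S \<subseteq> ball a (2 * N * \<rho>)" by auto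
  then show ?thesis by (rule bounded_subset[OF bounded_ball])
qed

section \<open>The John position\<close>

lemma log_concave_nonneg:
  assumes "log_concave h"
  shows "0 \<le> h x"
proof -
  obtain \<phi> where "\<And>x. h x = exp_minus (\<phi> x)" using assms by (auto simp: log_concave_def)
  then show ?thesis by (cases "\<phi> x") (auto simp: exp_minus_def)
qed

text \<open>Where \<phi> is infinite at x or y the left side is 0, since
  \<open>0 powr t = 0\<close>; elsewhere this is the convexity of \<phi> under the
  exponential.\<close>

lemma log_concaveD:
  assumes "log_concave h" "0 < t" "t < 1"
  shows "h x powr (1 - t) * h y powr t \<le> h ((1 - t) *\<^sub>R x + t *\<^sub>R y)"
proof -
  obtain \<phi> where \<phi>: "convex_ext \<phi>" "\<And>x. h x = exp_minus (\<phi> x)"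
    using assms(1) by (auto simp: log_concave_def)
  have ninf: "\<phi> z \<noteq> - \<infinity>" for z using \<phi>(1) by (simp add: convex_ext_def)
  let ?z = "(1 - t) *\<^sub>R x + t *\<^sub>R y"
  have le: "\<phi> ?z \<le> ereal (1 - t) * \<phi> x + ereal t * \<phi> y"
    using \<phi>(1) assms(2,3) by (simp add: convex_ext_def)
  show ?thesis
  proof (cases "\<phi> x = \<infinity> \<or> \<phi> y = \<infinity>")
    case True
    then have "h x = 0 \<or> h y = 0" by (auto simp: \<phi>(2) exp_minus_def)
    then show ?thesis using log_concave_nonneg[OF assms(1)] by auto
  next
    case False
    then obtain a b where ab: "\<phi> x = ereal a" "\<phi> y = ereal b"
      using ninf by (metis ereal_cases)
    with le ninf[of ?z] obtain c where c: "\<phi> ?z = ereal c" "c \<le> (1 - t) * a + t * b"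
      by (cases "\<phi> ?z") auto
    have "h x powr (1 - t) * h y powr t = exp (- ((1 - t) * a + t * b))"
      by (simp add: \<phi>(2) ab exp_minus_def powr_def flip: exp_add)
    also have "\<dots> \<le> h ?z" using c by (simp add: \<phi>(2) exp_minus_def)
    finally show ?thesis .
  qed
qed

locale john_position =
  fixes s :: real and h :: "real ^ 'n \<Rightarrow> real"
  assumes s_pos: "0 < s" and proper: "proper_log_concave h" and john: "John_s_ellipsoid s h (cball 0 1)"
begin

text \<open>The half-length of the vertical slices of the s-lifting: containment of an ellipsoid
  becomes a pointwise inequality between \<open>ball_profile\<close> and q.\<close>

definition q :: "real ^ 'n \<Rightarrow> real" where
  "q x = h x powr (1 / s)"

lemma q_nonneg [simp]: "0 \<le> q x"
  by (simp add: q_def)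

lemma h_nonneg [simp]: "0 \<le> h x"
  using proper log_concave_nonneg by (auto simp: proper_log_concave_def)

lemma q_log_concave:
  assumes "0 < t" "t < 1"
  shows "q x powr (1 - t) * q y powr t \<le> q ((1 - t) *\<^sub>R x + t *\<^sub>R y)"
proof -
  have "q x powr (1 - t) * q y powr t = (h x powr (1 - t) * h y powr t) powr (1 / s)"
    by (simp add: q_def powr_mult powr_powr mult.commute)
  also have "\<dots> \<le> q ((1 - t) *\<^sub>R x + t *\<^sub>R y)"
    unfolding q_def using proper assms s_pos
    by (intro powr_mono2 log_concaveD) (auto simp: proper_log_concave_def)
  finally show ?thesis .
qed

lemma q_midpoint: "sqrt (q x * q y) \<le> q ((1/2) *\<^sub>R (x + y))"
  using q_log_concave[of "1/2" x y] by (simp add: real_sqrt_mult powr_half_sqrt scaleR_add_right)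

lemma open_q_less: "open {x. q x < c}"
proof (cases "c \<le> 0")
  case True
  then have "{x. q x < c} = {}" using q_nonneg by (auto simp: not_less intro: order_trans)
  then show ?thesis by simp
next
  case False
  have "q x < c \<longleftrightarrow> h x < c powr s" for x
  proof -
    have "q x < c \<longleftrightarrow> q x powr s < c powr s"
      using False s_pos by (meson not_le powr_less_mono2 powr_mono2 q_nonneg less_imp_le)
    then show ?thesis using s_pos by (simp add: q_def powr_powr)
  qed
  then show ?thesis using proper by (simp add: proper_log_concave_def)
qed

lemma borel_measurable_q [measurable]: "q \<in> borel_measurable borel"
  by (rule borel_measurableI_less) (use open_q_less in auto)

text \<open>The containment half of the John hypothesis; its maximality half enters through
  \<open>contained_volume\<close>.\<close>

lemma ball_profile_le_q: "ball_profile x \<le> q x"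
proof (cases "norm x \<le> 1")
  case True
  then have "(norm x)\<^sup>2 \<le> 1" by (simp add: power_le_one)
  then have "(x, ball_profile x) \<in> cball 0 1" unfolding mem_cball_Pair_iff by (simp add: ball_profile_def)
  then have "(x, ball_profile x) \<in> s_lifting s h" using john by (auto simp: John_s_ellipsoid_def)
  then show ?thesis by (simp add: s_lifting_def q_def)
next
  case False
  then have "(norm x)\<^sup>2 > 1" by (simp add: one_less_power)
  then show ?thesis by (simp add: ball_profile_def)
qed

text \<open>The ellipsoid \<open>(A \<oplus> \<alpha>) B + (v, 0)\<close> lies in the \<open>s\<close>-lifting of \<^term>\<open>h\<close>.\<close>

definition contained :: "real ^ 'n ^ 'n \<Rightarrow> real \<Rightarrow> real ^ 'n \<Rightarrow> bool" where
  "contained A \<alpha> v \<longleftrightarrow> (\<forall>x. \<alpha> * ball_profile x \<le> q (A *v x + v))"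

text \<open>Maximality of the unit ball: both s-volumes are multiples of the same positive finite
  integral, so the inequality between them is one between the factors.\<close>

lemma contained_volume:
  assumes A: "spd A" and \<alpha>: "0 < \<alpha>" and con: "contained A \<alpha> v"
  shows "\<alpha> powr s * det A \<le> 1"
proof -
  let ?C = "(\<lambda>(x, t). (A *v x + v, \<alpha> * t)) ` cball 0 1"
  let ?V = "\<integral>\<^sup>+x. ennreal (ball_profile (x :: real ^ 'n) powr s) \<partial>lborel"
  have maximal: "s_volume s C' \<le> s_volume s (cball 0 1 :: ((real ^ 'n) \<times> real) set)"
    if "n_symmetric_ellipsoid C'" "C' \<subseteq> s_lifting s h" for C'
    using john that unfolding John_s_ellipsoid_def by blast
  have sub: "?C \<subseteq> s_lifting s h"
  proof clarify
    fix x :: "real ^ 'n" and t :: real assume "(x, t) \<in> cball 0 1"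
    then have "(norm x)\<^sup>2 + t\<^sup>2 \<le> 1" unfolding mem_cball_Pair_iff .
    then have "\<bar>t\<bar> \<le> ball_profile x"
      unfolding ball_profile_def real_sqrt_abs[symmetric] real_sqrt_le_iff by auto
    then have "\<alpha> * \<bar>t\<bar> \<le> \<alpha> * ball_profile x" using \<alpha> by simp
    also have "\<dots> \<le> q (A *v x + v)" using con by (simp add: contained_def)
    finally show "(A *v x + v, \<alpha> * t) \<in> s_lifting s h"
      using \<alpha> by (simp add: s_lifting_def q_def abs_mult)
  qed
  have "n_symmetric_ellipsoid ?C"
    unfolding n_symmetric_ellipsoid_def
    by (intro exI[of _ A] exI[of _ \<alpha>] exI[of _ v] conjI A \<alpha> refl)
  then have "s_volume s ?C \<le> s_volume s (cball 0 1 :: ((real ^ 'n) \<times> real) set)"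
    using sub by (rule maximal)
  moreover have "s_volume s (cball 0 1 :: ((real ^ 'n) \<times> real) set) = ?V"
    using s_volume_ellipsoid[OF s_pos spd_mat_1, of 1 0] by simp
  ultimately have le: "ennreal (\<alpha> powr s * det A) * ?V \<le> 1 * ?V"
    unfolding s_volume_ellipsoid[OF s_pos A \<alpha>] by simp
  have "ennreal (\<alpha> powr s * det A) \<le> 1"
  proof (rule ccontr)
    assume "\<not> ?thesis"
    then have "1 * ?V < ennreal (\<alpha> powr s * det A) * ?V"
      by (intro ennreal_mult_strict_right_mono)
        (use ball_profile_integral[OF s_pos, where 'a = "real ^ 'n"] in \<open>auto simp: less_top zero_less_iff_neq_zero\<close>)
    then show False using le by simp
  qed
  then show ?thesis by simp
qed

text \<open>Averaging with the unit ball forces \<open>A\<close> and \<open>\<alpha>\<close>; if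
  \<open>B + (v, 0)\<close> is contained with \<open>v \<noteq> 0\<close>, then so is the unit ball centred at \<open>v / 2\<close> and
  stretched in the direction of \<open>v\<close>.\<close>

lemma contained_unique:
  assumes A: "spd A" and \<alpha>: "0 < \<alpha>" and vol: "\<alpha> powr s * det A = 1" and con: "contained A \<alpha> v"
  shows "A = mat 1" "\<alpha> = 1" "v = 0"
proof -
  have con': "contained ((1/2) *\<^sub>R (A + mat 1)) (sqrt \<alpha>) ((1/2) *\<^sub>R v)"
    unfolding contained_def
  proof
    fix x :: "real ^ 'n"
    have p: "0 \<le> ball_profile x" by (simp add: ball_profile_def)
    have "sqrt \<alpha> * ball_profile x = sqrt ((\<alpha> * ball_profile x) * ball_profile x)"
      using p by (simp add: real_sqrt_mult)
    also have "\<dots> \<le> sqrt (q (A *v x + v) * q x)"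
      using con p \<alpha> ball_profile_le_q[of x] by (intro real_sqrt_le_mono mult_mono) (auto simp: contained_def)
    also have "\<dots> \<le> q ((1/2) *\<^sub>R (A *v x + v + x))" by (rule q_midpoint)
    also have "(1/2) *\<^sub>R (A *v x + v + x) = ((1/2) *\<^sub>R (A + mat 1)) *v x + (1/2) *\<^sub>R v"
      by (simp add: matrix_vector_mult_add_rdistrib scaleR_matrix_vector_assoc[symmetric] algebra_simps)
    finally show "sqrt \<alpha> * ball_profile x \<le> q (((1/2) *\<^sub>R (A + mat 1)) *v x + (1/2) *\<^sub>R v)" .
  qed
  have "spd ((1/2) *\<^sub>R (A + mat 1))" by (intro spd_scaleR spd_add A spd_mat_1) simp
  from contained_volume[OF this _ con'] \<alpha>
  have le1: "sqrt \<alpha> powr s * det ((1/2) *\<^sub>R (A + mat 1)) \<le> 1" by simp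
  have eq1: "sqrt \<alpha> powr s * sqrt (det A * det (mat 1 :: real ^ 'n ^ 'n)) = 1"
  proof -
    have "sqrt \<alpha> powr s = sqrt (\<alpha> powr s)"
      using \<alpha> by (simp add: powr_half_sqrt[symmetric] powr_powr mult.commute)
    then show ?thesis using vol by (simp add: real_sqrt_mult[symmetric])
  qed
  show A1: "A = mat 1"
  proof (rule ccontr)
    assume "A \<noteq> mat 1"
    from det_midpoint(2)[OF A spd_mat_1 this]
    have "sqrt \<alpha> powr s * sqrt (det A * det (mat 1 :: real ^ 'n ^ 'n))
        < sqrt \<alpha> powr s * det ((1/2) *\<^sub>R (A + mat 1))" using \<alpha> by simp
    then show False using le1 eq1 by simp
  qed
  then have "\<alpha> powr s = 1 powr s" using vol by simp
  then show \<alpha>1: "\<alpha> = 1" using \<alpha> s_pos by (metis less_irrefl powr_less_mono2 less_imp_le linorder_neqE_linordered_idom zero_le_one)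
  show "v = 0"
  proof (rule ccontr)
    assume v: "v \<noteq> 0"
    \<comment> \<open>E is the rank one matrix of v. The map A' stretches by 1 + norm v / 2 along v,
      so that the ellipsoid centred at v / 2 reaches, in that direction, exactly from the end of the
      unit ball to the opposite end of its translate by v.\<close>
    define E where "E = (\<chi> i j. v $ i * v $ j)"
    have E: "E *v x = (v \<bullet> x) *\<^sub>R v" for x
      by (simp add: E_def vec_eq_iff matrix_vector_mult_def inner_vec_def sum_distrib_left sum_distrib_right mult.assoc
          mult.left_commute mult.commute)
    define A' where "A' = mat 1 + (1 / (2 * norm v)) *\<^sub>R E"
    have A': "A' *v x = x + ((v \<bullet> x) / (2 * norm v)) *\<^sub>R v" for x
      by (simp add: A'_def matrix_vector_mult_add_rdistrib scaleR_matrix_vector_assoc[symmetric] E)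
    have ge: "x \<bullet> x \<le> x \<bullet> (A' *v x)" for x
      by (simp add: A' inner_add_right inner_commute[of x v])
    have spd: "spd A'"
      unfolding spd_def
    proof (intro conjI allI impI)
      show "transpose A' = A'"
        by (simp add: A'_def E_def transpose_def mat_def vec_eq_iff mult.commute)
      fix x :: "real ^ 'n" assume "x \<noteq> 0"
      then have "0 < x \<bullet> x" by simp
      then show "0 < x \<bullet> (A' *v x)" using ge[of x] by linarith
    qed
    have "A' *v v \<noteq> v" using v by (simp add: A')
    then have "A' \<noteq> mat 1" by auto
    then have "1 < det A'" using det_gt_1[OF spd] ge by blast
    moreover have "contained A' 1 ((1/2) *\<^sub>R v)"
      unfolding contained_def
    proof
      fix x :: "real ^ 'n"
      show "1 * ball_profile x \<le> q (A' *v x + (1/2) *\<^sub>R v)"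
      proof (cases "norm x < 1")
        case False
        then have "(norm x)\<^sup>2 \<ge> 1" by (simp add: one_le_power)
        then show ?thesis by (simp add: ball_profile_def)
      next
        case True
        have p: "0 < ball_profile x" using True by (simp add: ball_profile_def abs_square_less_1)
        \<comment> \<open>The image \<open>A' *v x + v / 2\<close> is x + t v, a point between x and
          x + v. At both ends q is at least \<open>ball_profile x\<close>, and log-concavity carries
          this bound over to the segment.\<close>
        define t where "t = 1/2 + (v \<bullet> x) / (2 * norm v)"
        have "\<bar>v \<bullet> x\<bar> < norm v"
          using Cauchy_Schwarz_ineq2[of v x] True v
          by (meson le_less_trans mult_less_cancel_left2 norm_ge_zero zero_less_norm_iff not_le)
        then have t: "0 < t" "t < 1" using v by (auto simp: t_def field_simps abs_less_iff)
        have "(1 - t) *\<^sub>R x + t *\<^sub>R (x + v) = x + t *\<^sub>R v" by (simp add: algebra_simps)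
        then have "A' *v x + (1/2) *\<^sub>R v = (1 - t) *\<^sub>R x + t *\<^sub>R (x + v)"
          by (simp add: A' t_def scaleR_add_left add.commute)
        moreover have "ball_profile x powr (1 - t) * ball_profile x powr t \<le> q x powr (1 - t) * q (x + v) powr t"
          using t p ball_profile_le_q[of x] con unfolding A1 \<alpha>1 contained_def
          by (intro mult_mono powr_mono2) auto
        moreover have "ball_profile x powr (1 - t) * ball_profile x powr t = ball_profile x"
          using p by (simp flip: powr_add)
        ultimately show ?thesis using q_log_concave[OF t, of x "x + v"] by simp
      qed
    qed
    ultimately show False using contained_volume[OF spd, of 1] by simp
  qed
qed

text \<open>The set is convex by log-concavity, has finite measure because the integrable h is at
  least (1/2) powr s on it, and contains a ball because q dominates
  \<open>ball_profile\<close>.\<close>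

lemma bounded_q_superlevel: "bounded {x. 1/2 \<le> q x}"
proof (rule bounded_convex_finite_measure)
  show "convex {x. 1/2 \<le> q x}"
    unfolding convex_alt
  proof (intro ballI allI impI CollectI)
    fix x y and t :: real
    assume x: "x \<in> {x. 1/2 \<le> q x}" and y: "y \<in> {x. 1/2 \<le> q x}" and t: "0 \<le> t \<and> t \<le> 1"
    show "1/2 \<le> q ((1 - t) *\<^sub>R x + t *\<^sub>R y)"
    proof (cases "t = 0 \<or> t = 1")
      case True
      then show ?thesis using x y by auto
    next
      case False
      then have t: "0 < t" "t < 1" using t by auto
      have "(1/2) powr (1 - t) * (1/2) powr t \<le> q x powr (1 - t) * q y powr t"
        using x y t by (intro mult_mono powr_mono2) auto
      then show ?thesis using q_log_concave[OF t, of x y] by (simp flip: powr_add)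
    qed
  qed
  show meas: "{x. 1/2 \<le> q x} \<in> sets borel" by measurable
  show "ball 0 (1/2) \<subseteq> {x. 1/2 \<le> q x}"
  proof
    fix x :: "real ^ 'n" assume "x \<in> ball 0 (1/2)"
    then have "(norm x)\<^sup>2 \<le> (1/2)\<^sup>2" by (intro power_mono) auto
    then have "sqrt ((1/2)\<^sup>2) \<le> ball_profile x"
      unfolding ball_profile_def by (intro real_sqrt_le_mono) (simp add: power2_eq_square)
    then have "1/2 \<le> ball_profile x" by simp
    then show "x \<in> {x. 1/2 \<le> q x}" using ball_profile_le_q[of x] by simp
  qed
  define c where "c = (1/2 :: real) powr s"
  have c: "c > 0" by (simp add: c_def)
  have "ennreal c * emeasure lborel {x. 1/2 \<le> q x} = (\<integral>\<^sup>+x. ennreal c * indicator {x. 1/2 \<le> q x} x \<partial>lborel)"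
    using meas by (simp add: nn_integral_cmult)
  also have "\<dots> \<le> (\<integral>\<^sup>+x. ennreal (h x) \<partial>lborel)"
  proof (rule nn_integral_mono)
    fix x
    have "c \<le> h x" if "1/2 \<le> q x"
    proof -
      have "c \<le> q x powr s" unfolding c_def using that s_pos by (intro powr_mono2) auto
      then show ?thesis using s_pos by (simp add: q_def powr_powr)
    qed
    then show "ennreal c * indicator {x. 1/2 \<le> q x} x \<le> ennreal (h x)"
      by (auto simp: indicator_def intro: ennreal_leI)
  qed
  also have "\<dots> < top"
    using proper by (auto simp: proper_log_concave_def integrable_iff_bounded less_top)
  finally show "emeasure lborel {x. 1/2 \<le> q x} < top"
    using c by (auto simp: ennreal_mult_less_top)
qed simp

lemma q_bounded_on_compact:
  assumes "compact S"
  obtains Q where "\<And>x. x \<in> S \<Longrightarrow> q x \<le> Q"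
proof -
  have "S \<subseteq> (\<Union>n::nat\<in>UNIV. {x. q x < n})"
    using reals_Archimedean2 by auto
  then obtain D :: "nat set" where D: "finite D" "S \<subseteq> (\<Union>n\<in>D. {x. q x < real n})"
    using compactE_image[OF assms, of UNIV "\<lambda>n. {x. q x < real n}"] open_q_less by metis
  have "q x \<le> real (\<Sum>D)" if x: "x \<in> S" for x
  proof -
    obtain n where "n \<in> D" "q x < n" using D x by blast
    moreover have "n \<le> \<Sum>D" using D(1) \<open>n \<in> D\<close> using member_le_sum[of n D "\<lambda>n. n"] by simp
    ultimately show ?thesis by (meson less_imp_le of_nat_mono order_trans)
  qed
  then show thesis by (rule that)
qed

text \<open>On the sphere of radius R, q is below 1/2, while q 0 \<ge> 1. For x outside,
  log-concavity along the segment from 0 to x, read at its point of norm R, gives q x \<le> (1/2)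
  powr (norm x / R).\<close>

lemma q_exponential_decay:
  obtains Q c where "0 < Q" "0 < c" "\<And>x. q x \<le> Q * exp (- c * norm x)"
proof -
  obtain R where R: "R > 0" "\<And>x. 1/2 \<le> q x \<Longrightarrow> norm x < R"
    using bounded_q_superlevel unfolding bounded_pos_less by auto
  obtain Q0 where Q0: "\<And>x. x \<in> cball 0 R \<Longrightarrow> q x \<le> Q0"
    using q_bounded_on_compact[OF compact_cball] by blast
  \<comment> \<open>This c rewrites (1/2) powr (norm x / R) as an exponential; the factor exp (c R)
    in Q makes the same bound valid inside the ball of radius R.\<close>
  define c where "c = ln 2 / R"
  define Q where "Q = max 1 Q0 * exp (c * R)"
  have c: "0 < c" using R by (simp add: c_def)
  have Q: "0 < Q" "1 \<le> Q" using c R by (auto simp: Q_def less_max_iff_disj intro!: mult_ge1_I)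
  have "q x \<le> Q * exp (- c * norm x)" for x
  proof (cases "norm x \<le> R")
    case True
    have "q x \<le> max 1 Q0 * 1" using Q0[of x] True by simp
    also have "\<dots> \<le> max 1 Q0 * exp (c * R - c * norm x)"
      using True c by (intro mult_left_mono) (auto simp: less_imp_le)
    also have "\<dots> = Q * exp (- c * norm x)" by (simp add: Q_def exp_diff exp_minus field_simps)
    finally show ?thesis .
  next
    case False
    define t where "t = R / norm x"
    have t: "0 < t" "t < 1" using False R by (auto simp: t_def divide_simps)
    have "norm (t *\<^sub>R x) = R" using R False by (auto simp: t_def)
    then have "q (t *\<^sub>R x) < 1/2" using R(2)[of "t *\<^sub>R x"] by force
    moreover have "q 0 powr (1 - t) * q x powr t \<le> q (t *\<^sub>R x)"
      using q_log_concave[OF t, of 0 x] by simp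
    moreover have "1 \<le> q 0" using ball_profile_le_q[of 0] by (simp add: ball_profile_def)
    then have "1 \<le> q 0 powr (1 - t)" using t by (intro ge_one_powr_ge_zero) auto
    then have "1 * q x powr t \<le> q 0 powr (1 - t) * q x powr t" by (intro mult_right_mono) auto
    ultimately have "q x powr t \<le> 1/2" by linarith
    then have "(q x powr t) powr (1 / t) \<le> (1/2) powr (1 / t)" using t by (intro powr_mono2) auto
    then have "q x \<le> (1/2) powr (1 / t)" using t by (simp add: powr_powr)
    also have "\<dots> = exp (- c * norm x)"
      by (simp add: powr_def t_def c_def ln_div)
    also have "\<dots> \<le> Q * exp (- c * norm x)" using Q by simp
    finally show ?thesis .
  qed
  then show thesis using that Q c by blast
qed

end

section \<open>Convex loss integrals\<close>

text \<open>For a > 0 and F tending to infinity, the value at b = 0 is the limit of F (a / b) as b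
  decreases to 0, which preserves lower semicontinuity there.\<close>

definition loss :: "(real \<Rightarrow> real) \<Rightarrow> real \<Rightarrow> real \<Rightarrow> ennreal" where
  "loss F a b = (if b = 0 then top else ennreal (F (a / b)))"

definition loss_fun :: "(real \<Rightarrow> real) \<Rightarrow> bool" where
  "loss_fun F \<longleftrightarrow> mono F \<and> convex_on UNIV F \<and> (\<forall>x. 0 \<le> F x) \<and> filterlim F at_top at_top"

lemma loss_fun_continuous: "loss_fun F \<Longrightarrow> continuous_on UNIV F"
  by (auto simp: loss_fun_def intro: convex_on_continuous)

lemma loss_fun_measurable: "loss_fun F \<Longrightarrow> F \<in> borel_measurable borel"
  by (intro borel_measurable_continuous_onI loss_fun_continuous)

lemma loss_mono_left:
  assumes "mono F" "a \<le> a'" "0 \<le> b"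
  shows "loss F a b \<le> loss F a' b"
  using assms by (auto simp: loss_def intro!: ennreal_leI monoD[OF assms(1)] divide_right_mono)

lemma convex_on_midpoint:
  fixes F :: "real \<Rightarrow> real"
  assumes "convex_on UNIV F"
  shows "2 * F ((u + v) / 2) \<le> F u + F v"
  using convex_onD[OF assms, of "1/2" u v] by (simp add: add_divide_distrib)

text \<open>The quotient is at most the geometric mean of the two given quotients, hence at most
  their arithmetic mean. This is how log-concavity of the denominator becomes convexity of the
  quotient.\<close>

lemma quotient_le_mean:
  fixes a b :: real
  assumes a: "0 < a1" "0 < a2" "a \<le> sqrt (a1 * a2)" and b: "0 < b1" "0 < b2" "sqrt (b1 * b2) \<le> b"
  shows "a / b \<le> (a1 / b1 + a2 / b2) / 2"
proof -
  have sb: "0 < sqrt (b1 * b2)" using b by simp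
  have "a / b \<le> sqrt (a1 * a2) / sqrt (b1 * b2)"
    using a b sb by (intro frac_le) auto
  also have "\<dots> = sqrt ((a1 / b1) * (a2 / b2))" by (simp add: real_sqrt_divide)
  also have "\<dots> \<le> (a1 / b1 + a2 / b2) / 2" using a b by (intro arith_geo_mean_sqrt) auto
  finally show ?thesis .
qed

lemma loss_midpoint:
  assumes F: "loss_fun F"
    and a: "0 < a1" "0 < a2" "a \<le> sqrt (a1 * a2)"
    and b: "0 \<le> b1" "0 \<le> b2" "sqrt (b1 * b2) \<le> b"
  shows "2 * loss F a b \<le> loss F a1 b1 + loss F a2 b2"
proof (cases "b1 = 0 \<or> b2 = 0")
  case True
  then show ?thesis by (auto simp: loss_def)
next
  case False
  then have b': "0 < b1" "0 < b2" using b by auto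
  then have "0 < sqrt (b1 * b2)" by simp
  then have b0: "0 < b" using b by linarith
  have "2 * F (a / b) \<le> 2 * F ((a1 / b1 + a2 / b2) / 2)"
    using quotient_le_mean[OF a b' b(3)] F by (auto simp: loss_fun_def mono_def)
  also have "\<dots> \<le> F (a1 / b1) + F (a2 / b2)"
    using F by (intro convex_on_midpoint) (simp add: loss_fun_def)
  finally have "ennreal (2 * F (a / b)) \<le> ennreal (F (a1 / b1) + F (a2 / b2))" by (rule ennreal_leI)
  then show ?thesis using b0 b' F by (simp add: loss_def loss_fun_def ennreal_mult)
qed

text \<open>Upper semicontinuity bounds Y k only from above, by b + \<epsilon>. Since
  \<open>loss\<close> decreases in its second argument, this gives the lower bound F (a / (b +
  \<epsilon>)), and \<epsilon> then tends to 0.\<close>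

lemma loss_lower_semicontinuous:
  assumes F: "loss_fun F" and a: "X \<longlonglongrightarrow> a" "0 < a" and b: "0 \<le> b" "\<And>k. 0 \<le> Y k"
    and usc: "\<And>\<epsilon>. 0 < \<epsilon> \<Longrightarrow> eventually (\<lambda>k. Y k < b + \<epsilon>) sequentially"
  shows "loss F a b \<le> liminf (\<lambda>k. loss F (X k) (Y k))"
proof -
  have cont: "isCont F x" for x
    using loss_fun_continuous[OF F] by (simp add: continuous_on_eq_continuous_at)
  have *: "ennreal (F (a / (b + \<epsilon>))) \<le> liminf (\<lambda>k. loss F (X k) (Y k))" if \<epsilon>: "0 < \<epsilon>" for \<epsilon>
  proof -
    have "(\<lambda>k. F (X k / (b + \<epsilon>))) \<longlonglongrightarrow> F (a / (b + \<epsilon>))"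
      using a b \<epsilon> by (intro isCont_tendsto_compose[OF cont] tendsto_intros) auto
    then have "(\<lambda>k. ennreal (F (X k / (b + \<epsilon>)))) \<longlonglongrightarrow> ennreal (F (a / (b + \<epsilon>)))"
      by (intro tendsto_intros)
    then have "ennreal (F (a / (b + \<epsilon>))) = liminf (\<lambda>k. ennreal (F (X k / (b + \<epsilon>))))"
      by (intro lim_imp_Liminf[symmetric]) auto
    also have "\<dots> \<le> liminf (\<lambda>k. loss F (X k) (Y k))"
    proof (rule Liminf_mono)
      have "eventually (\<lambda>k. 0 < X k) sequentially" using a by (rule order_tendstoD)
      with usc[OF \<epsilon>] show "eventually (\<lambda>k. ennreal (F (X k / (b + \<epsilon>))) \<le> loss F (X k) (Y k)) sequentially"
      proof eventually_elim
        case (elim k)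
        show ?case
        proof (cases "Y k = 0")
          case False
          then have "X k / (b + \<epsilon>) \<le> X k / Y k" using elim b(2)[of k] by (intro divide_left_mono) auto
          then show ?thesis using False F by (auto simp: loss_def loss_fun_def mono_def intro!: ennreal_leI)
        qed (simp add: loss_def)
      qed
    qed
    finally show ?thesis .
  qed
  have pos: "eventually (\<lambda>\<epsilon>::real. 0 < \<epsilon>) (at_right 0)" by (simp add: eventually_at_right_less)
  show ?thesis
  proof (cases "b = 0")
    case False
    have "((\<lambda>\<epsilon>. ennreal (F (a / (b + \<epsilon>)))) \<longlongrightarrow> ennreal (F (a / (b + 0)))) (at_right 0)"
      using False by (intro tendsto_ennrealI isCont_tendsto_compose[OF cont] tendsto_intros) auto
    then have "ennreal (F (a / b)) \<le> liminf (\<lambda>k. loss F (X k) (Y k))"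
      using * pos by (intro tendsto_upperbound) (auto elim: eventually_mono)
    then show ?thesis using False by (simp add: loss_def)
  next
    case True
    have "ennreal (real M) \<le> liminf (\<lambda>k. loss F (X k) (Y k))" for M :: nat
    proof -
      have "eventually (\<lambda>u. real M \<le> F u) at_top"
        using F by (simp add: loss_fun_def filterlim_at_top)
      then obtain u0 where u0: "\<And>u. u0 \<le> u \<Longrightarrow> real M \<le> F u" by (auto simp: eventually_at_top_linorder)
      \<comment> \<open>For b = 0 the choice \<epsilon> = a / u turns the bound \<open>*\<close>
        into F u, which is at least M; the maximum with 1 keeps u positive.\<close>
      define u where "u = max 1 u0"
      have "real M \<le> F (a / (b + a / u))" using True a by (simp add: u_def u0)
      then have "ennreal (real M) \<le> ennreal (F (a / (b + a / u)))" by (rule ennreal_leI)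
      also have "\<dots> \<le> liminf (\<lambda>k. loss F (X k) (Y k))" using a by (intro *) (simp add: u_def)
      finally show ?thesis .
    qed
    then have "liminf (\<lambda>k. loss F (X k) (Y k)) = top"
      by (metis ennreal_of_nat_eq_real_of_nat ennreal_Ex_less_of_nat less_top not_le)
    then show ?thesis by simp
  qed
qed

section \<open>Auxiliary bounds for determinants and exponentials\<close>

lemma tendsto_det:
  fixes A :: "real ^ 'n ^ 'n"
  assumes "(X \<longlongrightarrow> A) F"
  shows "((\<lambda>k. det (X k)) \<longlongrightarrow> det A) F"
  unfolding det_def by (intro tendsto_intros assms)

lemma det_le_fact_mult_power:
  fixes A :: "real ^ 'n ^ 'n"
  assumes "\<And>i j. \<bar>A $ i $ j\<bar> \<le> m"
  shows "\<bar>det A\<bar> \<le> fact CARD('n) * m ^ CARD('n)"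
proof -
  have "\<bar>det A\<bar> \<le> (\<Sum>p | p permutes (UNIV :: 'n set). \<bar>of_int (sign p) * (\<Prod>i\<in>UNIV. A $ i $ p i)\<bar>)"
    unfolding det_def by (rule sum_abs)
  also have "\<dots> \<le> (\<Sum>p | p permutes (UNIV :: 'n set). m ^ CARD('n))"
  proof (rule sum_mono)
    fix p :: "'n \<Rightarrow> 'n"
    have "\<bar>of_int (sign p) * (\<Prod>i\<in>UNIV. A $ i $ p i)\<bar> = (\<Prod>i\<in>UNIV. \<bar>A $ i $ p i\<bar>)"
      by (simp add: abs_mult abs_prod sign_def)
    also have "\<dots> \<le> (\<Prod>i\<in>(UNIV :: 'n set). m)" using assms by (intro prod_mono) auto
    finally show "\<bar>of_int (sign p) * (\<Prod>i\<in>UNIV. A $ i $ p i)\<bar> \<le> m ^ CARD('n)" by simp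
  qed
  also have "\<dots> = fact CARD('n) * m ^ CARD('n)" by (simp add: card_permutations)
  finally show ?thesis .
qed

lemma exp_dominates_power:
  assumes "0 < (c :: real)"
  obtains m0 where "\<And>m. exp (c * m) \<le> K * m ^ n \<Longrightarrow> 0 \<le> m \<Longrightarrow> m \<le> m0"
proof -
  have "((\<lambda>x::real. x ^ n / exp x) \<longlongrightarrow> 0) at_top" by (rule tendsto_power_div_exp_0)
  then have "((\<lambda>m. (c * m) ^ n / exp (c * m)) \<longlongrightarrow> 0) at_top"
    by (rule filterlim_compose) (use assms in \<open>auto intro: filterlim_tendsto_pos_mult_at_top filterlim_ident\<close>)
  moreover have "0 < c ^ n / (\<bar>K\<bar> + 1)" using assms by simp
  ultimately have "eventually (\<lambda>m. (c * m) ^ n / exp (c * m) < c ^ n / (\<bar>K\<bar> + 1)) at_top"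
    by (rule order_tendstoD)
  then obtain m0 where m0: "\<And>m. m0 \<le> m \<Longrightarrow> (c * m) ^ n / exp (c * m) < c ^ n / (\<bar>K\<bar> + 1)"
    by (auto simp: eventually_at_top_linorder)
  have "m \<le> m0" if m: "exp (c * m) \<le> K * m ^ n" "0 \<le> m" for m
  proof (rule ccontr)
    assume "\<not> m \<le> m0"
    then have "c ^ n * m ^ n / exp (c * m) < c ^ n / (\<bar>K\<bar> + 1)" using m0[of m] by (simp add: power_mult_distrib)
    then have "c ^ n * (m ^ n * (\<bar>K\<bar> + 1)) < c ^ n * exp (c * m)"
      by (simp add: pos_divide_less_eq pos_less_divide_eq mult.assoc mult.commute mult.left_commute)
    then have "m ^ n * (\<bar>K\<bar> + 1) < exp (c * m)" using assms by simp
    moreover have "K * m ^ n \<le> (\<bar>K\<bar> + 1) * m ^ n" using m by (intro mult_right_mono) auto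
    ultimately show False using m by (simp add: mult.commute)
  qed
  then show thesis by (rule that)
qed

text \<open>Evaluated at \<alpha> y / q it is the relative amount by which a point of the ellipsoid
  sticks out of the lifting.\<close>

definition positive_part :: "real \<Rightarrow> real" where
  "positive_part u = max 0 (u - 1)"

lemma loss_fun_positive_part: "loss_fun positive_part"
  unfolding loss_fun_def
proof (intro conjI allI)
  show "mono positive_part" by (auto simp: mono_def positive_part_def)
  show "convex_on UNIV positive_part"
  proof (rule convex_onI)
    fix t x y :: real
    assume t: "0 < t" "t < 1"
    have "(1 - t) * (x - 1) + t * (y - 1) \<le> (1 - t) * max 0 (x - 1) + t * max 0 (y - 1)"
      using t by (intro add_mono mult_left_mono) auto
    moreover have "(1 - t) *\<^sub>R x + t *\<^sub>R y - 1 = (1 - t) * (x - 1) + t * (y - 1)" by (simp add: algebra_simps)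
    moreover have "0 \<le> (1 - t) * max 0 (x - 1) + t * max 0 (y - 1)" using t by simp
    ultimately show "positive_part ((1 - t) *\<^sub>R x + t *\<^sub>R y) \<le> (1 - t) * positive_part x + t * positive_part y"
      unfolding positive_part_def by (simp only: max.bounded_iff)
  qed simp
  show "filterlim positive_part at_top at_top"
    by (rule filterlim_at_top_mono[OF filterlim_tendsto_add_at_top[OF tendsto_const[of "-1"] filterlim_ident]])
      (auto simp: positive_part_def)
qed (simp add: positive_part_def)

text \<open>Taken open so that a violated inequality with an upper semicontinuous right side is
  violated on an open set.\<close>

definition half_ball :: "('a::real_normed_vector \<times> real) set" where
  "half_ball = {p. norm p < 1 \<and> 0 < snd p}"

lemma open_half_ball: "open half_ball"
  unfolding half_ball_def by (intro open_Collect_conj open_Collect_less continuous_intros)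

lemma mem_half_ball_iff: "(x, y) \<in> half_ball \<longleftrightarrow> 0 < y \<and> (norm x)\<^sup>2 + y\<^sup>2 < 1"
  by (simp add: half_ball_def norm_Pair real_sqrt_lt_1_iff conj_commute)

context john_position begin

text \<open>The measure N absorbs the weight built from \<open>g\<close> and the prefactor, so that
  \<open>L_bar\<close> at fixed r and \<open>excess\<close> are instances of one functional and
  share the semicontinuity argument.\<close>

definition total_loss :: "(real \<Rightarrow> real) \<Rightarrow> ((real ^ 'n) \<times> real) measure \<Rightarrow> 'n block \<times> (real ^ 'n) \<Rightarrow> ennreal" where
  "total_loss F N = (\<lambda>((A, \<alpha>), v). \<integral>\<^sup>+p. loss F (\<alpha> * snd p) (q (A *v fst p + v)) \<partial>N)"

definition half_ball_measure :: "((real ^ 'n) \<times> real) measure" where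
  "half_ball_measure = density lborel (indicator half_ball)"

text \<open>A functional not involving \<open>r\<close>, \<open>f\<close>, \<open>g\<close> that is dominated by a multiple of every \<^const>\<open>L_bar\<close>.\<close>

definition excess :: "'n block \<times> (real ^ 'n) \<Rightarrow> ennreal" where
  "excess = total_loss positive_part half_ball_measure"

lemma borel_measurable_loss [measurable]:
  assumes "loss_fun F" and [measurable]: "X \<in> borel_measurable M" "Y \<in> borel_measurable M"
  shows "(\<lambda>p. loss F (X p) (Y p)) \<in> borel_measurable M"
proof -
  have [measurable]: "F \<in> borel_measurable borel" by (rule loss_fun_measurable) fact
  show ?thesis unfolding loss_def by measurable
qed

lemma borel_measurable_loss_integrand:
  fixes A :: "real ^ 'n ^ 'n"
  assumes "loss_fun F"
  shows "(\<lambda>p. loss F (\<alpha> * snd p) (q (A *v fst p + v))) \<in> borel_measurable borel"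
proof -
  have fst: "(\<lambda>p. fst p) \<in> borel_measurable (borel :: ((real ^ 'n) \<times> real) measure)"
    by (intro borel_measurable_continuous_onI continuous_intros)
  have "(\<lambda>p. A *v fst p + v) \<in> borel_measurable (borel :: ((real ^ 'n) \<times> real) measure)"
    by (intro borel_measurable_add borel_measurable_matrix_vector_mult borel_measurable_const fst)
  then have "(\<lambda>p. q (A *v fst p + v)) \<in> borel_measurable (borel :: ((real ^ 'n) \<times> real) measure)"
    using borel_measurable_q by (rule measurable_compose)
  moreover have "(\<lambda>p. \<alpha> * snd p) \<in> borel_measurable (borel :: ((real ^ 'n) \<times> real) measure)"
    by (intro borel_measurable_continuous_onI continuous_intros)
  ultimately show ?thesis using assms by (intro borel_measurable_loss)
qed

lemma q_upper_semicontinuous: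
  assumes "Z \<longlonglongrightarrow> z" "0 < \<epsilon>"
  shows "eventually (\<lambda>k. q (Z k) < q z + \<epsilon>) sequentially"
  using topological_tendstoD[OF assms(1) open_q_less[of "q z + \<epsilon>"]] assms(2) by simp

text \<open>Fatou's lemma applied to the pointwise semicontinuity of \<open>loss\<close>. Positivity
  of \<alpha> and of \<open>snd p\<close> almost everywhere makes the limiting numerator positive,
  as that pointwise statement demands.\<close>

lemma total_loss_lower_semicontinuous:
  assumes F: "loss_fun F" and N: "sets N = sets borel" "AE p in N. 0 < snd p"
    and lim: "P \<longlonglongrightarrow> ((A, \<alpha>), v)" and \<alpha>: "0 < \<alpha>"
  shows "total_loss F N ((A, \<alpha>), v) \<le> liminf (\<lambda>k. total_loss F N (P k))"
proof -
  define X where "X k p = loss F (snd (fst (P k)) * snd p) (q (fst (fst (P k)) *v fst p + snd (P k)))" for k p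
  have P: "(\<lambda>k. snd (fst (P k))) \<longlonglongrightarrow> \<alpha>" "(\<lambda>k. fst (fst (P k))) \<longlonglongrightarrow> A" "(\<lambda>k. snd (P k)) \<longlonglongrightarrow> v"
    using tendsto_fst[OF lim] tendsto_snd[OF lim] tendsto_fst[OF tendsto_fst[OF lim]] tendsto_snd[OF tendsto_fst[OF lim]]
    by simp_all
  have meas: "X k \<in> borel_measurable N" for k
    using borel_measurable_loss_integrand[OF F] N(1) unfolding X_def by (simp cong: measurable_cong_sets)
  have "total_loss F N ((A, \<alpha>), v) \<le> (\<integral>\<^sup>+p. liminf (\<lambda>k. X k p) \<partial>N)"
    unfolding total_loss_def prod.case
  proof (rule nn_integral_mono_AE, use N(2) in eventually_elim)
    fix p :: "(real ^ 'n) \<times> real"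
    assume p: "0 < snd p"
    have lim': "(\<lambda>k. fst (fst (P k)) *v fst p + snd (P k)) \<longlonglongrightarrow> A *v fst p + v"
    proof (intro tendsto_add P)
      show "(\<lambda>k. fst (fst (P k)) *v fst p) \<longlonglongrightarrow> A *v fst p"
        unfolding matrix_vector_mult_def by (intro vec_tendstoI) (auto intro!: tendsto_intros P(2))
    qed
    show "loss F (\<alpha> * snd p) (q (A *v fst p + v)) \<le> liminf (\<lambda>k. X k p)"
      unfolding X_def using p \<alpha>
      by (intro loss_lower_semicontinuous[OF F] q_upper_semicontinuous[OF lim'] tendsto_intros P(1)) auto
  qed
  also have "\<dots> \<le> liminf (\<lambda>k. \<integral>\<^sup>+p. X k p \<partial>N)"
    by (rule nn_integral_liminf) (rule meas)
  also have "(\<lambda>k. \<integral>\<^sup>+p. X k p \<partial>N) = (\<lambda>k. total_loss F N (P k))"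
    by (auto simp: total_loss_def X_def split: prod.splits)
  finally show ?thesis .
qed

lemma loss_integrand_midpoint:
  assumes F: "loss_fun F" and \<alpha>: "0 < \<alpha>1" "0 < \<alpha>2" "\<alpha> \<le> sqrt (\<alpha>1 * \<alpha>2)" and y: "0 < y"
  shows "2 * loss F (\<alpha> * y) (q (((1/2) *\<^sub>R (A1 + A2)) *v x + (1/2) *\<^sub>R (v1 + v2)))
    \<le> loss F (\<alpha>1 * y) (q (A1 *v x + v1)) + loss F (\<alpha>2 * y) (q (A2 *v x + v2))"
proof (rule loss_midpoint[OF F])
  have "\<alpha> * y \<le> sqrt (\<alpha>1 * \<alpha>2) * y" using \<alpha> y by simp
  also have "\<dots> = sqrt ((\<alpha>1 * y) * (\<alpha>2 * y))" using y by (simp add: real_sqrt_mult)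
  finally show "\<alpha> * y \<le> sqrt (\<alpha>1 * y * (\<alpha>2 * y))" .
  have "((1/2) *\<^sub>R (A1 + A2)) *v x + (1/2) *\<^sub>R (v1 + v2) = (1/2) *\<^sub>R ((A1 *v x + v1) + (A2 *v x + v2))"
    by (simp add: matrix_vector_mult_add_rdistrib scaleR_matrix_vector_assoc[symmetric] algebra_simps)
  then show "sqrt (q (A1 *v x + v1) * q (A2 *v x + v2)) \<le> q (((1/2) *\<^sub>R (A1 + A2)) *v x + (1/2) *\<^sub>R (v1 + v2))"
    using q_midpoint by simp
qed (use \<alpha> y in auto)

end

section \<open>Coercivity\<close>

lemma borel_half_ball [measurable]: "half_ball \<in> sets borel"
  using open_half_ball by (rule borel_open)

lemma borel_ball [measurable]: "ball (z :: 'a::metric_space) e \<in> sets borel"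
  by (rule borel_open) simp

context john_position begin

text \<open>The product of the ball of radius 1/2 with the interval from 1/4 to 1/2 lies in the half
  ball, and on it y may be replaced by 1/4. The factor 4 is the inverse length of the
  interval.\<close>

lemma excess_ge_integral:
  assumes \<alpha>: "0 < \<alpha>"
  shows "(\<integral>\<^sup>+x. loss positive_part (\<alpha> / 4) (q (A *v x + v)) * indicator (ball 0 (1/2)) x \<partial>lborel)
    \<le> 4 * excess ((A, \<alpha>), v)"
proof -
  define k where "k x = loss positive_part (\<alpha> / 4) (q (A *v x + v))" for x
  have [measurable]: "k \<in> borel_measurable borel"
    unfolding k_def by (intro borel_measurable_loss[OF loss_fun_positive_part]) measurable
  define k1 where "k1 x = k x * indicator (ball 0 (1/2)) x" for x
  define k2 where "k2 y = (indicator {1/4<..<1/2} y :: ennreal)" for y :: real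
  have [measurable]: "k1 \<in> borel_measurable borel" "k2 \<in> borel_measurable borel"
    unfolding k1_def k2_def by measurable
  have "(\<integral>\<^sup>+x. k x * indicator (ball 0 (1/2)) x \<partial>lborel) * ennreal (1/4)
      = (\<integral>\<^sup>+x. (\<integral>\<^sup>+y. k x * indicator (ball 0 (1/2)) x * indicator {1/4<..<1/2::real} y \<partial>lborel) \<partial>lborel)"
    by (subst nn_integral_multc[symmetric], measurable) (simp add: nn_integral_cmult)
  also have "\<dots> = (\<integral>\<^sup>+x. \<integral>\<^sup>+y. k1 (fst (x, y)) * k2 (snd (x, y)) \<partial>lborel \<partial>lborel)"
    by (simp add: k1_def k2_def)
  also have "\<dots> = (\<integral>\<^sup>+p. k1 (fst p) * k2 (snd p) \<partial>(lborel \<Otimes>\<^sub>M lborel))"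
    by (rule lborel.nn_integral_fst) measurable
  also have "\<dots> \<le> (\<integral>\<^sup>+p. indicator half_ball p * loss positive_part (\<alpha> * snd p) (q (A *v fst p + v)) \<partial>lborel)"
    unfolding lborel_prod
  proof (rule nn_integral_mono)
    fix p :: "(real ^ 'n) \<times> real"
    obtain x y where p: "p = (x, y)" by (cases p)
    have "k x \<le> indicator half_ball p * loss positive_part (\<alpha> * y) (q (A *v x + v))"
      if "norm x < 1/2" "1/4 < y" "y < 1/2"
    proof -
      have "(norm x)\<^sup>2 < (1/2)\<^sup>2" using that by (intro power_strict_mono) auto
      moreover have "y\<^sup>2 < (1/2)\<^sup>2" using that by (intro power_strict_mono) auto
      ultimately have "p \<in> half_ball" using that unfolding p mem_half_ball_iff by (simp add: power2_eq_square)
      moreover have "k x \<le> loss positive_part (\<alpha> * y) (q (A *v x + v))"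
        using that \<alpha> loss_fun_positive_part unfolding k_def by (intro loss_mono_left) (auto simp: loss_fun_def)
      ultimately show ?thesis by simp
    qed
    then show "k1 (fst p) * k2 (snd p)
        \<le> indicator half_ball p * loss positive_part (\<alpha> * snd p) (q (A *v fst p + v))"
      unfolding p k1_def k2_def by (auto simp: indicator_def)
  qed
  also have "\<dots> = excess ((A, \<alpha>), v)"
    unfolding excess_def total_loss_def half_ball_measure_def prod.case
    using borel_measurable_loss_integrand[OF loss_fun_positive_part] open_half_ball
    by (subst nn_integral_density) auto
  finally have "(\<integral>\<^sup>+x. k x * indicator (ball 0 (1/2)) x \<partial>lborel) * ennreal (1/4) * 4 \<le> excess ((A, \<alpha>), v) * 4"
    by (rule mult_right_mono) simp
  moreover have "ennreal (1/4) * 4 = 1"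
    by (metis ennreal_mult'' ennreal_numeral ennreal_1 divide_cancel_right div_by_1 nonzero_divide_eq_eq zero_neq_numeral
        zero_le_numeral)
  ultimately show ?thesis unfolding k_def[symmetric] by (simp add: mult.assoc) (simp add: mult.commute)
qed

text \<open>The function \<open>\<alpha> / (4 q (A x + v))\<close> is convex, so its value at a point is at most its mean over
  a ball around that point.\<close>

lemma excess_ge_pointwise:
  assumes \<alpha>: "0 < \<alpha>" and x0: "norm x0 \<le> 1/4"
  shows "loss positive_part (\<alpha> / 4) (q (A *v x0 + v)) * emeasure lborel (ball (0 :: real ^ 'n) (1/4))
    \<le> 4 * excess ((A, \<alpha>), v)"
proof -
  define k where "k x = loss positive_part (\<alpha> / 4) (q (A *v x + v))" for x
  have [measurable]: "k \<in> borel_measurable borel"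
    unfolding k_def by (intro borel_measurable_loss[OF loss_fun_positive_part]) measurable
  let ?B = "ball (0 :: real ^ 'n) (1/4)"
  \<comment> \<open>Integrated over z in a ball around 0 this is the mean value inequality: the two
    terms on the right have equal integrals because the reflection z to -z is orthogonal.\<close>
  have mid: "2 * k x0 \<le> k (x0 + z) + k (x0 - z)" for z
    unfolding k_def
  proof (rule loss_midpoint[OF loss_fun_positive_part])
    have "A *v x0 + v = (1/2) *\<^sub>R ((A *v (x0 + z) + v) + (A *v (x0 - z) + v))"
      by (simp add: matrix_vector_right_distrib matrix_vector_mult_diff_distrib scaleR_add_right scaleR_half_double)
    then show "sqrt (q (A *v (x0 + z) + v) * q (A *v (x0 - z) + v)) \<le> q (A *v x0 + v)"
      using q_midpoint by metis
    show "\<alpha> / 4 \<le> sqrt (\<alpha> / 4 * (\<alpha> / 4))" unfolding real_sqrt_abs2 by simp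
  qed (use \<alpha> in auto)
  have "(\<integral>\<^sup>+z. k (x0 + z) * indicator ?B z \<partial>lborel)
      = (\<integral>\<^sup>+z. k (x0 + z) * indicator (ball x0 (1/4)) (x0 + z) \<partial>lborel)"
    by (intro nn_integral_cong) (simp add: indicator_def dist_norm)
  also have "\<dots> = (\<integral>\<^sup>+x. k x * indicator (ball x0 (1/4)) x \<partial>lborel)"
    by (rule nn_integral_translation[of "\<lambda>x. k x * indicator (ball x0 (1/4)) x"]) measurable
  also have "\<dots> \<le> (\<integral>\<^sup>+x. k x * indicator (ball 0 (1/2)) x \<partial>lborel)"
  proof (intro nn_integral_mono mult_left_mono)
    fix x
    have "ball x0 (1/4) \<subseteq> ball 0 (1/2)" using x0 by (intro ball_subset_ball_iff[THEN iffD2]) (simp add: dist_norm)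
    then show "indicator (ball x0 (1/4)) x \<le> (indicator (ball 0 (1/2)) x :: ennreal)"
      by (auto simp: indicator_def)
  qed simp
  also have "\<dots> \<le> 4 * excess ((A, \<alpha>), v)" unfolding k_def by (rule excess_ge_integral[OF \<alpha>])
  finally have 1: "(\<integral>\<^sup>+z. k (x0 + z) * indicator ?B z \<partial>lborel) \<le> 4 * excess ((A, \<alpha>), v)" .
  have orth: "orthogonal_matrix (- mat 1 :: real ^ 'n ^ 'n)"
    by (simp add: orthogonal_matrix matrix_matrix_mult_def transpose_def mat_def vec_eq_iff mult_delta_left)
  have neg: "(- mat 1) *v z = - z" for z :: "real ^ 'n"
    by (metis diff_0 matrix_vector_mul_lid matrix_vector_mult_0 matrix_vector_mult_diff_rdistrib)
  have 2: "(\<integral>\<^sup>+z. k (x0 - z) * indicator ?B z \<partial>lborel) = (\<integral>\<^sup>+z. k (x0 + z) * indicator ?B z \<partial>lborel)"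
    using nn_integral_orthogonal[OF orth, of "\<lambda>z. k (x0 + z) * indicator ?B z"]
    by (simp add: neg indicator_def)
  have "2 * (k x0 * emeasure lborel ?B) = (\<integral>\<^sup>+z. 2 * k x0 * indicator ?B z \<partial>lborel)"
    by (simp add: nn_integral_cmult mult.assoc)
  also have "\<dots> \<le> (\<integral>\<^sup>+z. (k (x0 + z) + k (x0 - z)) * indicator ?B z \<partial>lborel)"
    using mid by (intro nn_integral_mono mult_right_mono) auto
  also have "\<dots> = (\<integral>\<^sup>+z. k (x0 + z) * indicator ?B z \<partial>lborel) + (\<integral>\<^sup>+z. k (x0 - z) * indicator ?B z \<partial>lborel)"
    by (simp add: distrib_right nn_integral_add)
  also have "\<dots> \<le> 2 * (4 * excess ((A, \<alpha>), v))"
    unfolding 2 mult_2 using 1 by (intro add_mono)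
  finally have "2 * (k x0 * emeasure lborel ?B) \<le> 2 * (4 * excess ((A, \<alpha>), v))" .
  then show ?thesis unfolding k_def
    by (subst (asm) ennreal_mult_le_mult_iff) auto
qed

text \<open>Turns a bound on the integral into a pointwise one, uniform in A and v: near the centre
  q cannot be small compared with \<alpha>. Together with the decay of q this confines the points A
  x + v.\<close>

lemma excess_bounds_scale:
  assumes C: "0 \<le> C"
  obtains K where "0 < K" "\<And>A \<alpha> v x. 0 < \<alpha> \<Longrightarrow> excess ((A, \<alpha>), v) \<le> ennreal C \<Longrightarrow> norm x \<le> 1/4 \<Longrightarrow>
    \<alpha> \<le> K * q (A *v x + v)"
proof -
  define \<beta> where "\<beta> = measure lborel (ball (0 :: real ^ 'n) (1/4))"
  have e\<beta>: "emeasure lborel (ball (0 :: real ^ 'n) (1/4)) = ennreal \<beta>"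
    by (simp add: \<beta>_def emeasure_ball measure_def)
  have \<beta>: "0 < \<beta>" by (simp add: \<beta>_def content_ball)
  \<comment> \<open>The result of solving (\<alpha> / (4 q) - 1) \<beta> \<le> 4 C for \<alpha>, the
    inequality supplied by \<open>excess_ge_pointwise\<close>.\<close>
  define K where "K = 4 + 16 * C / \<beta>"
  have "\<alpha> \<le> K * q (A *v x + v)" if *: "0 < \<alpha>" "excess ((A, \<alpha>), v) \<le> ennreal C" "norm x \<le> 1/4" for A \<alpha> v x
  proof -
    let ?q = "q (A *v x + v)"
    have "loss positive_part (\<alpha> / 4) ?q * ennreal \<beta> \<le> 4 * excess ((A, \<alpha>), v)"
      using excess_ge_pointwise[OF *(1,3)] by (simp add: e\<beta>)
    also have "\<dots> \<le> 4 * ennreal C" using *(2) by (intro mult_left_mono) auto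
    also have "\<dots> = ennreal (4 * C)" using C by (simp add: ennreal_mult)
    finally have le: "loss positive_part (\<alpha> / 4) ?q * ennreal \<beta> \<le> ennreal (4 * C)" .
    have q: "?q \<noteq> 0" using le \<beta> by (auto simp: loss_def ennreal_top_mult top_unique)
    then have q0: "0 < ?q" by (simp add: less_le)
    have "positive_part (\<alpha> / 4 / ?q) * \<beta> \<le> 4 * C"
      using le q \<beta> C by (simp add: loss_def positive_part_def flip: ennreal_mult')
    then have "(\<alpha> / 4 / ?q - 1) * \<beta> \<le> 4 * C"
      using \<beta> by (elim order_trans[rotated]) (auto simp: positive_part_def intro!: mult_right_mono)
    then have "\<alpha> / 4 / ?q - 1 \<le> 4 * C / \<beta>" using \<beta> by (simp add: pos_le_divide_eq)
    then have "\<alpha> / 4 / ?q \<le> 1 + 4 * C / \<beta>" by simp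
    then have "\<alpha> / 4 \<le> (1 + 4 * C / \<beta>) * ?q" using q0 by (simp add: pos_divide_le_eq)
    then show ?thesis by (simp add: K_def algebra_simps)
  qed
  moreover have "0 < K" using C \<beta> by (simp add: K_def add_pos_nonneg)
  ultimately show thesis using that by blast
qed

text \<open>Separates A from v: A x is half the difference of A x + v and A (-x) + v, so one of
  these two has norm at least that of A x, and both are controlled by the decay of q.\<close>

lemma excess_exponential_bound:
  assumes C: "0 \<le> C"
  obtains L c where "0 < L" "0 < c"
    "\<And>A \<alpha> v. 0 < \<alpha> \<Longrightarrow> excess ((A, \<alpha>), v) \<le> ennreal C \<Longrightarrow> \<alpha> * exp (c * norm v) \<le> L"
    "\<And>A \<alpha> v x. 0 < \<alpha> \<Longrightarrow> excess ((A, \<alpha>), v) \<le> ennreal C \<Longrightarrow> norm x \<le> 1/4 \<Longrightarrow> \<alpha> * exp (c * norm (A *v x)) \<le> L"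
proof -
  obtain K where K: "0 < K" "\<And>A \<alpha> v x. 0 < \<alpha> \<Longrightarrow> excess ((A, \<alpha>), v) \<le> ennreal C \<Longrightarrow> norm x \<le> 1/4 \<Longrightarrow>
    \<alpha> \<le> K * q (A *v x + v)" using excess_bounds_scale[OF C] by blast
  obtain Q c where Q: "0 < Q" "0 < c" "\<And>x. q x \<le> Q * exp (- c * norm x)" using q_exponential_decay by blast
  have bd: "\<alpha> * exp (c * norm (A *v x + v)) \<le> K * Q"
    if "0 < \<alpha>" "excess ((A, \<alpha>), v) \<le> ennreal C" "norm x \<le> 1/4" for A \<alpha> v x
  proof -
    have "\<alpha> \<le> K * (Q * exp (- c * norm (A *v x + v)))"
      using K(2)[OF that] Q(3)[of "A *v x + v"] K(1) by (meson mult_left_mono order_trans less_imp_le)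
    then show ?thesis by (simp add: exp_minus field_simps)
  qed
  have "\<alpha> * exp (c * norm (A *v x)) \<le> K * Q"
    if *: "0 < \<alpha>" "excess ((A, \<alpha>), v) \<le> ennreal C" "norm x \<le> 1/4" for A \<alpha> v x
  proof -
    have "A *v x = (1/2) *\<^sub>R ((A *v x + v) - (A *v (- x) + v))"
      by (simp add: vec.neg scaleR_half_double)
    then have "norm (A *v x) = (1/2) * norm ((A *v x + v) - (A *v (- x) + v))"
      by (metis norm_scaleR abs_of_pos half_gt_zero zero_less_one)
    also have "\<dots> \<le> (1/2) * (norm (A *v x + v) + norm (A *v (- x) + v))"
      by (rule mult_left_mono[OF norm_triangle_ineq4]) simp
    finally have "norm (A *v x) \<le> (1/2) * (norm (A *v x + v) + norm (A *v (- x) + v))" .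
    moreover have "a \<le> b \<or> a \<le> c" if "a \<le> (1/2) * (b + c)" for a b c :: real using that by auto
    ultimately have "norm (A *v x) \<le> norm (A *v x + v) \<or> norm (A *v x) \<le> norm (A *v (- x) + v)" by blast
    then obtain x' where "norm x' \<le> 1/4" "norm (A *v x) \<le> norm (A *v x' + v)"
      using *(3) norm_minus_cancel by metis
    then have "\<alpha> * exp (c * norm (A *v x)) \<le> \<alpha> * exp (c * norm (A *v x' + v))" "norm x' \<le> 1/4"
      using Q * by auto
    then show ?thesis using bd[OF *(1,2)] by (meson order_trans)
  qed
  moreover have "\<alpha> * exp (c * norm v) \<le> K * Q"
    if "0 < \<alpha>" "excess ((A, \<alpha>), v) \<le> ennreal C" for A \<alpha> v
    using bd[OF that, of 0] by simp
  ultimately show thesis using that[of "K * Q" c] K(1) Q(1,2) by (metis mult_pos_pos)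
qed

text \<open>The exponential bound alone allows \<alpha> to be tiny and A huge. Multiplying its s-th
  power by \<open>det A\<close> removes \<alpha> by the volume constraint and leaves an exponential
  of the largest entry of A below a power of it. So A is bounded, hence \<alpha> is bounded below,
  and only then v is bounded.\<close>

lemma excess_coercive:
  assumes C: "0 \<le> C"
  obtains R where "0 < R" "\<And>A \<alpha> v. spd A \<Longrightarrow> 0 < \<alpha> \<Longrightarrow> \<alpha> powr s * det A = 1 \<Longrightarrow> excess ((A, \<alpha>), v) \<le> ennreal C \<Longrightarrow>
    norm A \<le> R \<and> 1 / R \<le> \<alpha> \<and> \<alpha> \<le> R \<and> norm v \<le> R"
proof -
  let ?n = "CARD('n)"
  obtain L c where L: "0 < L" "0 < c"
    and Lv: "\<And>A \<alpha> v. 0 < \<alpha> \<Longrightarrow> excess ((A, \<alpha>), v) \<le> ennreal C \<Longrightarrow> \<alpha> * exp (c * norm v) \<le> L"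
    and LA: "\<And>A \<alpha> v x. 0 < \<alpha> \<Longrightarrow> excess ((A, \<alpha>), v) \<le> ennreal C \<Longrightarrow> norm x \<le> 1/4 \<Longrightarrow> \<alpha> * exp (c * norm (A *v x)) \<le> L"
    using excess_exponential_bound[OF C] by blast
  have cs: "0 < c * s / 4" using L s_pos by simp
  obtain m0 where m0: "\<And>m. exp (c * s / 4 * m) \<le> (L powr s * fact ?n) * m ^ ?n \<Longrightarrow> 0 \<le> m \<Longrightarrow> m \<le> m0"
    using exp_dominates_power[OF cs, of "L powr s * fact ?n" ?n] by blast
  \<comment> \<open>M bounds the entries of A and D its determinant; a0 is the lower bound on
    \<alpha> which the volume constraint then forces. The summand 1 keeps D positive, and R collects
    all the bounds.\<close>
  define M where "M = max 0 m0"
  define D where "D = fact ?n * M ^ ?n + 1"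
  have D: "0 < D" by (simp add: D_def M_def add_nonneg_pos)
  define a0 where "a0 = (1 / D) powr (1 / s)"
  have a0: "0 < a0" using D by (simp add: a0_def)
  define R where "R = 1 + ?n * ?n * M + 1 / a0 + L + \<bar>ln (L / a0) / c\<bar>"
  have M0: "0 \<le> ?n * ?n * M" by (simp add: M_def)
  moreover have "0 < 1 / a0" using a0 by simp
  ultimately have R0: "0 < R" using L unfolding R_def by linarith
  have "norm A \<le> R \<and> 1 / R \<le> \<alpha> \<and> \<alpha> \<le> R \<and> norm v \<le> R"
    if A: "spd A" and \<alpha>: "0 < \<alpha>" and vol: "\<alpha> powr s * det A = 1" and ex: "excess ((A, \<alpha>), v) \<le> ennreal C" for A \<alpha> v
  proof -
    define m where "m = Max (range (\<lambda>(i, j). \<bar>A $ i $ j\<bar>))"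
    have mge: "\<bar>A $ i $ j\<bar> \<le> m" for i j unfolding m_def by (rule Max_ge) (auto intro: image_eqI[of _ _ "(i, j)"])
    have "m \<in> range (\<lambda>(i, j). \<bar>A $ i $ j\<bar>)" unfolding m_def by (rule Max_in) auto
    then obtain i j where ij: "m = \<bar>A $ i $ j\<bar>" by auto
    have detpos: "0 < det A" by (rule spd_det_pos[OF A])
    have det: "det A \<le> fact ?n * m ^ ?n" using det_le_fact_mult_power[of A m, OF mge] by linarith
    \<comment> \<open>The entry is read off from the image of \<open>axis j 1\<close> shortened to
      length 1/4, the largest length that \<open>LA\<close> admits.\<close>
    have "m / 4 = \<bar>(A *v ((1/4) *\<^sub>R axis j 1)) $ i\<bar>"
      by (simp add: ij matrix_vector_mult_scaleR matrix_vector_mult_basis column_def abs_mult)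
    also have "\<dots> \<le> norm (A *v ((1/4) *\<^sub>R axis j 1))" by (rule component_le_norm_cart)
    finally have "\<alpha> * exp (c * (m / 4)) \<le> \<alpha> * exp (c * norm (A *v ((1/4) *\<^sub>R axis j 1)))" using L \<alpha> by simp
    also have "\<dots> \<le> L" by (rule LA[OF \<alpha> ex]) simp
    finally have "(\<alpha> * exp (c * (m / 4))) powr s \<le> L powr s" using \<alpha> s_pos by (intro powr_mono2) auto
    then have "\<alpha> powr s * exp (c * s / 4 * m) \<le> L powr s"
      using \<alpha> by (simp add: powr_mult powr_def[of "exp _"] mult.commute mult.left_commute)
    then have "\<alpha> powr s * exp (c * s / 4 * m) * det A \<le> L powr s * det A" using detpos by simp
    then have "exp (c * s / 4 * m) * (\<alpha> powr s * det A) \<le> L powr s * det A" by (simp only: ac_simps)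
    then have "exp (c * s / 4 * m) \<le> L powr s * det A" using vol by simp
    also have "\<dots> \<le> (L powr s * fact ?n) * m ^ ?n" using det L by (simp add: mult.assoc)
    finally have "m \<le> m0" using m0[of m] ij by simp
    then have mM: "m \<le> M" "0 \<le> m" using ij by (auto simp: M_def)
    have "norm A \<le> (\<Sum>i\<in>UNIV. norm (A $ i))" unfolding norm_vec_def[of A] by (rule L2_set_le_sum) simp
    also have "\<dots> \<le> (\<Sum>i\<in>(UNIV::'n set). \<Sum>j\<in>(UNIV::'n set). M)"
    proof (rule sum_mono)
      fix i
      have "norm (A $ i) \<le> (\<Sum>j\<in>UNIV. \<bar>A $ i $ j\<bar>)" by (rule norm_le_l1_cart)
      also have "\<dots> \<le> (\<Sum>j\<in>(UNIV::'n set). M)" using mge mM by (intro sum_mono) (meson order_trans)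
      finally show "norm (A $ i) \<le> (\<Sum>j\<in>(UNIV::'n set). M)" .
    qed
    finally have nA: "norm A \<le> ?n * ?n * M" by simp
    have "m ^ ?n \<le> M ^ ?n" using mM by (intro power_mono)
    then have "det A \<le> D" using det unfolding D_def
      by (smt (verit, best) fact_ge_zero mult_left_mono)
    then have "1 / D \<le> \<alpha> powr s" using vol detpos D
      by (metis frac_le less_eq_real_def nonzero_eq_divide_eq order_less_irrefl zero_le_one)
    then have "(1 / D) powr (1 / s) \<le> (\<alpha> powr s) powr (1 / s)" using D s_pos by (intro powr_mono2) auto
    then have a: "a0 \<le> \<alpha>" using \<alpha> s_pos by (simp add: a0_def powr_powr)
    have v: "\<alpha> * exp (c * norm v) \<le> L" by (rule Lv[OF \<alpha> ex])
    have "\<alpha> * 1 \<le> \<alpha> * exp (c * norm v)" using \<alpha> L by (intro mult_left_mono) auto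
    then have aL: "\<alpha> \<le> L" using v by linarith
    have "a0 * exp (c * norm v) \<le> \<alpha> * exp (c * norm v)" by (rule mult_right_mono[OF a]) simp
    then have "a0 * exp (c * norm v) \<le> L" using v by linarith
    then have "exp (c * norm v) \<le> L / a0" using a0 by (simp add: pos_le_divide_eq mult.commute)
    then have "c * norm v \<le> ln (L / a0)" using L a0 by (simp add: ln_ge_iff)
    then have "norm v \<le> ln (L / a0) / c" using L by (simp add: field_simps)
    then have nv: "norm v \<le> \<bar>ln (L / a0) / c\<bar>" by linarith
    have "1 / a0 \<le> R" using M0 L by (simp add: R_def)
    then have "1 / R \<le> a0" using a0 R0 by (simp add: field_simps)
    then have "1 / R \<le> \<alpha>" using a by linarith
    moreover have i0: "0 < 1 / a0" using a0 by simp
    ultimately show ?thesis using nA aL nv M0 L abs_ge_zero[of "ln (L / a0) / c"] unfolding R_def by linarith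
  qed
  then show thesis using that R0 by blast
qed

section \<open>Compactness in the feasible set\<close>

lemma mem_feasible_iff: "((A, \<alpha>), v) \<in> feasible s \<longleftrightarrow> spd A \<and> 0 < \<alpha> \<and> \<alpha> powr s * det A = 1"
  by (auto simp: feasible_def E_plus_def SL_def)

text \<open>Coercivity places the sequence in a compact box in which \<alpha> stays away from 0. The
  limit matrix is a priori only semidefinite; the volume constraint, which passes to the limit,
  makes it invertible and hence positive definite.\<close>

lemma feasible_convergent_subsequence:
  assumes P: "\<And>k :: nat. P k \<in> feasible s" and C: "\<And>k. excess (P k) \<le> ennreal C"
  obtains \<sigma> l where "strict_mono \<sigma>" "l \<in> feasible s" "(P \<circ> \<sigma>) \<longlonglongrightarrow> l"
proof -
  have C': "excess (P k) \<le> ennreal (max 0 C)" for k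
    by (rule order_trans[OF C ennreal_leI]) simp
  obtain R where R: "0 < R" "\<And>A \<alpha> v. spd A \<Longrightarrow> 0 < \<alpha> \<Longrightarrow> \<alpha> powr s * det A = 1 \<Longrightarrow> excess ((A, \<alpha>), v) \<le> ennreal (max 0 C) \<Longrightarrow>
    norm A \<le> R \<and> 1 / R \<le> \<alpha> \<and> \<alpha> \<le> R \<and> norm v \<le> R"
    using excess_coercive[of "max 0 C"] by auto
  have dec: "spd (fst (fst (P k))) \<and> 0 < snd (fst (P k)) \<and> snd (fst (P k)) powr s * det (fst (fst (P k))) = 1" for k
    using P[of k] mem_feasible_iff[of "fst (fst (P k))" "snd (fst (P k))" "snd (P k)"] by simp
  have bd: "norm (fst (fst (P k))) \<le> R \<and> 1 / R \<le> snd (fst (P k)) \<and> snd (fst (P k)) \<le> R \<and> norm (snd (P k)) \<le> R" for k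
    using R(2)[of "fst (fst (P k))" "snd (fst (P k))" "snd (P k)"] dec[of k] C'[of k] by simp
  have "P k \<in> (cball 0 R \<times> {1 / R..R}) \<times> cball 0 R" for k
    using bd[of k] by (simp add: mem_Times_iff)
  moreover have "compact ((cball (0 :: real ^ 'n ^ 'n) R \<times> {1 / R..R}) \<times> cball (0 :: real ^ 'n) R)"
    by (intro compact_Times compact_cball compact_Icc)
  ultimately obtain l \<sigma> where l: "l \<in> (cball 0 R \<times> {1 / R..R}) \<times> cball 0 R"
    and \<sigma>: "strict_mono \<sigma>" "(P \<circ> \<sigma>) \<longlonglongrightarrow> l"
    unfolding compact_def by (metis (no_types, lifting))
  obtain A \<alpha> v where lA: "l = ((A, \<alpha>), v)" by (metis prod.exhaust)
  have \<alpha>: "0 < \<alpha>" using l R(1) by (auto simp: lA intro: less_le_trans[of 0 "1 / R"])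
  have limA: "(\<lambda>k. fst (fst (P (\<sigma> k)))) \<longlonglongrightarrow> A" and lim\<alpha>: "(\<lambda>k. snd (fst (P (\<sigma> k)))) \<longlonglongrightarrow> \<alpha>"
    using tendsto_fst[OF tendsto_fst[OF \<sigma>(2)]] tendsto_snd[OF tendsto_fst[OF \<sigma>(2)]] by (simp_all add: lA o_def)
  have "(\<lambda>k. snd (fst (P (\<sigma> k))) powr s * det (fst (fst (P (\<sigma> k))))) \<longlonglongrightarrow> \<alpha> powr s * det A"
    using \<alpha> by (intro tendsto_intros limA lim\<alpha> tendsto_det) auto
  then have vol: "\<alpha> powr s * det A = 1" using dec by (simp add: LIMSEQ_const_iff)
  have "spd A"
  proof (rule spd_if_semidefinite_det)
    show "det A \<noteq> 0" using vol by auto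
    have lim: "(\<lambda>k. fst (fst (P (\<sigma> k))) $ i $ j) \<longlonglongrightarrow> A $ i $ j" for i j by (intro tendsto_vec_nth limA)
    have sym: "fst (fst (P k)) $ i $ j = fst (fst (P k)) $ j $ i" for i j k
      using dec[of k] by (simp add: spd_def transpose_def vec_eq_iff)
    have "A $ i $ j = A $ j $ i" for i j
      using lim[of i j] lim[of j i] unfolding sym[of _ i j] by (rule LIMSEQ_unique)
    then show "transpose A = A" by (simp add: transpose_def vec_eq_iff)
    fix x :: "real ^ 'n"
    have "(\<lambda>k. x \<bullet> (fst (fst (P (\<sigma> k))) *v x)) \<longlonglongrightarrow> x \<bullet> (A *v x)"
      unfolding matrix_vector_mult_def
      by (intro tendsto_inner tendsto_const vec_tendstoI) (auto intro!: tendsto_intros limA)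
    then show "0 \<le> x \<bullet> (A *v x)"
    proof (rule LIMSEQ_le_const, intro exI allI impI)
      fix k
      show "0 \<le> x \<bullet> (fst (fst (P (\<sigma> k))) *v x)"
        using dec[of "\<sigma> k"] by (cases "x = 0") (auto simp: spd_def less_imp_le)
    qed
  qed
  then have "l \<in> feasible s" using \<alpha> vol by (simp add: lA mem_feasible_iff)
  then show thesis using that \<sigma> by blast
qed

text \<open>By upper semicontinuity of q the part of the half ball where the inequality fails is
  open, and an open null set is empty.\<close>

lemma contained_if_AE:
  assumes ae: "AE p in lborel. p \<in> half_ball \<longrightarrow> c * snd p \<le> q (A *v fst p + v)"
  shows "contained A c v"
proof -
  let ?S = "half_ball \<inter> {p :: (real ^ 'n) \<times> real. q (A *v fst p + v) < c * snd p}"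
  have "{p. q (A *v fst p + v) < c * snd p}
      = (\<Union>r. (\<lambda>p. A *v fst p + v) -` {z. q z < r} \<inter> {p :: (real ^ 'n) \<times> real. r < c * snd p})"
    using dense by (auto intro: order_less_trans)
  also have "open \<dots>"
  proof (intro open_UN open_Int ballI)
    fix r
    have "continuous_on UNIV (\<lambda>p :: (real ^ 'n) \<times> real. A *v fst p + v)"
      by (intro continuous_intros linear_continuous_on_compose[OF _ matrix_vector_mul_linear])
    then show "open ((\<lambda>p :: (real ^ 'n) \<times> real. A *v fst p + v) -` {z. q z < r})"
      using open_q_less by (rule open_vimage[rotated])
    show "open {p :: (real ^ 'n) \<times> real. r < c * snd p}"
      by (intro open_Collect_less continuous_intros)
  qed
  finally have op: "open ?S" using open_half_ball by blast
  have "AE p in lborel. p \<notin> ?S" using ae by eventually_elim auto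
  then have "emeasure lborel ?S = 0"
    using op by (subst (asm) AE_iff_measurable[of ?S]) auto
  then have "negligible ?S" using op by (auto simp: negligible_iff_null_sets null_sets_def)
  then have empty: "?S = {}" using op open_not_negligible by blast
  show ?thesis
    unfolding contained_def
  proof
    fix x :: "real ^ 'n"
    show "c * ball_profile x \<le> q (A *v x + v)"
    proof (cases "norm x < 1")
      case False
      then have "(norm x)\<^sup>2 \<ge> 1" by (simp add: one_le_power)
      then show ?thesis by (simp add: ball_profile_def)
    next
      case True
      then have n: "(norm x)\<^sup>2 < 1" by (simp add: abs_square_less_1)
      then have bp: "0 < ball_profile x" "(ball_profile x)\<^sup>2 = 1 - (norm x)\<^sup>2" by (auto simp: ball_profile_def)
      show ?thesis
      \<comment> \<open>The point of the sphere above x is not in the open half ball; it is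
        approached from below through factors t < 1.\<close>
      proof (rule field_le_mult_one_interval)
        fix t :: real assume t: "0 < t" "t < 1"
        have "t\<^sup>2 * (1 - (norm x)\<^sup>2) < 1 * (1 - (norm x)\<^sup>2)"
          using t n by (intro mult_strict_right_mono) (auto simp: abs_square_less_1)
        then have "(x, t * ball_profile x) \<in> half_ball"
          using t bp by (simp add: mem_half_ball_iff power_mult_distrib)
        then have "\<not> q (A *v x + v) < c * (t * ball_profile x)" using empty by auto
        then show "t * (c * ball_profile x) \<le> q (A *v x + v)" by (simp add: ac_simps)
      qed
    qed
  qed
qed

section \<open>Zeros of the excess and the direct method\<close>

lemma sets_half_ball_measure [simp]: "sets half_ball_measure = sets borel"
  by (simp add: half_ball_measure_def)

lemma AE_half_ball_measure: "AE p in half_ball_measure. 0 < snd p"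
  unfolding half_ball_measure_def
  by (subst AE_density, measurable) (simp add: half_ball_def indicator_def)

lemma excess_eq_0:
  assumes p: "((A, \<alpha>), v) \<in> feasible s" and 0: "excess ((A, \<alpha>), v) = 0"
  shows "((A, \<alpha>), v) = ((mat 1, 1), 0)"
proof -
  have f: "spd A" "0 < \<alpha>" "\<alpha> powr s * det A = 1" using p by (auto simp: mem_feasible_iff)
  have "AE p in half_ball_measure. loss positive_part (\<alpha> * snd p) (q (A *v fst p + v)) = 0"
    using 0 borel_measurable_loss_integrand[OF loss_fun_positive_part] unfolding excess_def total_loss_def prod.case
    by (subst (asm) nn_integral_0_iff_AE) (auto cong: measurable_cong_sets)
  then have "AE p in lborel. p \<in> half_ball \<longrightarrow> loss positive_part (\<alpha> * snd p) (q (A *v fst p + v)) = 0"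
    unfolding half_ball_measure_def by (subst (asm) AE_density) auto
  then have "AE p in lborel. p \<in> half_ball \<longrightarrow> \<alpha> * snd p \<le> q (A *v fst p + v)"
  proof eventually_elim
    case (elim p)
    have "\<alpha> * snd p \<le> q (A *v fst p + v)" if "loss positive_part (\<alpha> * snd p) (q (A *v fst p + v)) = 0"
    proof -
      have "q (A *v fst p + v) \<noteq> 0" using that by (auto simp: loss_def)
      then have "0 < q (A *v fst p + v)" by (simp add: less_le)
      moreover have "\<alpha> * snd p / q (A *v fst p + v) \<le> 1"
        using that by (auto simp: loss_def positive_part_def ennreal_eq_0_iff split: if_splits)
      ultimately show ?thesis by (simp add: pos_divide_le_eq)
    qed
    then show ?case using elim by blast
  qed
  then have "contained A \<alpha> v" by (rule contained_if_AE)
  then show ?thesis using contained_unique[OF f] by simp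
qed

text \<open>Otherwise a sequence outside U with excess tending to 0 would have a feasible limit,
  which lies outside U as its complement is closed, and has excess 0 by semicontinuity. But the only
  such point is the identity.\<close>

lemma excess_separates:
  assumes "open U" "((mat 1, 1), 0) \<in> U"
  obtains \<delta> where "0 < \<delta>" "\<And>p. p \<in> feasible s \<Longrightarrow> excess p < ennreal \<delta> \<Longrightarrow> p \<in> U"
proof -
  have "\<exists>\<delta>>0. \<forall>p\<in>feasible s. excess p < ennreal \<delta> \<longrightarrow> p \<in> U"
  proof (rule ccontr)
    assume *: "\<not> ?thesis"
    have "\<exists>p. p \<in> feasible s \<and> excess p < ennreal (1 / Suc k) \<and> p \<notin> U" for k
      using * by (metis of_nat_0_less_iff zero_less_Suc zero_less_divide_1_iff)
    then obtain P where P: "\<And>k. P k \<in> feasible s" "\<And>k. excess (P k) < ennreal (1 / Suc k)" "\<And>k. P k \<notin> U"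
      by metis
    have "ennreal (1 / Suc k) \<le> ennreal 1" for k by (intro ennreal_leI) simp
    then have le: "excess (P k) \<le> ennreal 1" for k using P(2)[of k] by (meson less_imp_le order_trans)
    obtain \<sigma> l where \<sigma>: "strict_mono \<sigma>" "l \<in> feasible s" "(P \<circ> \<sigma>) \<longlonglongrightarrow> l"
      by (rule feasible_convergent_subsequence[of P 1, OF P(1) le])
    obtain A \<alpha> v where l: "l = ((A, \<alpha>), v)" by (metis prod.exhaust)
    have \<alpha>: "0 < \<alpha>" using \<sigma>(2) by (simp add: l mem_feasible_iff)
    have "(\<lambda>k. ennreal (1 / Suc k)) \<longlonglongrightarrow> ennreal 0"
      using LIMSEQ_inverse_real_of_nat by (intro tendsto_ennrealI) (simp add: inverse_eq_divide)
    then have lim0: "(\<lambda>k. ennreal (1 / Suc k)) \<longlonglongrightarrow> 0" by simp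
    have "(\<lambda>k. excess (P k)) \<longlonglongrightarrow> 0"
    proof (rule tendsto_sandwich[OF _ _ tendsto_const lim0])
      show "eventually (\<lambda>k. excess (P k) \<le> ennreal (1 / Suc k)) sequentially"
        using less_imp_le[OF P(2)] by (intro always_eventually allI)
    qed simp
    then have "(\<lambda>k. excess ((P \<circ> \<sigma>) k)) \<longlonglongrightarrow> 0"
      using LIMSEQ_subseq_LIMSEQ[OF _ \<sigma>(1)] by (fastforce simp: o_def)
    then have "liminf (\<lambda>k. excess ((P \<circ> \<sigma>) k)) = 0" by (rule lim_imp_Liminf[rotated]) simp
    moreover have "excess l \<le> liminf (\<lambda>k. excess ((P \<circ> \<sigma>) k))"
      using total_loss_lower_semicontinuous[OF loss_fun_positive_part sets_half_ball_measure
          AE_half_ball_measure \<sigma>(3)[unfolded l] \<alpha>]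
      unfolding excess_def l .
    ultimately have "excess l = 0" by simp
    then have "l \<in> U" using excess_eq_0 \<sigma>(2) assms(2) unfolding l by metis
    moreover have "l \<in> - U"
      using P(3) assms(1) by (intro closed_sequentially[OF _ _ \<sigma>(3)]) auto
    ultimately show False by simp
  qed
  then show thesis using that by blast
qed

lemma feasible_minimizer_exists:
  assumes x0: "x0 \<in> feasible s" "\<Phi> x0 < top"
    and coercive: "0 < c" "\<And>p. p \<in> feasible s \<Longrightarrow> ennreal c * excess p \<le> \<Phi> p"
    and lsc: "\<And>P p. (\<And>k. P k \<in> feasible s) \<Longrightarrow> p \<in> feasible s \<Longrightarrow> P \<longlonglongrightarrow> p \<Longrightarrow> \<Phi> p \<le> liminf (\<lambda>k. \<Phi> (P k))"
  obtains p where "minimizer_on \<Phi> (feasible s) p"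
proof -
  define I where "I = Inf (\<Phi> ` feasible s)"
  have "I \<le> \<Phi> x0" unfolding I_def using x0 by (intro Inf_lower) auto
  then have "I < top" using x0 by simp
  obtain u where u: "\<And>k. u k \<in> \<Phi> ` feasible s" "u \<longlonglongrightarrow> I"
    using Inf_as_limit[of "\<Phi> ` feasible s"] x0(1) unfolding I_def by auto
  have "\<forall>k. \<exists>p. p \<in> feasible s \<and> u k = \<Phi> p" using u(1) by blast
  from choice[OF this] obtain P where P: "\<And>k. P k \<in> feasible s" "\<And>k. u k = \<Phi> (P k)" by blast
  obtain C where C: "I < ennreal C" "0 \<le> C"
  proof -
    obtain x where "I < x" "x < top" using dense[OF \<open>I < top\<close>] by blast
    then show thesis using that by (cases x) auto
  qed
  have "eventually (\<lambda>k. u k < ennreal C) sequentially" using u(2) C(1) by (rule order_tendstoD)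
  then obtain k0 where k0: "\<And>k. k0 \<le> k \<Longrightarrow> u k < ennreal C" by (auto simp: eventually_sequentially)
  \<comment> \<open>Dropping finitely many terms puts the whole minimizing sequence into one
    sublevel set of \<open>excess\<close>.\<close>
  define P' where "P' k = P (k + k0)" for k
  have "excess (P' k) \<le> ennreal (C / c)" for k
  proof -
    have "ennreal c * excess (P' k) \<le> ennreal C"
      using coercive(2)[OF P(1), of "k + k0"] k0[of "k + k0"] by (simp add: P'_def P(2)[symmetric])
    also have "ennreal C = ennreal c * ennreal (C / c)" using coercive(1) C(2) by (simp flip: ennreal_mult)
    finally show ?thesis using coercive(1) by (subst (asm) ennreal_mult_le_mult_iff) auto
  qed
  then obtain \<sigma> l where \<sigma>: "strict_mono \<sigma>" "l \<in> feasible s" "(P' \<circ> \<sigma>) \<longlonglongrightarrow> l"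
    using feasible_convergent_subsequence[of P'] P(1) unfolding P'_def by metis
  have "\<Phi> l \<le> liminf (\<lambda>k. \<Phi> ((P' \<circ> \<sigma>) k))"
    using P(1) by (intro lsc[of "P' \<circ> \<sigma>", OF _ \<sigma>(2,3)]) (simp add: P'_def)
  also have "(\<lambda>k. \<Phi> ((P' \<circ> \<sigma>) k)) = (\<lambda>k. u (k + k0)) \<circ> \<sigma>" by (auto simp: P'_def P(2))
  also have "liminf \<dots> = I"
    using LIMSEQ_subseq_LIMSEQ[OF LIMSEQ_ignore_initial_segment[OF u(2)] \<sigma>(1)] by (intro lim_imp_Liminf) auto
  finally have "\<Phi> l \<le> I" .
  then have "\<Phi> l \<le> \<Phi> p" if "p \<in> feasible s" for p
    using that unfolding I_def by (meson Inf_lower imageI order_trans)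
  then have "minimizer_on \<Phi> (feasible s) l" using \<sigma>(2) by (auto simp: is_arg_min_linorder)
  then show thesis by (rule that)
qed

end

section \<open>Minimizers of \<open>L_bar\<close>\<close>

lemma ext_by_limits_PInfty:
  assumes "((\<lambda>t. ennreal (\<gamma> t)) \<longlongrightarrow> l) at_top"
  shows "ext_by_limits \<gamma> \<infinity> = l"
  using tendsto_Lim[OF _ assms] by (simp add: ext_by_limits_def)

locale john_losses = john_position s h
  for s :: real and h :: "real ^ 'n \<Rightarrow> real" +
  fixes f g :: "real \<Rightarrow> real"
  assumes f_convex: "convex_on UNIV f" and f_zero: "\<And>x. x \<le> -1 \<Longrightarrow> f x = 0"
    and f_strict_mono: "strict_mono_on {-1..} f"
    and g_antimono: "antimono g" and g_one: "\<And>x. x \<le> -1 \<Longrightarrow> g x = 1"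
    and g_pos: "\<And>x. -1 < x \<Longrightarrow> x < 1 \<Longrightarrow> g x > 0" and g_zero: "\<And>x. x \<ge> 1 \<Longrightarrow> g x = 0"
begin

section \<open>The rescaled losses and weights\<close>

lemma f_less:
  assumes "x < y" "-1 < y"
  shows "f x < f y"
proof (cases "-1 \<le> x")
  case True
  then show ?thesis using assms f_strict_mono by (auto simp: strict_mono_on_def)
next
  case False
  then have "f x = f (-1)" using f_zero by simp
  also have "\<dots> < f y" using assms f_strict_mono by (auto simp: strict_mono_on_def)
  finally show ?thesis .
qed

lemma f_mono: "mono f"
proof (rule monoI)
  fix x y :: real
  assume "x \<le> y"
  then show "f x \<le> f y" using f_less[of x y] f_zero[of x] f_zero[of y] by (cases "x = y"; cases "-1 < y") auto
qed

lemma f_nonneg: "0 \<le> f x"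
  using monoD[OF f_mono, of "min x (-1)" x] f_zero[of "min x (-1)"] by simp

lemma f_0_pos: "0 < f 0"
  using f_less[of "-1" 0] f_zero[of "-1"] by simp

text \<open>Convexity at 0, written as a combination of t and -1, where f vanishes. It provides the
  slope that becomes f 0 / (1 - r) after rescaling.\<close>

lemma f_ge_linear:
  assumes "0 \<le> t"
  shows "f 0 * t \<le> f t"
proof -
  have "f ((1 - 1 / (1 + t)) *\<^sub>R (-1) + (1 / (1 + t)) *\<^sub>R t) \<le> (1 - 1 / (1 + t)) * f (-1) + (1 / (1 + t)) * f t"
    using assms by (intro convex_onD[OF f_convex]) auto
  moreover have "(1 - 1 / (1 + t)) *\<^sub>R (-1) + (1 / (1 + t)) *\<^sub>R t = 0"
    using assms by (simp add: field_simps)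
  ultimately have "f 0 \<le> f t / (1 + t)" using f_zero[of "-1"] by simp
  then have "f 0 * (1 + t) \<le> f t" using assms by (simp add: field_simps)
  then show ?thesis using f_0_pos by (simp add: algebra_simps)
qed

text \<open>The threshold is r because (r - 1) / (1 - r) = -1, the point up to which f
  vanishes.\<close>

lemma rescaled_f_less:
  assumes "r < 1" "u < w" "r < w"
  shows "rescaled f r u < rescaled f r w"
  unfolding rescaled_def using assms by (intro f_less divide_strict_right_mono) (auto simp: field_simps)

lemma rescaled_f_ge:
  assumes "r < 1"
  shows "f 0 / (1 - r) * positive_part u \<le> rescaled f r u"
proof (cases "1 \<le> u")
  case True
  then show ?thesis using f_ge_linear[of "(u - 1) / (1 - r)"] assms by (simp add: positive_part_def rescaled_def)
next
  case False
  then show ?thesis using f_nonneg by (simp add: positive_part_def rescaled_def)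
qed

lemma loss_fun_rescaled:
  assumes r: "r < 1"
  shows "loss_fun (rescaled f r)"
  unfolding loss_fun_def
proof (intro conjI allI)
  show "mono (rescaled f r)"
    using r by (auto simp: mono_def rescaled_def intro!: monoD[OF f_mono] divide_right_mono)
  show "convex_on UNIV (rescaled f r)"
  proof (rule convex_onI)
    fix t x y :: real
    assume t: "0 < t" "t < 1"
    have "((1 - t) *\<^sub>R x + t *\<^sub>R y - 1) / (1 - r) = (1 - t) *\<^sub>R ((x - 1) / (1 - r)) + t *\<^sub>R ((y - 1) / (1 - r))"
      by (simp add: diff_divide_distrib add_divide_distrib algebra_simps)
    then show "rescaled f r ((1 - t) *\<^sub>R x + t *\<^sub>R y) \<le> (1 - t) * rescaled f r x + t * rescaled f r y"
      unfolding rescaled_def using t by (simp only: convex_onD[OF f_convex] less_imp_le UNIV_I)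
  qed simp
  show "0 \<le> rescaled f r x" for x by (simp add: rescaled_def f_nonneg)
  have "filterlim (\<lambda>u. f 0 / (1 - r) * positive_part u) at_top at_top"
    using f_0_pos r loss_fun_positive_part
    by (intro filterlim_tendsto_pos_mult_at_top[OF tendsto_const]) (auto simp: loss_fun_def)
  then show "filterlim (rescaled f r) at_top at_top"
    by (rule filterlim_at_top_mono) (intro always_eventually allI rescaled_f_ge[OF r])
qed

lemma g_nonneg: "0 \<le> g x"
  using g_one[of x] g_pos[of x] g_zero[of x] by (cases "x \<le> -1"; cases "x < 1") auto

lemma g_le_1: "g x \<le> 1"
  using antimonoD[OF g_antimono, of "min x (-1)" x] g_one[of "min x (-1)"] by simp

lemma borel_measurable_g [measurable]: "g \<in> borel_measurable borel"
proof -
  have "mono (\<lambda>x. - g x)" using g_antimono by (auto simp: mono_def antimono_def)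
  then have "(\<lambda>x. - g x) \<in> borel_measurable borel" by (rule borel_measurable_mono)
  then show ?thesis by simp
qed

text \<open>Where \<^term>\<open>q\<close> vanishes, \<open>norm x \<ge> 1\<close>; so for \<open>y > 0\<close> the argument of \<open>g\<^sub>r\<close> in the integrand of \<^const>\<open>L_bar\<close>
  is \<open>\<infinity>\<close> there, which explains the value \<open>0\<close>.\<close>

definition weight :: "real \<Rightarrow> (real ^ 'n) \<times> real \<Rightarrow> ennreal" where
  "weight r = (\<lambda>(x, y). if y \<le> 0 \<or> q x = 0 then 0
     else ennreal (g (((norm x)\<^sup>2 + y\<^sup>2 - 1) / (2 * (q x)\<^sup>2) / (1 - r))))"

definition weight_measure :: "real \<Rightarrow> ((real ^ 'n) \<times> real) measure" where
  "weight_measure r = density lborel (\<lambda>p. ennreal (1 / (1 - r)) * weight r p)"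

lemma borel_measurable_weight_compose [measurable]:
  assumes [measurable]: "X \<in> borel_measurable M" "Y \<in> borel_measurable M"
  shows "(\<lambda>p. weight r (X p, Y p)) \<in> borel_measurable M"
  unfolding weight_def prod.case by measurable

lemma borel_measurable_weight [measurable]: "weight r \<in> borel_measurable borel"
proof -
  have "(\<lambda>p. weight r (fst p, snd p)) \<in> borel_measurable (borel :: ((real ^ 'n) \<times> real) measure)"
    by (intro borel_measurable_weight_compose borel_measurable_continuous_onI continuous_intros)
  then show ?thesis by simp
qed

lemma one_minus_norm_le_q: "1 - (norm x)\<^sup>2 \<le> (q x)\<^sup>2"
proof -
  have "max 0 (1 - (norm x)\<^sup>2) = (ball_profile x)\<^sup>2" by (simp add: ball_profile_def)
  also have "\<dots> \<le> (q x)\<^sup>2" using ball_profile_le_q[of x] by (intro power_mono) (auto simp: ball_profile_def)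
  finally show ?thesis by simp
qed

lemma ext_rescaled_f:
  assumes "r < 1" "0 < a" "0 \<le> b"
  shows "ext_by_limits (rescaled f r) (ereal a / ereal b) = loss (rescaled f r) a b"
proof (cases "b = 0")
  case True
  have "((\<lambda>t. ennreal (rescaled f r t)) \<longlongrightarrow> top) at_top"
    using loss_fun_rescaled[OF assms(1)] by (simp add: ennreal_tendsto_top_eq_at_top loss_fun_def)
  moreover have "ereal a / ereal b = \<infinity>" using True assms(2) by (simp add: divide_ereal_def flip: zero_ereal_def)
  ultimately show ?thesis using True by (simp add: loss_def ext_by_limits_PInfty)
next
  case False
  then show ?thesis by (simp add: loss_def ext_by_limits_def)
qed

lemma ext_rescaled_g:
  assumes r: "r < 1" and y: "0 < y"
  shows "ext_by_limits (rescaled g r) (ereal ((norm x)\<^sup>2 + y\<^sup>2 - 1) / ereal (2 * h x powr (2 / s)) + 1) = weight r (x, y)"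
proof -
  have q2: "h x powr (2 / s) = (q x)\<^sup>2"
    by (simp add: q_def power2_eq_square flip: powr_add add_divide_distrib)
  show ?thesis
  proof (cases "q x = 0")
    case True
    then have "1 - (norm x)\<^sup>2 \<le> 0" using one_minus_norm_le_q[of x] by simp
    moreover have "0 < y\<^sup>2" using y by simp
    ultimately have "0 < (norm x)\<^sup>2 + y\<^sup>2 - 1" by linarith
    then have "ereal ((norm x)\<^sup>2 + y\<^sup>2 - 1) / ereal (2 * (q x)\<^sup>2) + 1 = \<infinity>"
      using True by (simp add: divide_ereal_def flip: zero_ereal_def)
    moreover have "((\<lambda>t. ennreal (rescaled g r t)) \<longlongrightarrow> 0) at_top"
    proof (rule tendsto_eventually)
      \<comment> \<open>The zero set of g, from 1 on, becomes t \<ge> 2 - r after rescaling.\<close>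
      show "eventually (\<lambda>t. ennreal (rescaled g r t) = 0) at_top"
        using eventually_ge_at_top[of "2 - r"]
        by eventually_elim (use r in \<open>simp add: rescaled_def g_zero le_divide_eq\<close>)
    qed
    ultimately show ?thesis using True unfolding q2
      by (simp add: weight_def ext_by_limits_PInfty)
  next
    case False
    then show ?thesis using y unfolding q2
      by (simp add: weight_def ext_by_limits_def rescaled_def flip: one_ereal_def)
  qed
qed

lemma L_bar_eq:
  assumes r: "r < 1" and \<alpha>: "0 < \<alpha>"
  shows "L_bar s h f g r ((A, \<alpha>), v) = ennreal (1 / (1 - r)) *
    (\<integral>\<^sup>+x. \<integral>\<^sup>+y. loss (rescaled f r) (\<alpha> * y) (q (A *v x + v)) * weight r (x, y) \<partial>lborel \<partial>lborel)"
  unfolding L_bar_def prod.case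
proof (intro arg_cong[where f = "\<lambda>I. ennreal (1 / (1 - r)) * I"] nn_integral_cong)
  fix x and y :: real
  show "ext_by_limits (rescaled f r) (ereal (\<alpha> * y) / ereal (h (A *v x + v) powr (1 / s))) *
      ext_by_limits (rescaled g r) (ereal ((norm x)\<^sup>2 + y\<^sup>2 - 1) / ereal (2 * h x powr (2 / s)) + 1) *
      indicator {0<..} y = loss (rescaled f r) (\<alpha> * y) (q (A *v x + v)) * weight r (x, y)"
  proof (cases "0 < y")
    case True
    then show ?thesis
      using ext_rescaled_f[OF r, of "\<alpha> * y" "q (A *v x + v)"] \<alpha> ext_rescaled_g[OF r True, of x]
      by (simp add: q_def)
  next
    case False
    then show ?thesis by (simp add: weight_def)
  qed
qed

lemma L_bar_eq_total_loss:
  assumes r: "r < 1" and \<alpha>: "0 < \<alpha>"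
  shows "L_bar s h f g r ((A, \<alpha>), v) = total_loss (rescaled f r) (weight_measure r) ((A, \<alpha>), v)"
proof -
  let ?l = "\<lambda>p. loss (rescaled f r) (\<alpha> * snd p) (q (A *v fst p + v))"
  have l: "?l \<in> borel_measurable borel"
    by (rule borel_measurable_loss_integrand[OF loss_fun_rescaled[OF r]])
  have m: "(\<lambda>p. ?l p * weight r p) \<in> borel_measurable (lborel \<Otimes>\<^sub>M lborel)"
    unfolding lborel_prod using l by simp
  have "L_bar s h f g r ((A, \<alpha>), v) = ennreal (1 / (1 - r)) *
      (\<integral>\<^sup>+x. \<integral>\<^sup>+y. ?l (x, y) * weight r (x, y) \<partial>lborel \<partial>lborel)"
    unfolding L_bar_eq[OF r \<alpha>] by simp
  also have "\<dots> = ennreal (1 / (1 - r)) * (\<integral>\<^sup>+p. ?l p * weight r p \<partial>lborel)"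
    unfolding lborel.nn_integral_fst[OF m] lborel_prod by simp
  also have "\<dots> = (\<integral>\<^sup>+p. ennreal (1 / (1 - r)) * weight r p * ?l p \<partial>lborel)"
    using l by (subst nn_integral_cmult[symmetric]) (auto simp: ac_simps)
  also have "\<dots> = total_loss (rescaled f r) (weight_measure r) ((A, \<alpha>), v)"
    unfolding total_loss_def weight_measure_def prod.case using l by (subst nn_integral_density) auto
  finally show ?thesis .
qed

lemma sets_weight_measure [simp]: "sets (weight_measure r) = sets borel"
  by (simp add: weight_measure_def)

lemma AE_weight_measure: "AE p in weight_measure r. 0 < snd p"
  unfolding weight_measure_def
  by (subst AE_density, measurable) (rule AE_I2, auto simp: weight_def split: if_splits)

text \<open>On the half ball the argument of g is negative, and q is positive there by comparison
  with the unit ball.\<close>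

lemma weight_ge_half_ball:
  assumes r: "r < 1" and p: "p \<in> half_ball"
  shows "ennreal (g 0) \<le> weight r p"
proof -
  obtain x y where xy: "p = (x, y)" by (cases p)
  have y: "0 < y" "(norm x)\<^sup>2 + y\<^sup>2 < 1" using p by (auto simp: xy mem_half_ball_iff)
  then have "(norm x)\<^sup>2 < 1" using zero_le_power2[of y] by linarith
  then have "0 < ball_profile x" by (simp add: ball_profile_def)
  then have "0 < q x" using ball_profile_le_q[of x] by linarith
  moreover have "g 0 \<le> g (((norm x)\<^sup>2 + y\<^sup>2 - 1) / (2 * (q x)\<^sup>2) / (1 - r))"
    using y r by (intro antimonoD[OF g_antimono]) (auto intro!: divide_nonpos_nonneg)
  ultimately show ?thesis using y by (auto simp: xy weight_def intro: ennreal_leI)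
qed

text \<open>One factor 1 / (1 - r) is the prefactor of \<open>L_bar\<close>, the other comes from
  the slope of the rescaled f; g 0 is the minimum guaranteed for the weight on the half
  ball.\<close>

lemma L_bar_coercive:
  assumes r: "r < 1" and \<alpha>: "0 < \<alpha>"
  shows "ennreal (g 0 * f 0 / (1 - r)\<^sup>2) * excess ((A, \<alpha>), v) \<le> L_bar s h f g r ((A, \<alpha>), v)"
proof -
  let ?l = "\<lambda>F p. loss F (\<alpha> * snd p) (q (A *v fst p + v))"
  have l: "?l F \<in> borel_measurable borel" if "loss_fun F" for F
    by (rule borel_measurable_loss_integrand[OF that])
  have "g 0 * f 0 / (1 - r)\<^sup>2 = (1 / (1 - r)) * g 0 * (f 0 / (1 - r))" by (simp add: power2_eq_square)
  then have c: "ennreal (g 0 * f 0 / (1 - r)\<^sup>2) = ennreal (1 / (1 - r)) * ennreal (g 0) * ennreal (f 0 / (1 - r))"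
    using r f_0_pos g_nonneg[of 0] by (simp only: ennreal_mult mult_nonneg_nonneg divide_nonneg_nonneg less_imp_le
        diff_gt_0_iff_gt zero_le_one)
  have "ennreal (g 0 * f 0 / (1 - r)\<^sup>2) * excess ((A, \<alpha>), v)
      = (\<integral>\<^sup>+p. ennreal (g 0 * f 0 / (1 - r)\<^sup>2) * (indicator half_ball p * ?l positive_part p) \<partial>lborel)"
    unfolding excess_def total_loss_def half_ball_measure_def prod.case using l[OF loss_fun_positive_part]
    by (subst nn_integral_density) (auto simp: nn_integral_cmult)
  also have "\<dots> \<le> (\<integral>\<^sup>+p. ennreal (1 / (1 - r)) * weight r p * ?l (rescaled f r) p \<partial>lborel)"
  proof (rule nn_integral_mono)
    fix p :: "(real ^ 'n) \<times> real"
    have le: "ennreal (f 0 / (1 - r)) * loss positive_part a b \<le> loss (rescaled f r) a b" for a b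
      using rescaled_f_ge[OF r, of "a / b"] f_0_pos r
      by (auto simp: loss_def positive_part_def simp flip: ennreal_mult intro!: ennreal_leI)
    show "ennreal (g 0 * f 0 / (1 - r)\<^sup>2) * (indicator half_ball p * ?l positive_part p)
        \<le> ennreal (1 / (1 - r)) * weight r p * ?l (rescaled f r) p"
    proof (cases "p \<in> half_ball")
      case True
      have "ennreal (g 0 * f 0 / (1 - r)\<^sup>2) * (indicator half_ball p * ?l positive_part p)
          = ennreal (1 / (1 - r)) * ennreal (g 0) * (ennreal (f 0 / (1 - r)) * ?l positive_part p)"
        using True unfolding c by (simp add: mult.assoc)
      also have "\<dots> \<le> ennreal (1 / (1 - r)) * weight r p * ?l (rescaled f r) p"
        by (intro mult_mono weight_ge_half_ball[OF r True] le) auto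
      finally show ?thesis .
    qed simp
  qed
  also have "\<dots> = L_bar s h f g r ((A, \<alpha>), v)"
    unfolding L_bar_eq_total_loss[OF r \<alpha>] total_loss_def weight_measure_def prod.case
    using l[OF loss_fun_rescaled[OF r]] by (subst nn_integral_density) auto
  finally show ?thesis .
qed

text \<open>Wherever the integrand of \<^const>\<open>L_bar\<close> at the identity is non-zero, \<open>r q x < y \<le> (2 - r) q x\<close>, and there
  \<open>f\<^sub>r\<close> is at most \<open>f 1\<close>. The length \<open>2 (1 - r) q x\<close> of this interval compensates the prefactor.\<close>

lemma L_bar_identity_bound:
  obtains C where "0 \<le> C" "\<And>r. 1/2 < r \<Longrightarrow> r < 1 \<Longrightarrow> L_bar s h f g r ((mat 1, 1), 0) \<le> ennreal C"
proof -
  obtain Q c where Qc: "0 < Q" "0 < c" "\<And>x. q x \<le> Q * exp (- c * norm x)" using q_exponential_decay by blast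
  have Q: "q x \<le> Q" for x
  proof -
    have "Q * exp (- c * norm x) \<le> Q * 1" using Qc by (intro mult_left_mono) auto
    then show ?thesis using Qc(3)[of x] by linarith
  qed
  define V where "V = measure lborel (cball (0 :: real ^ 'n) (1 + Q))"
  have V: "emeasure lborel (cball (0 :: real ^ 'n) (1 + Q)) = ennreal V"
    unfolding V_def using emeasure_bounded_finite[of "cball (0 :: real ^ 'n) (1 + Q)"]
    by (intro emeasure_eq_ennreal_measure) auto
  define C where "C = 2 * f 1 * Q * V"
  have f1: "0 \<le> f 1" by (rule f_nonneg)
  have "L_bar s h f g r ((mat 1, 1), 0) \<le> ennreal C" if r: "1/2 < r" "r < 1" for r
  proof -
    have pt: "loss (rescaled f r) y (q x) * weight r (x, y)
        \<le> ennreal (f 1) * indicator (cball 0 (1 + Q)) x * indicator {r * q x..(2 - r) * q x} y" for x y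
    proof (cases "0 < y \<and> q x \<noteq> 0 \<and> r < y / q x \<and> ((norm x)\<^sup>2 + y\<^sup>2 - 1) / (2 * (q x)\<^sup>2) / (1 - r) < 1")
      case False
      have "rescaled f r (y / q x) = 0" if "\<not> r < y / q x"
        using that r by (auto simp: rescaled_def field_simps intro!: f_zero)
      moreover have "g t = 0" if "\<not> t < 1" for t using that g_zero by simp
      ultimately show ?thesis using False by (auto simp: loss_def weight_def)
    next
      case True
      then have y: "0 < y" and q0: "q x \<noteq> 0" and ry: "r < y / q x"
        and w: "((norm x)\<^sup>2 + y\<^sup>2 - 1) / (2 * (q x)\<^sup>2) / (1 - r) < 1" by auto
      have q: "0 < q x" using q0 by (simp add: less_le)
      have w': "(norm x)\<^sup>2 + y\<^sup>2 - 1 < 2 * (1 - r) * (q x)\<^sup>2"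
      proof -
        have r1: "0 < 1 - r" using r by simp
        have "((norm x)\<^sup>2 + y\<^sup>2 - 1) / (2 * (q x)\<^sup>2) < 1 - r"
          using w unfolding pos_divide_less_eq[OF r1] by simp
        then have "(norm x)\<^sup>2 + y\<^sup>2 - 1 < (1 - r) * (2 * (q x)\<^sup>2)" using q by (simp add: pos_divide_less_eq)
        also have "\<dots> = 2 * (1 - r) * (q x)\<^sup>2" by (simp only: ac_simps)
        finally show ?thesis .
      qed
      \<comment> \<open>Since 1 - |x|^2 \<le> q^2, the bound is (3 - 2 r) q^2, which falls short of
        the square of (2 - r) q by (1 - r)^2 q^2.\<close>
      have "y\<^sup>2 \<le> (q x)\<^sup>2 + 2 * (1 - r) * (q x)\<^sup>2" using w' one_minus_norm_le_q[of x] by linarith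
      also have "\<dots> \<le> ((2 - r) * q x)\<^sup>2"
      proof -
        have "0 \<le> (1 - r)\<^sup>2 * (q x)\<^sup>2" by simp
        also have "\<dots> = ((2 - r) * q x)\<^sup>2 - ((q x)\<^sup>2 + 2 * (1 - r) * (q x)\<^sup>2)"
          by (simp add: power2_eq_square algebra_simps)
        finally show ?thesis by linarith
      qed
      finally have y2: "y \<le> (2 - r) * q x" by (rule power2_le_imp_le) (use r q in simp)
      then have "y / q x \<le> 2 - r" using q by (simp add: pos_divide_le_eq)
      then have "rescaled f r (y / q x) \<le> f 1"
        unfolding rescaled_def using r by (intro monoD[OF f_mono]) (simp add: pos_divide_le_eq)
      then have "loss (rescaled f r) y (q x) \<le> ennreal (f 1)" using q0 by (simp add: loss_def ennreal_leI)
      moreover have "weight r (x, y) \<le> 1" using g_le_1 by (auto simp: weight_def ennreal_le_1)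
      ultimately have "loss (rescaled f r) y (q x) * weight r (x, y) \<le> ennreal (f 1) * 1" by (intro mult_mono) auto
      moreover have "norm x \<le> 1 + Q"
      proof (rule power2_le_imp_le)
        \<comment> \<open>Here r > 1/2 gives 2 (1 - r) \<le> 1, so that the ball containing the
          relevant x does not depend on r.\<close>
        have "2 * (1 - r) * (q x)\<^sup>2 \<le> 1 * Q\<^sup>2" using r Q[of x] q by (intro mult_mono power_mono) auto
        then have "(norm x)\<^sup>2 \<le> 1 + Q\<^sup>2" using w' zero_le_power2[of y] by linarith
        also have "\<dots> \<le> (1 + Q)\<^sup>2" using Qc by (simp add: power2_sum)
        finally show "(norm x)\<^sup>2 \<le> (1 + Q)\<^sup>2" .
      qed (use Qc in simp)
      moreover have "r * q x \<le> y" using ry q by (simp add: pos_less_divide_eq)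
      ultimately show ?thesis using y2 by simp
    qed
    have "L_bar s h f g r ((mat 1, 1), 0) = ennreal (1 / (1 - r)) *
        (\<integral>\<^sup>+x. \<integral>\<^sup>+y. loss (rescaled f r) y (q x) * weight r (x, y) \<partial>lborel \<partial>lborel)"
      using L_bar_eq[OF r(2), of 1 "mat 1" 0] by simp
    also have "\<dots> \<le> ennreal (1 / (1 - r)) *
        (\<integral>\<^sup>+x. \<integral>\<^sup>+y. ennreal (f 1) * indicator (cball 0 (1 + Q)) x * indicator {r * q x..(2 - r) * q x} y \<partial>lborel \<partial>lborel)"
      by (intro mult_left_mono nn_integral_mono pt) simp
    also have "\<dots> \<le> ennreal (1 / (1 - r)) *
        (\<integral>\<^sup>+x. ennreal (f 1 * (2 * (1 - r) * Q)) * indicator (cball (0 :: real ^ 'n) (1 + Q)) x \<partial>lborel)"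
    proof (intro mult_left_mono nn_integral_mono)
      fix x :: "real ^ 'n"
      have "r * q x \<le> (2 - r) * q x" using r by (intro mult_right_mono) auto
      then have "(\<integral>\<^sup>+y. ennreal (f 1) * indicator (cball 0 (1 + Q)) x * indicator {r * q x..(2 - r) * q x} y \<partial>lborel)
          = ennreal (f 1) * indicator (cball 0 (1 + Q)) x * ennreal ((2 - r) * q x - r * q x)"
        by (simp add: nn_integral_cmult)
      also have "(2 - r) * q x - r * q x = 2 * (1 - r) * q x" by (simp add: algebra_simps)
      also have "ennreal (f 1) * indicator (cball 0 (1 + Q)) x * ennreal (2 * (1 - r) * q x)
          \<le> ennreal (f 1) * indicator (cball 0 (1 + Q)) x * ennreal (2 * (1 - r) * Q)"
        using r Q[of x] by (intro mult_left_mono ennreal_leI) auto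
      also have "\<dots> = ennreal (f 1 * (2 * (1 - r) * Q)) * indicator (cball 0 (1 + Q)) x"
        using f1 r Qc by (simp add: ennreal_mult ac_simps)
      finally show "(\<integral>\<^sup>+y. ennreal (f 1) * indicator (cball 0 (1 + Q)) x * indicator {r * q x..(2 - r) * q x} y \<partial>lborel)
          \<le> ennreal (f 1 * (2 * (1 - r) * Q)) * indicator (cball 0 (1 + Q)) x" .
    qed simp
    also have "\<dots> = ennreal (1 / (1 - r)) * (ennreal (f 1 * (2 * (1 - r) * Q)) * ennreal V)"
      by (subst nn_integral_cmult_indicator) (simp_all only: V sets_lborel borel_closed closed_cball)
    also have "\<dots> = ennreal (1 / (1 - r) * (f 1 * (2 * (1 - r) * Q) * V))"
      using r f1 Qc by (simp add: V_def flip: ennreal_mult)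
    also have "1 / (1 - r) * (f 1 * (2 * (1 - r) * Q) * V) = C" using r by (simp add: C_def field_simps)
    finally show ?thesis .
  qed
  moreover have "0 \<le> C" using f1 Qc by (simp add: C_def V_def)
  ultimately show thesis using that by blast
qed

section \<open>Existence, uniqueness and convergence of the minimizers\<close>

lemma identity_feasible: "((mat 1, 1), 0) \<in> feasible s"
  by (simp add: mem_feasible_iff spd_mat_1)

lemma L_bar_minimizer_exists:
  assumes r: "1/2 < r" "r < 1"
  obtains p where "minimizer_on (L_bar s h f g r) (feasible s) p"
proof (rule feasible_minimizer_exists[OF identity_feasible])
  show "L_bar s h f g r ((mat 1, 1), 0) < top"
    using L_bar_identity_bound r by (metis ennreal_less_top order_le_less_trans)
  show "0 < g 0 * f 0 / (1 - r)\<^sup>2" using r f_0_pos g_pos[of 0] by simp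
  show "ennreal (g 0 * f 0 / (1 - r)\<^sup>2) * excess p \<le> L_bar s h f g r p" if "p \<in> feasible s" for p :: "'n block \<times> (real ^ 'n)"
    using that L_bar_coercive[OF r(2)] by (cases p) (auto simp: mem_feasible_iff)
  fix P and p :: "'n block \<times> (real ^ 'n)" assume P: "\<And>k :: nat. P k \<in> feasible s" and p: "p \<in> feasible s" and lim: "P \<longlonglongrightarrow> p"
  have eq: "L_bar s h f g r p = total_loss (rescaled f r) (weight_measure r) p" if "p \<in> feasible s" for p :: "'n block \<times> (real ^ 'n)"
    using that L_bar_eq_total_loss[OF r(2)] by (cases p) (auto simp: mem_feasible_iff)
  obtain A \<alpha> v where pA: "p = ((A, \<alpha>), v)" by (metis prod.exhaust)
  have "0 < \<alpha>" using p by (simp add: pA mem_feasible_iff)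
  then show "L_bar s h f g r p \<le> liminf (\<lambda>k. L_bar s h f g r (P k))"
    unfolding eq[OF P] eq[OF p]
    using total_loss_lower_semicontinuous[OF loss_fun_rescaled[OF r(2)] sets_weight_measure AE_weight_measure
        lim[unfolded pA]] by (simp add: pA)
qed (rule that)

text \<open>Strictness stems from monotonicity, not from convexity: a lies strictly below the
  geometric mean, and \<open>rescaled f r\<close> increases strictly beyond r, where a / b lies.
  Finiteness of the right side excludes vanishing denominators.\<close>

lemma loss_midpoint_strict:
  assumes r: "r < 1"
    and a: "0 < a1" "0 < a2" "a < sqrt (a1 * a2)"
    and b: "0 \<le> b1" "0 \<le> b2" "sqrt (b1 * b2) \<le> b"
    and ra: "r * b < a"
    and fin: "loss (rescaled f r) a1 b1 + loss (rescaled f r) a2 b2 \<noteq> top"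
  shows "2 * loss (rescaled f r) a b < loss (rescaled f r) a1 b1 + loss (rescaled f r) a2 b2"
proof -
  let ?F = "rescaled f r"
  have b': "0 < b1" "0 < b2" using fin b by (auto simp: loss_def less_le split: if_splits)
  then have "0 < sqrt (b1 * b2)" by simp
  then have b0: "0 < b" using b by linarith
  have "a / b < sqrt (a1 * a2) / b" using a b0 by (simp add: divide_strict_right_mono)
  also have "\<dots> \<le> (a1 / b1 + a2 / b2) / 2" using quotient_le_mean[OF a(1,2) order_refl b' b(3)] .
  finally have lt: "a / b < (a1 / b1 + a2 / b2) / 2" .
  have "r < a / b" using ra b0 by (simp add: pos_less_divide_eq)
  then have "2 * ?F (a / b) < 2 * ?F ((a1 / b1 + a2 / b2) / 2)"
    using rescaled_f_less[OF r lt less_trans[OF _ lt]] by simp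
  also have "\<dots> \<le> ?F (a1 / b1) + ?F (a2 / b2)"
    using loss_fun_rescaled[OF r] by (intro convex_on_midpoint) (simp add: loss_fun_def)
  finally have "ennreal (2 * ?F (a / b)) < ennreal (?F (a1 / b1) + ?F (a2 / b2))"
    using loss_fun_rescaled[OF r] by (intro ennreal_lessI) (auto simp: loss_fun_def intro: le_less_trans[rotated])
  then show ?thesis using b0 b' loss_fun_rescaled[OF r] by (simp add: loss_def loss_fun_def ennreal_mult)
qed

text \<open>If two minimizers had different matrix parts, their midpoint (with \<open>\<alpha>\<close> determined by the
  volume constraint) would be strictly better: otherwise \<open>\<alpha> y \<le> r q (A x + v)\<close> on the half ball, and
  the contained ellipsoid \<open>A \<oplus> \<alpha> / r\<close> would have too large a volume.\<close>

lemma L_bar_midpoint_less: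
  assumes r: "1/2 < r" "r < 1"
    and p1: "((A1, \<alpha>1), v1) \<in> feasible s" and p2: "((A2, \<alpha>2), v2) \<in> feasible s" and "A1 \<noteq> A2"
    and m1: "L_bar s h f g r ((A1, \<alpha>1), v1) = m" and m2: "L_bar s h f g r ((A2, \<alpha>2), v2) = m" and m: "m < top"
  shows "\<exists>p\<in>feasible s. L_bar s h f g r p < m"
proof -
  let ?F = "rescaled f r" and ?N = "weight_measure r"
  have f1: "spd A1" "0 < \<alpha>1" "\<alpha>1 powr s * det A1 = 1" and f2: "spd A2" "0 < \<alpha>2" "\<alpha>2 powr s * det A2 = 1"
    using p1 p2 by (auto simp: mem_feasible_iff)
  define A where "A = (1/2) *\<^sub>R (A1 + A2)"
  define v where "v = (1/2) *\<^sub>R (v1 + v2)"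
  have A: "spd A" unfolding A_def by (intro spd_scaleR spd_add f1 f2) simp
  have d: "0 < det A" "0 < det A1" "0 < det A2" using A f1 f2 by (auto intro: spd_det_pos)
  define \<alpha> where "\<alpha> = (1 / det A) powr (1 / s)"
  have \<alpha>: "0 < \<alpha>" using d by (simp add: \<alpha>_def)
  have \<alpha>s: "\<alpha> powr s * det A = 1" using d s_pos by (simp add: \<alpha>_def powr_powr)
  have p: "((A, \<alpha>), v) \<in> feasible s" using A \<alpha> \<alpha>s by (simp add: mem_feasible_iff)
  \<comment> \<open>By the volume constraints each determinant is the inverse of the corresponding
    \<alpha> powr s, so this is the strict determinant inequality after inversion and an s-th
    root.\<close>
  have \<alpha>lt: "\<alpha> < sqrt (\<alpha>1 * \<alpha>2)"
  proof -
    have "sqrt (det A1 * det A2) < det A"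
      unfolding A_def using f1 f2 \<open>A1 \<noteq> A2\<close> by (intro det_midpoint(2))
    then have "1 / det A < 1 / sqrt (det A1 * det A2)"
      using d by (intro divide_strict_left_mono) auto
    also have "1 / sqrt (det A1 * det A2) = sqrt ((1 / det A1) * (1 / det A2))"
      by (simp add: real_sqrt_divide)
    also have "(1 / det A1) * (1 / det A2) = (\<alpha>1 * \<alpha>2) powr s"
      using f1 f2 d by (simp add: powr_mult field_simps)
    also have "sqrt ((\<alpha>1 * \<alpha>2) powr s) = sqrt (\<alpha>1 * \<alpha>2) powr s"
      using f1 f2 by (simp add: powr_half_sqrt[symmetric] powr_powr mult.commute)
    finally have "(1 / det A) powr (1 / s) < (sqrt (\<alpha>1 * \<alpha>2) powr s) powr (1 / s)"
      using d s_pos by (intro powr_less_mono2) auto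
    then show ?thesis using f1 f2 s_pos by (simp add: \<alpha>_def powr_powr)
  qed
  define u0 where "u0 p = loss ?F (\<alpha> * snd p) (q (A *v fst p + v))" for p
  define u1 where "u1 p = loss ?F (\<alpha>1 * snd p) (q (A1 *v fst p + v1))" for p
  define u2 where "u2 p = loss ?F (\<alpha>2 * snd p) (q (A2 *v fst p + v2))" for p
  have meas: "u0 \<in> borel_measurable ?N" "u1 \<in> borel_measurable ?N" "u2 \<in> borel_measurable ?N"
    unfolding u0_def u1_def u2_def using borel_measurable_loss_integrand[OF loss_fun_rescaled[OF r(2)]]
    by (auto cong: measurable_cong_sets)
  note [measurable] = meas
  have L: "L_bar s h f g r ((A, \<alpha>), v) = (\<integral>\<^sup>+p. u0 p \<partial>?N)" "m = (\<integral>\<^sup>+p. u1 p \<partial>?N)" "m = (\<integral>\<^sup>+p. u2 p \<partial>?N)"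
    using L_bar_eq_total_loss[OF r(2)] \<alpha> f1 f2 m1 m2 by (simp_all add: total_loss_def u0_def u1_def u2_def)
  have le: "AE p in ?N. 2 * u0 p \<le> u1 p + u2 p"
    using AE_weight_measure
  proof eventually_elim
    case (elim p)
    then show ?case unfolding u0_def u1_def u2_def A_def v_def
      using loss_fun_rescaled[OF r(2)] f1 f2 \<alpha>lt by (intro loss_integrand_midpoint) auto
  qed
  have sum: "(\<integral>\<^sup>+p. u1 p + u2 p \<partial>?N) = 2 * m" by (simp add: nn_integral_add L(2,3)[symmetric] mult_2)
  then have sum_fin: "(\<integral>\<^sup>+p. u1 p + u2 p \<partial>?N) \<noteq> \<infinity>" using m by (simp add: ennreal_mult_eq_top_iff)
  have "(\<integral>\<^sup>+p. 2 * u0 p \<partial>?N) \<le> (\<integral>\<^sup>+p. u1 p + u2 p \<partial>?N)" using le by (rule nn_integral_mono_AE)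
  then have fin: "(\<integral>\<^sup>+p. 2 * u0 p \<partial>?N) \<noteq> \<infinity>" using sum_fin by (auto simp: top_unique)
  have "\<not> (AE p in ?N. u1 p + u2 p \<le> 2 * u0 p)"
  proof
    assume ge: "AE p in ?N. u1 p + u2 p \<le> 2 * u0 p"
    \<comment> \<open>Where the sum is infinite the pointwise inequality need not be strict; such
      points form a null set because m is finite.\<close>
    have "AE p in ?N. u1 p + u2 p \<noteq> \<infinity>" using sum_fin by (intro nn_integral_noteq_infinite) auto
    with ge AE_weight_measure have "AE p in ?N. \<alpha> * snd p \<le> r * q (A *v fst p + v)"
    proof eventually_elim
      case (elim p)
      show ?case
      proof (rule ccontr)
        assume "\<not> ?case"
        then have ra: "r * q (A *v fst p + v) < \<alpha> * snd p" by simp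
        have "2 * u0 p < u1 p + u2 p"
          unfolding u0_def u1_def u2_def
        proof (rule loss_midpoint_strict[OF r(2)])
          show "\<alpha> * snd p < sqrt (\<alpha>1 * snd p * (\<alpha>2 * snd p))"
          proof -
            have "\<alpha> * snd p < sqrt (\<alpha>1 * \<alpha>2) * snd p" using \<alpha>lt elim by simp
            also have "\<dots> = sqrt (\<alpha>1 * snd p * (\<alpha>2 * snd p))" using elim by (simp add: real_sqrt_mult)
            finally show ?thesis .
          qed
          have "A *v fst p + v = (1/2) *\<^sub>R ((A1 *v fst p + v1) + (A2 *v fst p + v2))"
            by (simp add: A_def v_def matrix_vector_mult_add_rdistrib scaleR_matrix_vector_assoc[symmetric] algebra_simps)
          then show "sqrt (q (A1 *v fst p + v1) * q (A2 *v fst p + v2)) \<le> q (A *v fst p + v)"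
            using q_midpoint by simp
        qed (use elim f1 f2 ra in \<open>auto simp: u1_def u2_def\<close>)
        then show False using elim by simp
      qed
    qed
    then have "AE p in density lborel (\<lambda>p. ennreal (1 / (1 - r)) * weight r p). \<alpha> * snd p \<le> r * q (A *v fst p + v)"
      by (simp only: weight_measure_def)
    moreover have "(\<lambda>p. ennreal (1 / (1 - r)) * weight r p) \<in> borel_measurable lborel" by measurable
    ultimately have "AE p in lborel. 0 < ennreal (1 / (1 - r)) * weight r p \<longrightarrow> \<alpha> * snd p \<le> r * q (A *v fst p + v)"
      by (simp only: AE_density)
    then have "AE p in lborel. p \<in> half_ball \<longrightarrow> (\<alpha> / r) * snd p \<le> q (A *v fst p + v)"
    proof (rule eventually_mono, intro impI)
      fix p :: "(real ^ 'n) \<times> real"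
      assume *: "0 < ennreal (1 / (1 - r)) * weight r p \<longrightarrow> \<alpha> * snd p \<le> r * q (A *v fst p + v)" and hb: "p \<in> half_ball"
      have "0 < ennreal (g 0)" using g_pos[of 0] by simp
      then have "0 < weight r p" using weight_ge_half_ball[OF r(2) hb] by (rule less_le_trans)
      then have "\<alpha> * snd p \<le> r * q (A *v fst p + v)" using * r by (simp add: ennreal_zero_less_mult_iff)
      then have "\<alpha> * snd p / r \<le> q (A *v fst p + v)" using r by (simp add: pos_divide_le_eq mult.commute)
      then show "(\<alpha> / r) * snd p \<le> q (A *v fst p + v)" by simp
    qed
    then have "contained A (\<alpha> / r) v" by (rule contained_if_AE)
    then have "(\<alpha> / r) powr s * det A \<le> 1" using contained_volume[OF A] \<alpha> r by simp
    moreover have "\<alpha> powr s < (\<alpha> / r) powr s" using \<alpha> r s_pos by (intro powr_less_mono2) (auto simp: less_divide_eq)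
    then have "\<alpha> powr s * det A < (\<alpha> / r) powr s * det A" using d by simp
    ultimately show False using \<alpha>s by linarith
  qed
  with fin le have "(\<integral>\<^sup>+p. 2 * u0 p \<partial>?N) < (\<integral>\<^sup>+p. u1 p + u2 p \<partial>?N)"
    by (intro nn_integral_less) auto
  then have "2 * L_bar s h f g r ((A, \<alpha>), v) < 2 * m" unfolding sum L(1) by (simp add: nn_integral_cmult)
  then have "L_bar s h f g r ((A, \<alpha>), v) < m"
    using mult_left_mono[of m "L_bar s h f g r ((A, \<alpha>), v)" 2] by (cases "m \<le> L_bar s h f g r ((A, \<alpha>), v)") (auto simp: not_le)
  then show ?thesis using p by blast
qed

lemma L_bar_unique_min:
  assumes r: "1/2 < r" "r < 1"
  shows "unique_min_up_to_translation (L_bar s h f g r) (feasible s)"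
  unfolding unique_min_up_to_translation_def
proof (intro conjI allI impI)
  show "\<exists>p. minimizer_on (L_bar s h f g r) (feasible s) p" using L_bar_minimizer_exists[OF r] by blast
  fix p1 p2
  assume min: "minimizer_on (L_bar s h f g r) (feasible s) p1 \<and> minimizer_on (L_bar s h f g r) (feasible s) p2"
  obtain A1 \<alpha>1 v1 A2 \<alpha>2 v2 where p: "p1 = ((A1, \<alpha>1), v1)" "p2 = ((A2, \<alpha>2), v2)" by (metis prod.exhaust)
  have fe: "p1 \<in> feasible s" "p2 \<in> feasible s" using min by (auto simp: is_arg_min_linorder)
  have le: "L_bar s h f g r p1 \<le> L_bar s h f g r p" "L_bar s h f g r p2 \<le> L_bar s h f g r p" if "p \<in> feasible s" for p :: "'n block \<times> (real ^ 'n)"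
    using min that unfolding is_arg_min_linorder by blast+
  have eq: "L_bar s h f g r p2 = L_bar s h f g r p1" using le fe by (meson order_antisym)
  have fin: "L_bar s h f g r p1 < top"
    using L_bar_identity_bound r le(1)[OF identity_feasible] by (metis ennreal_less_top order_le_less_trans)
  have A: "A1 = A2"
  proof (rule ccontr)
    assume "A1 \<noteq> A2"
    then obtain p' where "p' \<in> feasible s" "L_bar s h f g r p' < L_bar s h f g r p1"
      using L_bar_midpoint_less[OF r fe[unfolded p], of "L_bar s h f g r p1"] eq fin unfolding p by auto
    then show False using le(1) by (meson not_le)
  qed
  \<comment> \<open>Once the matrices agree, the volume constraint determines \<alpha>.\<close>
  have f1: "0 < \<alpha>1" "0 < \<alpha>2" "\<alpha>1 powr s * det A1 = \<alpha>2 powr s * det A1" "0 < det A1"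
    using fe A by (auto simp: p mem_feasible_iff intro: spd_det_pos)
  then have "\<alpha>1 powr s = \<alpha>2 powr s" by simp
  then have "\<alpha>1 = \<alpha>2" using f1(1,2) s_pos
    by (metis less_irrefl less_imp_le linorder_neqE_linordered_idom powr_less_mono2)
  then show "fst p1 = fst p2" using A by (simp add: p)
qed

lemma L_bar_minimizers_tendsto:
  assumes min: "\<And>r. r \<in> {1/2<..<1} \<Longrightarrow> minimizer_on (L_bar s h f g r) (feasible s) (p r)"
  shows "(p \<longlongrightarrow> ((mat 1, 1), 0)) (at_left 1)"
proof (rule topological_tendstoI)
  fix U :: "('n block \<times> (real ^ 'n)) set"
  assume U: "open U" "((mat 1, 1), 0) \<in> U"
  obtain \<delta> where \<delta>: "0 < \<delta>" "\<And>p. p \<in> feasible s \<Longrightarrow> excess p < ennreal \<delta> \<Longrightarrow> p \<in> U"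
    using excess_separates[OF U] by blast
  obtain C where C: "0 \<le> C" "\<And>r. 1/2 < r \<Longrightarrow> r < 1 \<Longrightarrow> L_bar s h f g r ((mat 1, 1), 0) \<le> ennreal C"
    using L_bar_identity_bound by blast
  define c where "c = g 0 * f 0"
  have c: "0 < c" using f_0_pos g_pos[of 0] by (simp add: c_def)
  have "((\<lambda>r. C * (1 - r)\<^sup>2 / c) \<longlongrightarrow> C * (1 - 1)\<^sup>2 / c) (at_left 1)"
    using c by (intro tendsto_intros) auto
  then have ev: "eventually (\<lambda>r. C * (1 - r)\<^sup>2 / c < \<delta>) (at_left 1)" using \<delta>(1) by (intro order_tendstoD) auto
  have ev': "eventually (\<lambda>r::real. r \<in> {1/2<..<1}) (at_left 1)" by (rule eventually_at_left_real) simp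
  from ev ev' show "eventually (\<lambda>r. p r \<in> U) (at_left 1)"
  proof eventually_elim
    case (elim r)
    then have r: "1/2 < r" "r < 1" by auto
    have pr: "p r \<in> feasible s" using min elim by (auto simp: is_arg_min_linorder)
    have "L_bar s h f g r (p r) \<le> L_bar s h f g r ((mat 1, 1), 0)"
      using min[of r] elim identity_feasible by (auto simp: is_arg_min_linorder)
    then have le: "L_bar s h f g r (p r) \<le> ennreal C" using C(2)[OF r] by (rule order_trans)
    have "ennreal (c / (1 - r)\<^sup>2) * excess (p r) \<le> L_bar s h f g r (p r)"
      using pr L_bar_coercive[OF r(2)] by (cases "p r") (auto simp: mem_feasible_iff c_def)
    also note le
    also have "ennreal C = ennreal (c / (1 - r)\<^sup>2) * ennreal (C * (1 - r)\<^sup>2 / c)"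
      using C c r by (simp flip: ennreal_mult)
    finally have "excess (p r) \<le> ennreal (C * (1 - r)\<^sup>2 / c)"
      using c r by (subst (asm) ennreal_mult_le_mult_iff) auto
    also have "\<dots> < ennreal \<delta>" using elim \<delta>(1) by (intro ennreal_lessI) auto
    finally show ?case using \<delta>(2)[OF pr] by blast
  qed
qed

end

section \<open>Minimizers of \<open>I_bar\<close> and their traces\<close>

lemma frobenius_norm_eq_norm: "frobenius_norm X = norm X"
proof (cases X)
  case (Pair M \<beta>)
  have "(norm M)\<^sup>2 = (\<Sum>i\<in>UNIV. (norm (M $ i))\<^sup>2)"
    by (simp add: norm_vec_def[of M] L2_set_def sum_nonneg)
  also have "\<dots> = (\<Sum>i\<in>UNIV. \<Sum>j\<in>UNIV. (M $ i $ j)\<^sup>2)"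
    by (simp add: norm_vec_def[of "M $ i" for i] L2_set_def sum_nonneg)
  finally show ?thesis by (simp add: Pair frobenius_norm_def norm_Pair)
qed

lemma s_trace_scaleR: "s_trace s (c *\<^sub>R X) = c * s_trace s X"
  by (cases X) (simp add: s_trace_def trace_def sum_distrib_left algebra_simps)

lemma volume_has_derivative_identity:
  "((\<lambda>B :: 'n::finite block. snd B powr s * det (fst B)) has_derivative s_trace s) (at (mat 1, 1))"
proof -
  have det: "((\<lambda>B :: 'n block. det (fst B)) has_derivative (\<lambda>H. trace (fst H))) (at (mat 1, 1))"
    using has_derivative_compose[OF has_derivative_fst[OF has_derivative_ident], of det trace "(mat 1, 1) :: 'n block" UNIV]
      det_has_derivative_mat_1 by simp
  have "((\<lambda>b. b powr s) has_real_derivative s * 1 powr (s - 1)) (at 1)"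
    by (rule has_real_derivative_powr) simp
  then have "((\<lambda>b. b powr s) has_derivative (\<lambda>k. s * k)) (at (snd (mat 1 :: real ^ 'n ^ 'n, 1 :: real)))"
    by (simp add: has_field_derivative_def)
  from has_derivative_compose[OF has_derivative_snd[OF has_derivative_ident] this]
  have powr: "((\<lambda>B :: 'n block. snd B powr s) has_derivative (\<lambda>H. s * snd H)) (at (mat 1, 1))" .
  show ?thesis
    using has_derivative_mult[OF powr det] by (simp add: s_trace_def case_prod_unfold add.commute)
qed

text \<open>The trace is the derivative at the identity of the volume \<open>\<beta>\<^sup>s det M\<close>, which is constant on \<open>SL\<close>.\<close>

lemma s_trace_normalized_tendsto:
  fixes B :: "real \<Rightarrow> 'n::finite block"
  assumes lim: "(B \<longlongrightarrow> (mat 1, 1)) F" and SL: "eventually (\<lambda>r. B r \<in> SL s) F"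
    and c: "eventually (\<lambda>r. 0 < c r) F"
  shows "((\<lambda>r. s_trace s ((1 / frobenius_norm (c r *\<^sub>R (B r - (mat 1, 1)))) *\<^sub>R (c r *\<^sub>R (B r - (mat 1, 1))))) \<longlongrightarrow> 0) F"
proof (rule tendstoI)
  fix e :: real
  assume e: "0 < e"
  define D where "D B = snd B powr s * det (fst B)" for B :: "'n block"
  obtain d where d: "0 < d"
    "\<And>Y. norm (Y - (mat 1, 1)) < d \<Longrightarrow> norm (D Y - D (mat 1, 1) - s_trace s (Y - (mat 1, 1))) \<le> (e / 2) * norm (Y - (mat 1, 1))"
    using volume_has_derivative_identity[of s, where 'n = 'n] half_gt_zero[OF e]
    unfolding has_derivative_at_alt D_def by blast
  have "eventually (\<lambda>r. dist (B r) (mat 1, 1) < d) F" using lim d(1) by (rule tendstoD)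
  with SL c show "eventually (\<lambda>r. dist (s_trace s ((1 / frobenius_norm (c r *\<^sub>R (B r - (mat 1, 1)))) *\<^sub>R
      (c r *\<^sub>R (B r - (mat 1, 1))))) 0 < e) F"
  proof eventually_elim
    case (elim r)
    let ?X = "B r - (mat 1, 1)"
    have "D (B r) = 1" using elim(1) by (auto simp: SL_def D_def)
    moreover have "D (mat 1, 1) = 1" by (simp add: D_def)
    ultimately have le: "\<bar>s_trace s ?X\<bar> \<le> (e / 2) * norm ?X"
      using d(2)[of "B r"] elim(3) by (simp add: dist_norm)
    \<comment> \<open>The positive factor c r cancels in the normalization, so no rate of
      convergence is required. If B r is the identity, both sides are 0 because division by 0 gives
      0.\<close>
    have eq: "s_trace s ((1 / frobenius_norm (c r *\<^sub>R ?X)) *\<^sub>R (c r *\<^sub>R ?X)) = s_trace s ?X / norm ?X"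
      using elim(2) by (simp add: frobenius_norm_eq_norm s_trace_scaleR)
    show ?case
    proof (cases "norm ?X = 0")
      case True
      then show ?thesis using e unfolding eq by simp
    next
      case False
      then have "\<bar>s_trace s ?X / norm ?X\<bar> \<le> e / 2" using le by (simp add: abs_divide pos_divide_le_eq)
      then have "\<bar>s_trace s ?X / norm ?X\<bar> < e" using e by linarith
      then show ?thesis unfolding eq dist_real_def by simp
    qed
  qed
qed

context john_losses begin

text \<open>Substituting A x + v for x and \<alpha> y for y turns one integrand into the other. The
  Jacobian \<open>det A\<close> times \<alpha> combines with the prefactor \<alpha> powr (s - 1) to
  \<alpha> powr s * det A, which is 1 on the feasible set.\<close>

lemma I_bar_renormalize:
  assumes r: "1/2 < r" "r < 1" and p: "p \<in> feasible s"
  shows "I_bar s h f g r (renormalize r p) = L_bar s h f g r p"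
proof -
  obtain A \<alpha> v where pA: "p = ((A, \<alpha>), v)" by (metis prod.exhaust)
  have fe: "spd A" "0 < \<alpha>" "\<alpha> powr s * det A = 1" using p by (auto simp: pA mem_feasible_iff)
  have detA: "0 < det A" using fe(1) by (rule spd_det_pos)
  then have inv: "invertible A" by (simp add: invertible_det_nz)
  let ?T = "\<lambda>x. matrix_inv A *v (x - v)"
  let ?F = "rescaled f r"
  note [measurable] = borel_measurable_loss[OF loss_fun_rescaled[OF r(2)]]
  have ren: "renormalize r p = (((1 / (1 - r)) *\<^sub>R (A - mat 1), (1 / (1 - r)) *\<^sub>R (\<alpha> - 1)), (1 / (1 - r)) *\<^sub>R v)"
    by (simp add: renormalize_def pA)
  have par: "mat 1 + (1 - r) *\<^sub>R ((1 / (1 - r)) *\<^sub>R (A - mat 1)) = A"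
    "1 + (1 - r) * ((1 / (1 - r)) *\<^sub>R (\<alpha> - 1)) = \<alpha>" "(1 - r) *\<^sub>R ((1 / (1 - r)) *\<^sub>R v) = v"
    using r by simp_all
  define H where "H x = (\<integral>\<^sup>+y. loss ?F y (q x) * weight r (?T x, inverse \<alpha> * y) \<partial>lborel)" for x
  have "(\<integral>\<^sup>+y\<in>{0<..}. ext_by_limits (rescaled f r) (ereal y / ereal (h x powr (1 / s))) *
      ext_by_limits (rescaled g r) (ereal ((norm (?T x))\<^sup>2 + (inverse \<alpha> * y)\<^sup>2 - 1) / ereal (2 * h (?T x) powr (2 / s)) + 1)
      \<partial>lborel) = H x" for x
    unfolding H_def
  proof (rule nn_integral_cong)
    fix y :: real
    show "ext_by_limits (rescaled f r) (ereal y / ereal (h x powr (1 / s))) *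
      ext_by_limits (rescaled g r) (ereal ((norm (?T x))\<^sup>2 + (inverse \<alpha> * y)\<^sup>2 - 1) / ereal (2 * h (?T x) powr (2 / s)) + 1) *
      indicator {0<..} y = loss ?F y (q x) * weight r (?T x, inverse \<alpha> * y)"
    proof (cases "0 < y")
      case True
      then have "0 < inverse \<alpha> * y" using fe by simp
      then show ?thesis
        using ext_rescaled_f[OF r(2) True, of "q x"] ext_rescaled_g[OF r(2), of "inverse \<alpha> * y" "?T x"] True
        by (simp add: q_def)
    next
      case False
      then have "inverse \<alpha> * y \<le> 0" using fe by (simp add: mult_nonneg_nonpos)
      then show ?thesis using False by (simp add: weight_def)
    qed
  qed
  then have "I_bar s h f g r (renormalize r p) = ennreal (\<alpha> powr (s - 1) / (1 - r)) * (\<integral>\<^sup>+x. H x \<partial>lborel)"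
    unfolding I_bar_def ren prod.case Let_def par by simp
  also have "(\<integral>\<^sup>+x. H x \<partial>lborel) = ennreal (det A) * (\<integral>\<^sup>+x. H (A *v x + v) \<partial>lborel)"
  proof (rule nn_integral_affine_spd[OF fe(1)])
    have "(\<lambda>(x, y). loss ?F y (q x) * weight r (?T x, inverse \<alpha> * y)) \<in> borel_measurable (borel \<Otimes>\<^sub>M lborel)"
      by measurable
    then show "H \<in> borel_measurable borel"
      unfolding H_def by (rule lborel.borel_measurable_nn_integral)
  qed
  also have "(\<integral>\<^sup>+x. H (A *v x + v) \<partial>lborel)
      = (\<integral>\<^sup>+x. ennreal \<alpha> * (\<integral>\<^sup>+y. loss ?F (\<alpha> * y) (q (A *v x + v)) * weight r (x, y) \<partial>lborel) \<partial>lborel)"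
  proof (rule nn_integral_cong)
    fix x
    have "H (A *v x + v) = (\<integral>\<^sup>+y. loss ?F y (q (A *v x + v)) * weight r (x, inverse \<alpha> * y) \<partial>lborel)"
      using matrix_inv_vector_mult(2)[OF inv] by (simp add: H_def)
    also have "\<dots> = ennreal \<bar>\<alpha>\<bar> * (\<integral>\<^sup>+y. loss ?F (0 + \<alpha> * y) (q (A *v x + v)) * weight r (x, inverse \<alpha> * (0 + \<alpha> * y)) \<partial>lborel)"
      using fe(2) by (intro nn_integral_real_affine) auto
    finally show "H (A *v x + v) = ennreal \<alpha> * (\<integral>\<^sup>+y. loss ?F (\<alpha> * y) (q (A *v x + v)) * weight r (x, y) \<partial>lborel)"
      using fe(2) by (simp flip: mult.assoc)
  qed
  also have "\<dots> = ennreal \<alpha> * (\<integral>\<^sup>+x. \<integral>\<^sup>+y. loss ?F (\<alpha> * y) (q (A *v x + v)) * weight r (x, y) \<partial>lborel \<partial>lborel)"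
  proof (rule nn_integral_cmult)
    have "(\<lambda>(x, y). loss ?F (\<alpha> * y) (q (A *v x + v)) * weight r (x, y)) \<in> borel_measurable (lborel \<Otimes>\<^sub>M lborel)"
      by measurable
    then show "(\<lambda>x. \<integral>\<^sup>+y. loss ?F (\<alpha> * y) (q (A *v x + v)) * weight r (x, y) \<partial>lborel) \<in> borel_measurable lborel"
      by (rule lborel.borel_measurable_nn_integral)
  qed
  also have "ennreal (\<alpha> powr (s - 1) / (1 - r)) * (ennreal (det A) * (ennreal \<alpha> * I)) = ennreal (1 / (1 - r)) * I" for I
  proof -
    have "\<alpha> powr (s - 1) / (1 - r) * (det A * \<alpha>) = (\<alpha> powr (s - 1) * \<alpha>) * det A / (1 - r)" by simp
    also have "\<alpha> powr (s - 1) * \<alpha> = \<alpha> powr s" using fe(2) by (simp add: powr_diff)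
    finally have "\<alpha> powr (s - 1) / (1 - r) * (det A * \<alpha>) = 1 / (1 - r)" using fe(3) by simp
    then have "ennreal (\<alpha> powr (s - 1) / (1 - r)) * (ennreal (det A) * ennreal \<alpha>) = ennreal (1 / (1 - r))"
      using r fe(2) detA by (simp flip: ennreal_mult)
    then show ?thesis by (simp flip: mult.assoc)
  qed
  also have "ennreal (1 / (1 - r)) * (\<integral>\<^sup>+x. \<integral>\<^sup>+y. loss ?F (\<alpha> * y) (q (A *v x + v)) * weight r (x, y) \<partial>lborel \<partial>lborel)
      = L_bar s h f g r p" unfolding pA by (rule L_bar_eq[OF r(2) fe(2), symmetric])
  finally show ?thesis .
qed

lemma minimizer_on_renormalize_iff:
  assumes r: "1/2 < r" "r < 1" and p: "p \<in> feasible s"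
  shows "minimizer_on (I_bar s h f g r) (renormalize r ` feasible s) (renormalize r p) \<longleftrightarrow>
    minimizer_on (L_bar s h f g r) (feasible s) p"
  using p unfolding is_arg_min_def by (auto simp: I_bar_renormalize[OF r])

lemma I_bar_unique_min:
  assumes r: "1/2 < r" "r < 1"
  shows "unique_min_up_to_translation (I_bar s h f g r) (renormalize r ` feasible s)"
  unfolding unique_min_up_to_translation_def
proof (intro conjI allI impI)
  obtain p where p: "minimizer_on (L_bar s h f g r) (feasible s) p" using L_bar_minimizer_exists[OF r] by blast
  then have "p \<in> feasible s" by (simp add: is_arg_min_def)
  then show "\<exists>p. minimizer_on (I_bar s h f g r) (renormalize r ` feasible s) p"
    using p minimizer_on_renormalize_iff[OF r] by blast
  fix p1 p2
  assume min: "minimizer_on (I_bar s h f g r) (renormalize r ` feasible s) p1 \<and>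
    minimizer_on (I_bar s h f g r) (renormalize r ` feasible s) p2"
  then obtain p1' p2' where p': "p1 = renormalize r p1'" "p1' \<in> feasible s" "p2 = renormalize r p2'" "p2' \<in> feasible s"
    unfolding is_arg_min_def by blast
  then have "minimizer_on (L_bar s h f g r) (feasible s) p1'" "minimizer_on (L_bar s h f g r) (feasible s) p2'"
    using min minimizer_on_renormalize_iff[OF r] by auto
  then have "fst p1' = fst p2'" using L_bar_unique_min[OF r] unfolding unique_min_up_to_translation_def by blast
  then show "fst p1 = fst p2" by (simp add: p' renormalize_def case_prod_unfold)
qed

lemma s_trace_minimizers_tendsto:
  assumes min: "\<And>r. r \<in> {1/2<..<1} \<Longrightarrow> minimizer_on (L_bar s h f g r) (feasible s) (p r)"
  shows "((\<lambda>r. s_trace s ((1 / frobenius_norm (fst (renormalize r (p r)))) *\<^sub>R fst (renormalize r (p r)))) \<longlongrightarrow> 0) (at_left 1)"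
proof -
  have "((\<lambda>r. fst (p r)) \<longlongrightarrow> (mat 1, 1)) (at_left 1)"
    using tendsto_fst[OF L_bar_minimizers_tendsto[OF min]] by simp
  moreover have ev: "eventually (\<lambda>r::real. r \<in> {1/2<..<1}) (at_left 1)" by (rule eventually_at_left_real) simp
  have "eventually (\<lambda>r. fst (p r) \<in> SL s) (at_left 1)"
    using ev by eventually_elim (use min in \<open>force simp: is_arg_min_def feasible_def\<close>)
  moreover have "eventually (\<lambda>r::real. 0 < 1 / (1 - r)) (at_left 1)"
    using ev by eventually_elim auto
  ultimately have "((\<lambda>r. s_trace s ((1 / frobenius_norm ((1 / (1 - r)) *\<^sub>R (fst (p r) - (mat 1, 1)))) *\<^sub>R
      ((1 / (1 - r)) *\<^sub>R (fst (p r) - (mat 1, 1))))) \<longlongrightarrow> 0) (at_left 1)"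
    by (rule s_trace_normalized_tendsto)
  then show ?thesis by (simp add: renormalize_def case_prod_unfold)
qed

end

theorem theorem1p6:
  fixes s :: real and h :: "real ^ 'n \<Rightarrow> real" and f g :: "real \<Rightarrow> real"
  assumes "s > 0"
    and "proper_log_concave h"
    and "John_s_ellipsoid s h (cball 0 1)"
    and "locally_lipschitz f" and "convex_on UNIV f"
    and "\<And>x. x \<le> -1 \<Longrightarrow> f x = 0" and "strict_mono_on {-1..} f"
    and "locally_lipschitz g" and "antimono g"
    and "\<And>x. x \<le> -1 \<Longrightarrow> g x = 1"
    and "\<And>x. -1 < x \<Longrightarrow> x < 1 \<Longrightarrow> g x > 0"
    and "\<And>x. x \<ge> 1 \<Longrightarrow> g x = 0"
  shows
    "(\<forall>r\<in>{1/2<..<1}. unique_min_up_to_translation (L_bar s h f g r) (feasible s)) \<and>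
     (\<forall>r\<in>{1/2<..<1}.
        unique_min_up_to_translation (I_bar s h f g r) (renormalize r ` feasible s)) \<and>
     (\<forall>p :: real \<Rightarrow> 'n block \<times> (real ^ 'n).
        (\<forall>r\<in>{1/2<..<1}. minimizer_on (L_bar s h f g r) (feasible s) (p r)) \<longrightarrow>
          (p \<longlongrightarrow> ((mat 1, 1), 0)) (at_left 1) \<and>
          (\<forall>r\<in>{1/2<..<1}.
             minimizer_on (I_bar s h f g r) (renormalize r ` feasible s) (renormalize r (p r))) \<and>
          ((\<lambda>r. s_trace s ((1 / frobenius_norm (fst (renormalize r (p r)))) *\<^sub>R
                   fst (renormalize r (p r)))) \<longlongrightarrow> 0) (at_left 1))"
proof -
  interpret john_losses s h f g
    by unfold_locales (fact assms)+
  show ?thesis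
    using L_bar_unique_min I_bar_unique_min L_bar_minimizers_tendsto s_trace_minimizers_tendsto
      minimizer_on_renormalize_iff
    by (auto simp: is_arg_min_def)
qed

end
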